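(* Let $n\ge4$. The algebra $\widehat{TL}(D_n)$ over the ring $\mathbb{Z}[\delta]$ is cellular.
   Context: **Coxeter graph of type $D_n$.** Vertices $s_{\overline{1}},s_1,s_2,\dots,s_{n-1}$; edges join $s_{\overline 1}$ to $s_2$, and $s_i$ to $s_{i+1}$ for $1\le i\le n-2$. **The algebras.** $TL(D_n)$ is the unital $\mathbb{Z}[\delta]$-algebra generated by $b_{\overline{1}},b_1,\dots,b_{n-1}$ with relations $b_i^2=\delta b_i$ for all $i$; $b_ib_j=b_jb_i$ if $s_i\neq s_j$ are not connected in the Coxeter graph; $b_ib_jb_i=b_i$ if $s_i,s_j$ are connected in the Coxeter graph. Here $\delta$ is an indeterminate. The pair-free Temperley--Lieb algebra $\widehat{TL}(D_n)$ is the quotient of $TL(D_n)$ by the additional relation $b_1b_{\overline{1}}=0$. **Cellular algebra.** A cellular algebra over a commutative ring $R$ with identity is an associative unital $R$-algebra $A$ with a cell datum $(\Lambda,M,C,* )$ such that: (1) $\Lambda$ is a poset, for each $\lambda\in\Lambda$ the set $M(\lambda)$ is finite, and $C:\coprod_{\lambda\in\Lambda}(M(\lambda)\times M(\lambda))\to A$ is injective with image an $R$-basis of $A$; (2) writing $C(S,T)=C^\lambda_{S,T}$ for $S,T\in M(\lambda)$, $*$ is an $R$-linear involutory anti-automorphism of $A$ with $(C^\lambda_{S,T})^*=C^\lambda_{T,S}$; (3) for $\lambda\in\Lambda$, $S,T\in M(\lambda)$ and $a\in A$, $aC^\lambda_{S,T}\equiv\sum_{S'\in M(\lambda)}r_a(S',S)C^\lambda_{S',T}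 \mod A(<\lambda)$, where $r_a(S',S)\in R$ is independent of $T$ and $A(<\lambda)$ is the $R$-submodule generated by $\{C^\mu_{S'',T''}:\mu<\lambda,\ S'',T''\in M(\mu)\}$. *)

theory Defs
  imports
    "HOL-Algebra.QuotRing"
    "HOL-Algebra.Module"
    "HOL-Algebra.Algebraic_Closure_Type"
    "HOL-Library.Poly_Mapping"
    "HOL-Computational_Algebra.Polynomial"
begin

section \<open>Associative algebras\<close>

text \<open>The locale \<open>algebra\<close> of HOL-Algebra requires commutativity, hence this variant.\<close>

locale assoc_algebra = Module.module R A + Ring.ring A
  for R (structure) and A (structure) +
  assumes smult_mult_left:
      "\<lbrakk>c \<in> carrier R; x \<in> carrier A; y \<in> carrier A\<rbrakk>
        \<Longrightarrow> (c \<odot>\<^bsub>A\<^esub> x) \<otimes>\<^bsub>A\<^esub> y = c \<odot>\<^bsub>A\<^esub> (x \<otimes>\<^bsub>A\<^esub> y)"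
    and smult_mult_right:
      "\<lbrakk>c \<in> carrier R; x \<in> carrier A; y \<in> carrier A\<rbrakk>
        \<Longrightarrow> x \<otimes>\<^bsub>A\<^esub> (c \<odot>\<^bsub>A\<^esub> y) = c \<odot>\<^bsub>A\<^esub> (x \<otimes>\<^bsub>A\<^esub> y)"

definition generated_submodule ::
    "('r, 'p) ring_scheme \<Rightarrow> ('r, 'a, 'q) module_scheme \<Rightarrow> 'a set \<Rightarrow> 'a set" where
  "generated_submodule R A B = (\<lambda>N. submodule N R A) hull B"

definition linearly_independent ::
    "('r, 'p) ring_scheme \<Rightarrow> ('r, 'a, 'q) module_scheme \<Rightarrow> 'a set \<Rightarrow> bool" where
  "linearly_independent R A B \<longleftrightarrow>
    (\<forall>F c. finite F \<longrightarrow> F \<subseteq> B \<longrightarrow> c \<in> F \<rightarrow> carrier R \<longrightarrow>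
      (\<Oplus>\<^bsub>A\<^esub>b\<in>F. c b \<odot>\<^bsub>A\<^esub> b) = \<zero>\<^bsub>A\<^esub> \<longrightarrow> (\<forall>b\<in>F. c b = \<zero>\<^bsub>R\<^esub>))"

definition module_basis ::
    "('r, 'p) ring_scheme \<Rightarrow> ('r, 'a, 'q) module_scheme \<Rightarrow> 'a set \<Rightarrow> bool" where
  "module_basis R A B \<longleftrightarrow>
    B \<subseteq> carrier A \<and> linearly_independent R A B \<and> generated_submodule R A B = carrier A"


section \<open>Cellular algebras\<close>

definition cell_lower ::
    "('r, 'p) ring_scheme \<Rightarrow> ('r, 'a, 'q) module_scheme \<Rightarrow> 'l set \<Rightarrow> 'l rel \<Rightarrow>
      ('l \<Rightarrow> 'm set) \<Rightarrow> ('l \<Rightarrow> 'm \<Rightarrow> 'm \<Rightarrow> 'a) \<Rightarrow> 'l \<Rightarrow> 'a set" where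
  "cell_lower R A \<Lambda> leq M C l =
    generated_submodule R A
      {C k U V | k U V. k \<in> \<Lambda> \<and> (k, l) \<in> leq \<and> k \<noteq> l \<and> U \<in> M k \<and> V \<in> M k}"

locale cell_datum = assoc_algebra R A
  for R :: "('r, 'p) ring_scheme" (structure) and A :: "('r, 'a, 'q) module_scheme" (structure) +
  fixes \<Lambda> :: "'l set" and leq :: "'l rel" and M :: "'l \<Rightarrow> 'm set"
    and C :: "'l \<Rightarrow> 'm \<Rightarrow> 'm \<Rightarrow> 'a" and star :: "'a \<Rightarrow> 'a"
  assumes poset: "partial_order_on \<Lambda> leq"
    and finite_M: "l \<in> \<Lambda> \<Longrightarrow> finite (M l)"
    and C_inj: "inj_on (\<lambda>(l, S, T). C l S T) (SIGMA l:\<Lambda>. M l \<times> M l)"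
    and C_basis: "module_basis R A ((\<lambda>(l, S, T). C l S T) ` (SIGMA l:\<Lambda>. M l \<times> M l))"
    and star_closed: "x \<in> carrier A \<Longrightarrow> star x \<in> carrier A"
    and star_add: "\<lbrakk>x \<in> carrier A; y \<in> carrier A\<rbrakk> \<Longrightarrow> star (x \<oplus>\<^bsub>A\<^esub> y) = star x \<oplus>\<^bsub>A\<^esub> star y"
    and star_smult: "\<lbrakk>c \<in> carrier R; x \<in> carrier A\<rbrakk> \<Longrightarrow> star (c \<odot>\<^bsub>A\<^esub> x) = c \<odot>\<^bsub>A\<^esub> star x"
    and star_mult: "\<lbrakk>x \<in> carrier A; y \<in> carrier A\<rbrakk> \<Longrightarrow> star (x \<otimes>\<^bsub>A\<^esub> y) = star y \<otimes>\<^bsub>A\<^esub> star x"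
    and star_star: "x \<in> carrier A \<Longrightarrow> star (star x) = x"
    and star_C: "\<lbrakk>l \<in> \<Lambda>; S \<in> M l; T \<in> M l\<rbrakk> \<Longrightarrow> star (C l S T) = C l T S"
    and C_mult: "\<lbrakk>l \<in> \<Lambda>; a \<in> carrier A\<rbrakk> \<Longrightarrow>
      \<exists>r. (\<forall>S'\<in>M l. \<forall>S\<in>M l. r S' S \<in> carrier R) \<and>
        (\<forall>S\<in>M l. \<forall>T\<in>M l.
          a \<otimes>\<^bsub>A\<^esub> C l S T \<ominus>\<^bsub>A\<^esub> (\<Oplus>\<^bsub>A\<^esub>S'\<in>M l. r S' S \<odot>\<^bsub>A\<^esub> C l S' T)
            \<in> cell_lower R A \<Lambda> leq M C l)"

text \<open>
  One cannot quantify existentially over the types of \<open>\<Lambda>\<close> and \<open>M \<lambda>\<close>. Taking both inside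
  the type of \<open>A\<close> loses nothing: \<open>S \<mapsto> C \<lambda> S S\<close> embeds the index sets into \<open>A\<close>, after discarding
  those \<open>\<lambda>\<close> with \<open>M \<lambda> = {}\<close>; see \<open>cellular_algebraI\<close> below.
\<close>

definition cellular_algebra ::
    "('r, 'p) ring_scheme \<Rightarrow> ('r, 'a, 'q) module_scheme \<Rightarrow> bool" where
  "cellular_algebra R A \<longleftrightarrow>
    (\<exists>(\<Lambda> :: 'a set) (leq :: 'a rel) (M :: 'a \<Rightarrow> 'a set) (C :: 'a \<Rightarrow> 'a \<Rightarrow> 'a \<Rightarrow> 'a) star.
      cell_datum R A \<Lambda> leq M C star)"

lemma cellular_algebraI:
  fixes \<Lambda> :: "'l set" and M :: "'l \<Rightarrow> 'm set" and R :: "('r, 'p) ring_scheme"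
    and A :: "('r, 'a, 'q) module_scheme"
  assumes "cell_datum R A \<Lambda> leq M C star"
  shows "cellular_algebra R A"
proof -
  interpret cell_datum R A \<Lambda> leq M C star by fact
  define L where "L = {l \<in> \<Lambda>. M l \<noteq> {}}"
  define f where "f l = (let s = SOME s. s \<in> M l in C l s s)" for l
  have some: "(SOME s. s \<in> M l) \<in> M l" if "l \<in> L" for l
    using that by (simp add: L_def some_in_eq)
  have Cinj: "l = l' \<and> S = S' \<and> T = T'"
    if "C l S T = C l' S' T'" "l \<in> \<Lambda>" "l' \<in> \<Lambda>" "S \<in> M l" "T \<in> M l" "S' \<in> M l'" "T' \<in> M l'"
    for l l' S S' T T'
    using inj_onD[OF C_inj, of "(l, S, T)" "(l', S', T')"] that by auto
  have f_inj: "inj_on f L"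
    using Cinj some by (auto simp: inj_on_def f_def Let_def L_def)
  define fi where "fi = inv_into L f"
  have fi: "fi (f l) = l" if "l \<in> L" for l
    using that f_inj by (simp add: fi_def)
  define g where "g l s = C l s s" for l s
  define gi where "gi l = inv_into (M l) (g l)" for l
  have g_inj: "inj_on (g l) (M l)" if "l \<in> L" for l
    using Cinj that by (auto simp: inj_on_def g_def L_def)
  have gi: "gi l (g l s) = s" if "l \<in> L" "s \<in> M l" for l s
    using that g_inj by (simp add: gi_def)
  define M' where "M' x = g (fi x) ` M (fi x)" for x
  define C' where "C' x y z = C (fi x) (gi (fi x) y) (gi (fi x) z)" for x y z
  define leq' where "leq' = {(f k, f l) | k l. k \<in> L \<and> l \<in> L \<and> (k, l) \<in> leq}"
  have L: "l \<in> \<Lambda>" if "l \<in> L" for l using that by (simp add: L_def)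
  have M'f: "M' (f l) = g l ` M l" if "l \<in> L" for l using that by (simp add: M'_def fi)
  have C'f: "C' (f l) (g l S) (g l T) = C l S T" if "l \<in> L" "S \<in> M l" "T \<in> M l" for l S T
    using that by (simp add: C'_def fi gi)
  have leq'f: "(f k, f l) \<in> leq' \<longleftrightarrow> (k, l) \<in> leq" if "k \<in> L" "l \<in> L" for k l
    using that inj_onD[OF f_inj] unfolding leq'_def by blast
  have f_eq: "f k = f l \<longleftrightarrow> k = l" if "k \<in> L" "l \<in> L" for k l
    using that inj_onD[OF f_inj] by blast
  have gens: "{C' k U V | k U V. k \<in> f ` L \<and> (k, f l) \<in> leq' \<and> k \<noteq> f l \<and> U \<in> M' k \<and> V \<in> M' k}
    = {C k U V | k U V. k \<in> \<Lambda> \<and> (k, l) \<in> leq \<and> k \<noteq> l \<and> U \<in> M k \<and> V \<in> M k}"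
    (is "?X = ?Y") if l: "l \<in> L" for l
  proof (intro equalityI subsetI)
    fix x assume "x \<in> ?X"
    then obtain k U V where "k \<in> L" "(f k, f l) \<in> leq'" "f k \<noteq> f l" "U \<in> M k" "V \<in> M k"
      "x = C' (f k) (g k U) (g k V)"
      by (auto simp: M'f)
    then show "x \<in> ?Y" using l
      by (intro CollectI exI[of _ k] exI[of _ U] exI[of _ V]) (auto simp: C'f leq'f L)
  next
    fix x assume "x \<in> ?Y"
    then obtain k U V where k: "k \<in> \<Lambda>" "(k, l) \<in> leq" "k \<noteq> l" "U \<in> M k" "V \<in> M k" "x = C k U V"
      by auto
    then have "k \<in> L" by (auto simp: L_def)
    then show "x \<in> ?X" using l k
      by (intro CollectI exI[of _ "f k"] exI[of _ "g k U"] exI[of _ "g k V"])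
         (auto simp: C'f leq'f f_eq M'f)
  qed
  have lower: "cell_lower R A (f ` L) leq' M' C' (f l) = cell_lower R A \<Lambda> leq M C l" if "l \<in> L" for l
    unfolding cell_lower_def gens[OF that] ..
  have image: "(\<lambda>(l, S, T). C' l S T) ` (SIGMA l:f ` L. M' l \<times> M' l)
    = (\<lambda>(l, S, T). C l S T) ` (SIGMA l:\<Lambda>. M l \<times> M l)" (is "?X = ?Y")
  proof (intro equalityI subsetI)
    fix x assume "x \<in> ?X"
    then obtain l S T where "l \<in> L" "S \<in> M l" "T \<in> M l" "x = C l S T"
      by (auto simp: M'f C'f)
    then show "x \<in> ?Y"
      by (intro image_eqI[where x = "(l, S, T)"]) (auto simp: L)
  next
    fix x assume "x \<in> ?Y"
    then obtain l S T where l: "l \<in> \<Lambda>" "S \<in> M l" "T \<in> M l" "x = C l S T" by auto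
    then have "l \<in> L" by (auto simp: L_def)
    with l show "x \<in> ?X"
      by (intro image_eqI[where x = "(f l, g l S, g l T)"]) (auto simp: M'f C'f)
  qed
  have C_closed: "C l S T \<in> carrier A" if "l \<in> \<Lambda>" "S \<in> M l" "T \<in> M l" for l S T
  proof -
    have "C l S T \<in> (\<lambda>(l, S, T). C l S T) ` (SIGMA l:\<Lambda>. M l \<times> M l)"
      using that by (intro image_eqI[where x = "(l, S, T)"]) auto
    then show ?thesis using C_basis unfolding module_basis_def by blast
  qed
  have "cell_datum R A (f ` L) leq' M' C' star"
  proof unfold_locales
    show "partial_order_on (f ` L) leq'"
      unfolding partial_order_on_def preorder_on_def
    proof (intro conjI)
      show "leq' \<subseteq> f ` L \<times> f ` L" by (auto simp: leq'_def)
      show "refl_on (f ` L) leq'"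
        using partial_order_onD(1)[OF poset] by (auto simp: refl_on_def leq'f L)
      show "trans leq'"
      proof (rule transI)
        fix x y z assume "(x, y) \<in> leq'" "(y, z) \<in> leq'"
        then obtain a b c where "x = f a" "y = f b" "z = f c" "a \<in> L" "b \<in> L" "c \<in> L"
          "(a, b) \<in> leq" "(b, c) \<in> leq"
          unfolding leq'_def using inj_onD[OF f_inj] by blast
        then show "(x, z) \<in> leq'"
          using transD[OF partial_order_onD(2)[OF poset]] by (auto simp: leq'f)
      qed
      show "antisym leq'"
      proof (rule antisymI)
        fix x y assume "(x, y) \<in> leq'" "(y, x) \<in> leq'"
        then obtain a b where "x = f a" "y = f b" "(a, b) \<in> leq" "(b, a) \<in> leq"
          unfolding leq'_def using inj_onD[OF f_inj] by blast
        then show "x = y" using antisymD[OF partial_order_onD(3)[OF poset]] by blast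
      qed
    qed
    show "finite (M' l)" if "l \<in> f ` L" for l
      using that by (auto simp: M'f L finite_M)
    show "inj_on (\<lambda>(l, S, T). C' l S T) (SIGMA l:f ` L. M' l \<times> M' l)"
    proof (rule inj_onI)
      fix x y
      assume x: "x \<in> (SIGMA l:f ` L. M' l \<times> M' l)" and y: "y \<in> (SIGMA l:f ` L. M' l \<times> M' l)"
        and eq: "(case x of (l, S, T) \<Rightarrow> C' l S T) = (case y of (l, S, T) \<Rightarrow> C' l S T)"
      obtain k S T where x': "k \<in> L" "S \<in> M k" "T \<in> M k" "x = (f k, g k S, g k T)"
        using x by (auto simp: M'f)
      obtain l U V where y': "l \<in> L" "U \<in> M l" "V \<in> M l" "y = (f l, g l U, g l V)"
        using y by (auto simp: M'f)
      have "C k S T = C l U V" using eq x' y' by (simp add: C'f)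
      from Cinj[OF this L[OF x'(1)] L[OF y'(1)] x'(2,3) y'(2,3)] show "x = y"
        using x' y' by simp
    qed
    show "module_basis R A ((\<lambda>(l, S, T). C' l S T) ` (SIGMA l:f ` L. M' l \<times> M' l))"
      unfolding image by (rule C_basis)
    show "star (C' l S T) = C' l T S" if "l \<in> f ` L" "S \<in> M' l" "T \<in> M' l" for l S T
      using that by (auto simp: M'f C'f star_C L)
    show "\<exists>r. (\<forall>S'\<in>M' l. \<forall>S\<in>M' l. r S' S \<in> carrier R) \<and>
        (\<forall>S\<in>M' l. \<forall>T\<in>M' l.
          a \<otimes>\<^bsub>A\<^esub> C' l S T \<ominus>\<^bsub>A\<^esub> (\<Oplus>\<^bsub>A\<^esub>S'\<in>M' l. r S' S \<odot>\<^bsub>A\<^esub> C' l S' T)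
            \<in> cell_lower R A (f ` L) leq' M' C' l)" if "l \<in> f ` L" and a: "a \<in> carrier A" for l a
    proof -
      obtain k where k: "k \<in> L" "l = f k" using \<open>l \<in> f ` L\<close> by auto
      obtain r where r: "\<And>S' S. S' \<in> M k \<Longrightarrow> S \<in> M k \<Longrightarrow> r S' S \<in> carrier R"
        "\<And>S T. S \<in> M k \<Longrightarrow> T \<in> M k \<Longrightarrow>
          a \<otimes>\<^bsub>A\<^esub> C k S T \<ominus>\<^bsub>A\<^esub> (\<Oplus>\<^bsub>A\<^esub>S'\<in>M k. r S' S \<odot>\<^bsub>A\<^esub> C k S' T) \<in> cell_lower R A \<Lambda> leq M C k"
        using C_mult[OF L[OF k(1)] a] by blast
      have sum: "(\<Oplus>\<^bsub>A\<^esub>S'\<in>g k ` M k. r (gi k S') S \<odot>\<^bsub>A\<^esub> C' (f k) S' (g k T))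
          = (\<Oplus>\<^bsub>A\<^esub>S'\<in>M k. r S' S \<odot>\<^bsub>A\<^esub> C k S' T)" if "S \<in> M k" "T \<in> M k" for S T
      proof -
        have "(\<Oplus>\<^bsub>A\<^esub>S'\<in>g k ` M k. r (gi k S') S \<odot>\<^bsub>A\<^esub> C' (f k) S' (g k T))
          = (\<Oplus>\<^bsub>A\<^esub>S'\<in>M k. r (gi k (g k S')) S \<odot>\<^bsub>A\<^esub> C' (f k) (g k S') (g k T))"
          using that k(1) r(1) C_closed L by (intro finsum_reindex g_inj) (auto simp: gi C'f)
        also have "\<dots> = (\<Oplus>\<^bsub>A\<^esub>S'\<in>M k. r S' S \<odot>\<^bsub>A\<^esub> C k S' T)"
          using that k(1) r(1) C_closed L by (intro finsum_cong') (auto simp: gi C'f)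
        finally show ?thesis .
      qed
      show ?thesis
        unfolding k(2) M'f[OF k(1)] lower[OF k(1)]
        by (rule exI[of _ "\<lambda>S' S. r (gi k S') (gi k S)"])
           (auto simp: gi k(1) C'f sum r)
    qed
  qed (simp_all add: star_closed star_add star_smult star_mult star_star)
  then show ?thesis unfolding cellular_algebra_def by (intro exI)
qed


section \<open>Free algebras and quotient algebras\<close>

text \<open>
  The free monoid on \<open>'v\<close>, written additively so that \<open>'v free_word \<Rightarrow>\<^sub>0 'r\<close> with its convolution
  product is the free \<open>'r\<close>-algebra on \<open>'v\<close>.
\<close>

datatype 'v free_word = Word (letters: "'v list")

instantiation free_word :: (type) monoid_add
begin

definition zero_free_word :: "'a free_word" where
  "0 = Word []"

definition plus_free_word :: "'a free_word \<Rightarrow> 'a free_word \<Rightarrow> 'a free_word" where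
  "u + v = Word (letters u @ letters v)"

instance
  by standard (simp_all add: zero_free_word_def plus_free_word_def)

end

definition free_algebra :: "'v set \<Rightarrow> ('r::comm_ring_1, 'v free_word \<Rightarrow>\<^sub>0 'r) module" where
  "free_algebra V =
    \<lparr>carrier = {f. \<forall>w\<in>Poly_Mapping.keys f. set (letters w) \<subseteq> V},
     monoid.mult = (*), one = 1, zero = 0, add = (+),
     module.smult = (\<lambda>c. Poly_Mapping.map ((*) c))\<rparr>"

definition free_gen :: "'v \<Rightarrow> ('v free_word \<Rightarrow>\<^sub>0 'r::comm_ring_1)" where
  "free_gen v = Poly_Mapping.single (Word [v]) 1"

definition quotient_algebra ::
    "('r, 'a) module \<Rightarrow> 'a set \<Rightarrow> ('r, 'a set) module" where
  "quotient_algebra A I =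
    ring.extend (A Quot I) (module.fields (\<lambda>c K. \<Union>x\<in>K. I +>\<^bsub>A\<^esub> (c \<odot>\<^bsub>A\<^esub> x)))"

lemma single_zero_mult_commute: "f * Poly_Mapping.single 0 c = Poly_Mapping.single 0 c * f"
  for f :: "'v free_word \<Rightarrow>\<^sub>0 'r::comm_ring_1"
proof (induction f rule: update_induct)
  case (update f a b)
  have "Poly_Mapping.update a b f = f + Poly_Mapping.single a b"
    using update by (intro poly_mapping_eqI) (auto simp: lookup_update lookup_add lookup_single in_keys_iff when_def)
  then show ?case
    using update by (simp add: mult_single distrib_left distrib_right mult.commute)
qed simp

lemma assoc_algebra_free_algebra:
  "assoc_algebra ring_of_type_algebra (free_algebra V :: ('r::comm_ring_1, 'v free_word \<Rightarrow>\<^sub>0 'r) module)"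
proof -
  let ?R = "ring_of_type_algebra :: 'r ring"
  let ?F = "free_algebra V :: ('r, 'v free_word \<Rightarrow>\<^sub>0 'r) module"
  have cR: "cring ?R" ..
  have keys_closed: "f * g \<in> carrier ?F" if "f \<in> carrier ?F" "g \<in> carrier ?F" for f g
    using that keys_mult[of f g] by (fastforce simp: free_algebra_def plus_free_word_def)
  have add_closed: "f + g \<in> carrier ?F" if "f \<in> carrier ?F" "g \<in> carrier ?F" for f g
    using that keys_add[of f g] by (auto simp: free_algebra_def)
  have sel: "monoid.mult ?F = (*)" "one ?F = 1" "zero ?F = 0" "add ?F = (+)"
    by (simp_all add: free_algebra_def)
  have uminus_closed: "- f \<in> carrier ?F" if "f \<in> carrier ?F" for f
    using that by (simp add: free_algebra_def)
  have zero_one: "0 \<in> carrier ?F" "1 \<in> carrier ?F"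
    by (auto simp: free_algebra_def zero_free_word_def split: if_splits)
  have rF: "Ring.ring ?F"
  proof (rule ringI)
    show "abelian_group ?F"
    proof (rule abelian_groupI)
      fix x assume "x \<in> carrier ?F"
      then show "\<exists>y\<in>carrier ?F. y \<oplus>\<^bsub>?F\<^esub> x = \<zero>\<^bsub>?F\<^esub>"
        by (intro bexI[of _ "- x"]) (simp_all add: sel uminus_closed)
    qed (simp_all add: sel add_closed zero_one add.assoc add.commute)
    show "Group.monoid ?F"
      by unfold_locales (simp_all add: sel keys_closed zero_one mult.assoc)
  qed (simp_all add: sel distrib_left distrib_right)
  then interpret F: Ring.ring ?F .
  have sc: "Poly_Mapping.single 0 c \<in> carrier ?F" for c
    by (auto simp: free_algebra_def zero_free_word_def)
  have sm: "c \<odot>\<^bsub>?F\<^esub> f = Poly_Mapping.single 0 c * f" for c f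
    by (simp add: free_algebra_def mult_map_scale_conv_mult)
  have R: "monoid.mult ?R = (*)" "one ?R = 1" "add ?R = (+)"
    by (simp_all add: ring_of_type_algebra_def)
  have "Module.module ?R ?F"
  proof (rule Module.moduleI[OF cR F.abelian_group_axioms])
    show "(c \<otimes>\<^bsub>?R\<^esub> d) \<odot>\<^bsub>?F\<^esub> x = c \<odot>\<^bsub>?F\<^esub> (d \<odot>\<^bsub>?F\<^esub> x)" for c d x
      unfolding sm R mult.assoc[symmetric] mult_single by simp
  qed (simp_all add: sm sel R keys_closed sc distrib_left distrib_right single_add)
  moreover have "f * (Poly_Mapping.single 0 c * g) = Poly_Mapping.single 0 c * (f * g)"
    for c and f g :: "'v free_word \<Rightarrow>\<^sub>0 'r"
    using single_zero_mult_commute[of f c] by (metis mult.assoc)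
  ultimately show ?thesis
    by (intro assoc_algebra.intro rF assoc_algebra_axioms.intro) (simp_all add: sm sel mult.assoc)
qed

lemma assoc_algebra_quotient_algebra:
  assumes "assoc_algebra R A" and "ideal I A"
  shows "assoc_algebra R (quotient_algebra A I)"
proof -
  interpret A: assoc_algebra R A by fact
  interpret I: ideal I A by fact
  let ?Q = "quotient_algebra A I"
  note Qs = quotient_algebra_def ring.defs module.defs FactRing_def
  have sel: "carrier ?Q = carrier (A Quot I)" "monoid.mult ?Q = monoid.mult (A Quot I)"
    "one ?Q = one (A Quot I)" "zero ?Q = zero (A Quot I)" "add ?Q = add (A Quot I)"
    by (simp_all add: Qs)
  have rQ: "Ring.ring ?Q"
  proof -
    interpret Q: Ring.ring "A Quot I" by (rule I.quotient_is_ring)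
    show ?thesis
    proof (rule ringI)
      show "abelian_group ?Q"
      proof (rule abelian_groupI)
        fix x assume "x \<in> carrier ?Q"
        then show "\<exists>y\<in>carrier ?Q. y \<oplus>\<^bsub>?Q\<^esub> x = \<zero>\<^bsub>?Q\<^esub>"
          by (intro bexI[of _ "\<ominus>\<^bsub>A Quot I\<^esub> x"]) (simp_all add: sel Q.l_neg)
      qed (simp_all add: sel Q.a_ac)
      show "Group.monoid ?Q"
        by unfold_locales (simp_all add: sel Q.m_assoc)
    qed (simp_all add: sel Q.l_distr Q.r_distr)
  qed
  then interpret Q: Ring.ring ?Q .
  have smI: "c \<odot>\<^bsub>A\<^esub> i \<in> I" if "c \<in> carrier R" "i \<in> I" for c i
  proof -
    have "(c \<odot>\<^bsub>A\<^esub> \<one>\<^bsub>A\<^esub>) \<otimes>\<^bsub>A\<^esub> i \<in> I"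
      using that by (intro I.I_l_closed) auto
    then show ?thesis using that I.a_subset by (simp add: A.smult_mult_left subset_iff)
  qed
  have sm: "c \<odot>\<^bsub>?Q\<^esub> (I +>\<^bsub>A\<^esub> x) = I +>\<^bsub>A\<^esub> (c \<odot>\<^bsub>A\<^esub> x)" if c: "c \<in> carrier R" and x: "x \<in> carrier A" for c x
  proof -
    have "I +>\<^bsub>A\<^esub> (c \<odot>\<^bsub>A\<^esub> y) = I +>\<^bsub>A\<^esub> (c \<odot>\<^bsub>A\<^esub> x)" if y: "y \<in> I +>\<^bsub>A\<^esub> x" for y
    proof -
      obtain i where i: "i \<in> I" "y = i \<oplus>\<^bsub>A\<^esub> x" using y unfolding a_r_coset_def' by auto
      have iA: "i \<in> carrier A" using i I.a_subset by auto
      have "c \<odot>\<^bsub>A\<^esub> y = c \<odot>\<^bsub>A\<^esub> i \<oplus>\<^bsub>A\<^esub> c \<odot>\<^bsub>A\<^esub> x"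
        using i iA c x by (simp add: A.smult_r_distr)
      then have "c \<odot>\<^bsub>A\<^esub> y \<in> I +>\<^bsub>A\<^esub> (c \<odot>\<^bsub>A\<^esub> x)"
        using smI[OF c i(1)] unfolding a_r_coset_def' by auto
      then show ?thesis using c x by (metis A.smult_closed A.a_repr_independence I.a_subgroup)
    qed
    moreover have "x \<in> I +>\<^bsub>A\<^esub> x" using x by (rule I.a_rcos_self)
    ultimately have "(\<Union>y\<in>I +>\<^bsub>A\<^esub> x. I +>\<^bsub>A\<^esub> (c \<odot>\<^bsub>A\<^esub> y)) = I +>\<^bsub>A\<^esub> (c \<odot>\<^bsub>A\<^esub> x)"
      by blast
    then show ?thesis by (simp add: Qs)
  qed
  have C: "carrier ?Q = (\<lambda>x. I +>\<^bsub>A\<^esub> x) ` carrier A"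
    by (auto simp: sel FactRing_simps)
  have ops: "(I +>\<^bsub>A\<^esub> x) \<oplus>\<^bsub>?Q\<^esub> (I +>\<^bsub>A\<^esub> y) = I +>\<^bsub>A\<^esub> (x \<oplus>\<^bsub>A\<^esub> y)"
     "(I +>\<^bsub>A\<^esub> x) \<otimes>\<^bsub>?Q\<^esub> (I +>\<^bsub>A\<^esub> y) = I +>\<^bsub>A\<^esub> (x \<otimes>\<^bsub>A\<^esub> y)"
    if "x \<in> carrier A" "y \<in> carrier A" for x y
    using that by (simp_all add: sel FactRing_def I.rcoset_mult_add I.a_rcos_sum)
  have "Module.module R ?Q"
    by (rule Module.moduleI[OF A.R.is_cring Q.abelian_group_axioms])
       (auto simp: C sm ops A.smult_l_distr A.smult_r_distr A.smult_assoc1)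
  then show ?thesis
    by (intro assoc_algebra.intro rQ assoc_algebra_axioms.intro)
       (auto simp: C sm ops A.smult_mult_left A.smult_mult_right)
qed


section \<open>Temperley--Lieb algebras\<close>

abbreviation Z_delta :: "int poly ring" where
  "Z_delta \<equiv> ring_of_type_algebra"

definition delta :: "int poly" where
  "delta = [:0, 1:]"

text \<open>A graph is given by its vertex set \<open>V\<close> and its set \<open>E\<close> of two-element edges.\<close>

definition TL_relations :: "'v set \<Rightarrow> 'v set set \<Rightarrow> ('v free_word \<Rightarrow>\<^sub>0 int poly) set" where
  "TL_relations V E =
    {free_gen i * free_gen i - Poly_Mapping.map ((*) delta) (free_gen i) | i. i \<in> V} \<union>
    {free_gen i * free_gen j - free_gen j * free_gen i | i j.
      i \<in> V \<and> j \<in> V \<and> i \<noteq> j \<and> {i, j} \<notin> E} \<union>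
    {free_gen i * free_gen j * free_gen i - free_gen i | i j.
      i \<in> V \<and> j \<in> V \<and> {i, j} \<in> E}"

definition TL_ideal :: "'v set \<Rightarrow> 'v set set \<Rightarrow> ('v free_word \<Rightarrow>\<^sub>0 int poly) set" where
  "TL_ideal V E = Idl\<^bsub>free_algebra V\<^esub> (TL_relations V E)"

definition TL :: "'v set \<Rightarrow> 'v set set \<Rightarrow> (int poly, ('v free_word \<Rightarrow>\<^sub>0 int poly) set) module" where
  "TL V E = quotient_algebra (free_algebra V) (TL_ideal V E)"

definition TL_gen :: "'v set \<Rightarrow> 'v set set \<Rightarrow> 'v \<Rightarrow> ('v free_word \<Rightarrow>\<^sub>0 int poly) set" where
  "TL_gen V E v = TL_ideal V E +>\<^bsub>free_algebra V\<^esub> free_gen v"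

lemma delta_closed: "delta \<in> carrier Z_delta"
  by (simp add: ring_of_type_algebra_def)

lemma free_gen_in_free_algebra: "v \<in> V \<Longrightarrow> free_gen v \<in> carrier (free_algebra V)"
  by (simp add: free_gen_def free_algebra_def)

lemma TL_relations_in_free_algebra: "TL_relations V E \<subseteq> carrier (free_algebra V)"
proof -
  interpret F: assoc_algebra Z_delta "free_algebra V" by (rule assoc_algebra_free_algebra)
  have diff: "f - g \<in> carrier (free_algebra V)"
    if "f \<in> carrier (free_algebra V)" "g \<in> carrier (free_algebra V)"
    for f g :: "'a free_word \<Rightarrow>\<^sub>0 int poly"
    using that keys_diff[of f g] by (fastforce simp: free_algebra_def)
  have mult: "f * g \<in> carrier (free_algebra V)"
    if "f \<in> carrier (free_algebra V)" "g \<in> carrier (free_algebra V)"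
    for f g :: "'a free_word \<Rightarrow>\<^sub>0 int poly"
    using F.m_closed[OF that] by (simp add: free_algebra_def)
  have scale: "Poly_Mapping.map ((*) c) f \<in> carrier (free_algebra V)"
    if "f \<in> carrier (free_algebra V)"
    for c and f :: "'a free_word \<Rightarrow>\<^sub>0 int poly"
    using F.smult_closed[of c, OF _ that] by (simp add: free_algebra_def ring_of_type_algebra_def)
  show ?thesis
    unfolding TL_relations_def by (auto intro!: diff mult scale free_gen_in_free_algebra)
qed

lemma ideal_TL_ideal: "ideal (TL_ideal V E) (free_algebra V)"
proof -
  interpret F: assoc_algebra Z_delta "free_algebra V" by (rule assoc_algebra_free_algebra)
  show ?thesis
    unfolding TL_ideal_def by (rule F.genideal_ideal[OF TL_relations_in_free_algebra])
qed

lemma assoc_algebra_TL: "assoc_algebra Z_delta (TL V E)"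
  unfolding TL_def by (intro assoc_algebra_quotient_algebra assoc_algebra_free_algebra ideal_TL_ideal)

lemma TL_gen_closed: "v \<in> V \<Longrightarrow> TL_gen V E v \<in> carrier (TL V E)"
proof -
  interpret I: ideal "TL_ideal V E" "free_algebra V" by (rule ideal_TL_ideal)
  show "TL_gen V E v \<in> carrier (TL V E)" if "v \<in> V"
    using I.a_rcosetsI[OF I.a_subset free_gen_in_free_algebra[OF that]]
    by (simp add: TL_gen_def TL_def quotient_algebra_def ring.defs module.defs FactRing_def)
qed

datatype D_vertex = Node_bar | Node nat

definition D_vertices :: "nat \<Rightarrow> D_vertex set" where
  "D_vertices n = insert Node_bar (Node ` {1..n - 1})"

definition D_edges :: "nat \<Rightarrow> D_vertex set set" where
  "D_edges n = insert {Node_bar, Node 2} {{Node i, Node (i + 1)} | i. 1 \<le> i \<and> i \<le> n - 2}"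

abbreviation TL_D :: "nat \<Rightarrow> (int poly, (D_vertex free_word \<Rightarrow>\<^sub>0 int poly) set) module" where
  "TL_D n \<equiv> TL (D_vertices n) (D_edges n)"

abbreviation TL_D_gen :: "nat \<Rightarrow> D_vertex \<Rightarrow> (D_vertex free_word \<Rightarrow>\<^sub>0 int poly) set" where
  "TL_D_gen n \<equiv> TL_gen (D_vertices n) (D_edges n)"

definition pair_free_TL_D ::
    "nat \<Rightarrow> (int poly, (D_vertex free_word \<Rightarrow>\<^sub>0 int poly) set set) module" where
  "pair_free_TL_D n =
    quotient_algebra (TL_D n)
      (Idl\<^bsub>TL_D n\<^esub> {TL_D_gen n (Node 1) \<otimes>\<^bsub>TL_D n\<^esub> TL_D_gen n Node_bar})"

lemma ideal_pair_free:
  assumes "2 \<le> n"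
  shows "ideal (Idl\<^bsub>TL_D n\<^esub> {TL_D_gen n (Node 1) \<otimes>\<^bsub>TL_D n\<^esub> TL_D_gen n Node_bar}) (TL_D n)"
proof -
  interpret T: assoc_algebra Z_delta "TL_D n" by (rule assoc_algebra_TL)
  show ?thesis
    using assms T.m_closed[OF TL_gen_closed TL_gen_closed, of "Node 1" Node_bar]
    by (intro T.genideal_ideal) (auto simp: D_vertices_def)
qed

lemma assoc_algebra_pair_free_TL_D:
  "2 \<le> n \<Longrightarrow> assoc_algebra Z_delta (pair_free_TL_D n)"
  unfolding pair_free_TL_D_def
  by (intro assoc_algebra_quotient_algebra assoc_algebra_TL ideal_pair_free)

end

theory Submission
  imports Defs
begin

text \<open>
  In diagrammatic terms the algebra has as basis the planar diagrams on \<open>n\<close> strands with an even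
  number of decorations on left-exposed arcs, two decorations on an arc cancelling and a decorated
  loop being zero. Cutting the through strands leaves half diagrams, and these are read off
  from paths of length \<open>n\<close> in the infinite graph of type D: a step away from the ends opens a
  through strand, a step towards them closes the last one by an arc. The two end vertices record
  whether the diagram without through strands is decorated.

  For a path \<open>S\<close> from \<open>1\<close> to \<open>v\<close> let \<open>u\<^sub>S\<close> be the product of the elements
  \<open>g\<^sub>j\<^sub>,\<^sub>w = b\<^sub>t\<^sub>+\<^sub>1 b\<^sub>t\<^sub>+\<^sub>3 \<dots> b\<^sub>j\<^sub>-\<^sub>1\<close>, where \<open>w = S j\<close> has level \<open>t\<close>, for \<open>2 \<le> j < n\<close>. The cellular
  basis is \<open>u\<^sub>S g\<^sub>n\<^sub>,\<^sub>v u\<^sub>T\<^sup>*\<close>. That it spans follows by induction along the tower of algebras, as in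
  Jones's basic construction: up to scalars, \<open>A\<^sub>m\<^sub>+\<^sub>1 = A\<^sub>m \<union> A\<^sub>m b\<^sub>m A\<^sub>m\<close> and
  \<open>b\<^sub>m A\<^sub>m b\<^sub>m \<subseteq> A\<^sub>m\<^sub>-\<^sub>1 b\<^sub>m\<close> on monomials, so that \<open>g\<^sub>v x g\<^sub>v\<close> is a multiple of \<open>g\<^sub>v\<close> modulo lower cells.

  For independence, specialise \<open>\<delta>\<close> to an integer \<open>z \<ge> 2\<close> and let the algebra act on functions on
  paths, weighted by a positive eigenvector of the graph for the eigenvalue \<open>z\<close>. All matrix
  entries are then non-negative, and the entry of \<open>u\<^sub>S g\<^sub>n\<^sub>,\<^sub>v u\<^sub>T\<^sup>*\<close> at \<open>(S, T)\<close> is positive, while an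
  entry at \<open>(P, Q)\<close> can be non-zero only if \<open>P \<le> S\<close> and \<open>Q \<le> T\<close> stepwise.
\<close>


section \<open>Paths and words\<close>

text \<open>
  Besides naming the generators, \<open>D_vertex\<close> also serves as the vertex set of the infinite graph
  of type D that indexes the cells: \<open>Node 0\<close> and \<open>Node_bar\<close> are its two end vertices, both joined to
  \<open>Node 1\<close>. Vertices as cells count through strands, so they are shifted against the generators.
\<close>

fun level :: "D_vertex \<Rightarrow> nat" where
  "level Node_bar = 0"
| "level (Node t) = t"

definition adj :: "D_vertex \<Rightarrow> D_vertex \<Rightarrow> bool" where
  "adj x y \<longleftrightarrow> level x = Suc (level y) \<or> level y = Suc (level x)"

text \<open>The two end vertices are incomparable; apart from this pair the order is total. It
  orders the cells and, step by step, the paths.\<close>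

definition below :: "D_vertex \<Rightarrow> D_vertex \<Rightarrow> bool" where
  "below x y \<longleftrightarrow> x = y \<or> level x < level y"

definition is_path :: "nat \<Rightarrow> (nat \<Rightarrow> D_vertex) \<Rightarrow> bool" where
  "is_path m P \<longleftrightarrow> P 1 = Node 1 \<and> (\<forall>j. 1 \<le> j \<longrightarrow> j < m \<longrightarrow> adj (P j) (P (Suc j)))"

text \<open>Fixing the values outside \<open>1..m\<close> makes each path a single function, so that
  there are finitely many and equality is decided on the steps \<open>1\<close> to \<open>m\<close>.
  The predicate \<open>is_path\<close> leaves these values free, which suits the path
  representation.\<close>

definition paths :: "nat \<Rightarrow> (nat \<Rightarrow> D_vertex) set" where
  "paths m = {P. is_path m P \<and> (\<forall>j. j = 0 \<or> m < j \<longrightarrow> P j = Node_bar)}"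

text \<open>For \<open>m \<ge> 1\<close> these are the vertices a path can occupy at step
  \<open>m\<close>: it starts at level \<open>1\<close>, and each step changes the level by
  one.\<close>

definition shape :: "nat \<Rightarrow> D_vertex \<Rightarrow> bool" where
  "shape m v \<longleftrightarrow> level v \<le> m \<and> even (m + level v)"

text \<open>
  A word for \<open>b\<^sub>t\<^sub>+\<^sub>1 b\<^sub>t\<^sub>+\<^sub>3 \<dots> b\<^sub>m\<^sub>-\<^sub>1\<close>, where \<open>v\<close> has level \<open>t\<close>; for \<open>v = Node_bar\<close> the first letter is
  replaced by \<open>Node_bar\<close>.
\<close>

fun cups :: "nat \<Rightarrow> D_vertex \<Rightarrow> D_vertex list" where
  "cups 0 v = []"
| "cups (Suc 0) v = []"
| "cups (Suc (Suc m)) v =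
    (if m < level v then []
     else cups m v @ [if m = 0 \<and> v = Node_bar then Node_bar else Node (Suc m)])"

definition path_word :: "nat \<Rightarrow> (nat \<Rightarrow> D_vertex) \<Rightarrow> D_vertex list" where
  "path_word m S = concat (map (\<lambda>j. cups j (S j)) [2..<m])"

definition cell_word :: "nat \<Rightarrow> (nat \<Rightarrow> D_vertex) \<Rightarrow> (nat \<Rightarrow> D_vertex) \<Rightarrow> D_vertex list" where
  "cell_word m S T = path_word m S @ cups m (S m) @ rev (path_word m T)"

text \<open>The generators of the algebra on \<open>m\<close> strands. There are none for
  \<open>m \<le> 1\<close>, and \<open>Node 1\<close> and \<open>Node_bar\<close> appear together at
  \<open>m = 2\<close>.\<close>

definition gens :: "nat \<Rightarrow> D_vertex set" where
  "gens m = {v. (v = Node_bar \<and> 2 \<le> m) \<or> (\<exists>i. v = Node i \<and> 1 \<le> i \<and> i < m)}"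

section \<open>Elementary facts on generators, cup words, shapes and paths\<close>

lemma level_zero_cases: "level v = 0 \<Longrightarrow> v = Node_bar \<or> v = Node 0"
  by (cases v) auto

lemma gens_Suc: "2 \<le> m \<Longrightarrow> gens (Suc m) = insert (Node m) (gens m)"
  by (auto simp: gens_def)

lemma gens_mono: "m \<le> m' \<Longrightarrow> gens m \<subseteq> gens m'"
  by (auto simp: gens_def)

lemma gens_eq_D_vertices: "2 \<le> n \<Longrightarrow> gens n = D_vertices n"
  by (auto simp: gens_def D_vertices_def)

lemma cups_full [simp]: "level v = m \<Longrightarrow> cups m v = []"
  by (cases "(m, v)" rule: cups.cases) auto

lemma cups_gens: "set (cups m v) \<subseteq> gens m"
proof (induction m v rule: cups.induct)
  case (3 m v)
  then show ?case using gens_mono[of m "Suc (Suc m)"] by (auto simp: gens_def)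
qed auto

lemma path_word_2 [simp]: "path_word 2 S = []"
  by (simp add: path_word_def)

lemma path_word_Suc: "2 \<le> m \<Longrightarrow> path_word (Suc m) S = path_word m S @ cups m (S m)"
  by (simp add: path_word_def)

lemma path_word_cong: "(\<And>j. 2 \<le> j \<Longrightarrow> j < m \<Longrightarrow> S j = S' j) \<Longrightarrow> path_word m S = path_word m S'"
  unfolding path_word_def by (intro arg_cong[where f = concat] map_cong) auto

lemma path_word_gens: "set (path_word m S) \<subseteq> gens (m - 1)"
proof -
  have "set (cups j (S j)) \<subseteq> gens (m - 1)" if "j < m" for j
    using that by (intro order_trans[OF cups_gens gens_mono]) simp
  then show ?thesis unfolding path_word_def by fastforce
qed

lemma shape_neighbour_cases:
  assumes "shape m x" "shape (Suc m) y"
  shows "level x = Suc (level y) \<or> level y = Suc (level x) \<or> Suc (level x) < level y \<or> Suc (level y) < level x"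
proof -
  have "level x \<noteq> level y" using assms by (auto simp: shape_def)
  then show ?thesis by linarith
qed

lemma shape_Suc_Suc:
  assumes "shape m v" "m \<noteq> level v"
  obtains k where "m = Suc (Suc k)" "level v \<le> k" "shape k v"
proof -
  have "level v + 2 \<le> m" using assms unfolding shape_def by presburger
  then show ?thesis using assms that[of "m - 2"] by (auto simp: shape_def)
qed

lemma is_path_shape:
  assumes "is_path m P" "1 \<le> j" "j \<le> m"
  shows "shape j (P j)"
  using assms(2,3)
proof (induction j rule: nat_induct_at_least)
  case base
  then show ?case using assms by (simp add: shape_def is_path_def)
next
  case (Suc j)
  then have "shape j (P j)" "adj (P j) (P (Suc j))" using assms by (auto simp: is_path_def)
  then show ?case by (auto simp: shape_def adj_def)
qed

lemma paths_step:
  assumes "S \<in> paths m" "1 \<le> m" "adj (S m) v"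
  shows "S(Suc m := v) \<in> paths (Suc m)"
proof -
  have "adj ((S(Suc m := v)) j) ((S(Suc m := v)) (Suc j))" if "1 \<le> j" "j < Suc m" for j
    using assms that by (cases "j = m") (auto simp: paths_def is_path_def)
  then show ?thesis using assms unfolding paths_def is_path_def by auto
qed

lemma finite_paths: "finite (paths m)"
proof -
  let ?B = "insert Node_bar (Node ` {..m})"
  have "v \<in> ?B" if "level v \<le> m" for v using that by (cases v) auto
  moreover have "level (P j) \<le> m" if "P \<in> paths m" "1 \<le> j" "j \<le> m" for P j
    using that is_path_shape[of m P j] by (simp add: paths_def shape_def)
  ultimately have "paths m \<subseteq> {P. \<forall>j. (j \<in> {1..m} \<longrightarrow> P j \<in> ?B) \<and> (j \<notin> {1..m} \<longrightarrow> P j = Node_bar)}"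
    unfolding paths_def using not_less_eq_eq by (auto simp: not_le)
  then show ?thesis by (rule finite_subset) (rule finite_set_of_finite_funs, auto)
qed


section \<open>Spanning\<close>

text \<open>Spanning is derived from the relations alone, in any algebra satisfying them.
  \<open>b\<close> has values in the carrier at every vertex, so that \<open>val\<close> is closed
  on arbitrary words.\<close>

locale pair_free = assoc_algebra R A
  for R :: "('r, 'p) ring_scheme" and A :: "('r, 'a, 'q) module_scheme" (structure) +
  fixes n :: nat and d :: 'r and b :: "D_vertex \<Rightarrow> 'a"
  assumes n2: "2 \<le> n"
    and d_closed [simp]: "d \<in> carrier R"
    and b_closed [simp]: "b v \<in> carrier A"
    and b_sq: "v \<in> gens n \<Longrightarrow> b v \<otimes> b v = d \<odot> b v"
    and b_commute: "\<lbrakk>v \<in> gens n; w \<in> gens n; {v, w} \<notin> D_edges n\<rbrakk> \<Longrightarrow> b v \<otimes> b w = b w \<otimes> b v"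
    and b_braid: "\<lbrakk>v \<in> gens n; w \<in> gens n; {v, w} \<in> D_edges n\<rbrakk> \<Longrightarrow> b v \<otimes> b w \<otimes> b v = b v"
    and b_pair: "b (Node 1) \<otimes> b Node_bar = \<zero>"
begin

section \<open>Words and monomials in the generators\<close>

definition val :: "D_vertex list \<Rightarrow> 'a" where
  "val w = foldr (\<lambda>v x. b v \<otimes> x) w \<one>"

lemma val_Nil [simp]: "val [] = \<one>"
  and val_Cons [simp]: "val (v # w) = b v \<otimes> val w"
  by (simp_all add: val_def)

lemma val_closed [simp]: "val w \<in> carrier A"
  by (induction w) auto

lemma val_append: "val (u @ w) = val u \<otimes> val w"
  by (induction u) (auto simp: m_assoc)

lemma lswap:
  "\<lbrakk>x \<otimes> y = y \<otimes> x; x \<in> carrier A; y \<in> carrier A; z \<in> carrier A\<rbrakk>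
    \<Longrightarrow> x \<otimes> (y \<otimes> z) = y \<otimes> (x \<otimes> z)"
  by (metis m_assoc)

text \<open>Each relation equates a monomial with a scalar multiple of a monomial, the scalar being
  zero for the pair. So the whole spanning argument stays within scalar multiples of words and never
  forms a sum.\<close>

definition Mon :: "nat \<Rightarrow> 'a set" where
  "Mon m = {r \<odot> val w | r w. r \<in> carrier R \<and> set w \<subseteq> gens m}"

lemma Mon_closed: "x \<in> Mon m \<Longrightarrow> x \<in> carrier A"
  by (auto simp: Mon_def)

lemma Mon_val: "set w \<subseteq> gens m \<Longrightarrow> val w \<in> Mon m"
  unfolding Mon_def by (intro CollectI exI[of _ "\<one>\<^bsub>R\<^esub>"] exI[of _ w]) auto

lemma Mon_one: "\<one> \<in> Mon m"
  using Mon_val[of "[]" m] by simp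

lemma Mon_b: "v \<in> gens m \<Longrightarrow> b v \<in> Mon m"
  using Mon_val[of "[v]" m] by simp

lemma Mon_smult: "x \<in> Mon m \<Longrightarrow> r \<in> carrier R \<Longrightarrow> r \<odot> x \<in> Mon m"
  unfolding Mon_def by (auto simp: smult_assoc1[symmetric]) blast

lemma smult_mult_smult:
  assumes "r \<in> carrier R" "s \<in> carrier R" "x \<in> carrier A" "y \<in> carrier A"
  shows "(r \<odot> x) \<otimes> (s \<odot> y) = (r \<otimes>\<^bsub>R\<^esub> s) \<odot> (x \<otimes> y)"
  using assms by (simp add: smult_mult_left smult_mult_right smult_assoc1[symmetric] R.m_comm)

lemma Mon_mult: "x \<in> Mon m \<Longrightarrow> y \<in> Mon m \<Longrightarrow> x \<otimes> y \<in> Mon m"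
  unfolding Mon_def
  by (clarsimp simp: smult_mult_smult val_append[symmetric]) (metis R.m_closed Un_least set_append)

lemma Mon_mono: "m \<le> m' \<Longrightarrow> Mon m \<subseteq> Mon m'"
  unfolding Mon_def using gens_mono by blast

lemma Mon_cases:
  assumes "x \<in> Mon m"
  obtains r w where "r \<in> carrier R" "set w \<subseteq> gens m" "x = r \<odot> val w"
  using assms by (auto simp: Mon_def)

text \<open>Numbered letters in \<open>gens m\<close> have index at most \<open>k - 2\<close>. The
  letter \<open>Node_bar\<close>, whose only neighbour is \<open>Node 2\<close>, occurs only for
  \<open>m \<ge> 2\<close>, and then \<open>k \<ge> 3\<close>.\<close>

lemma b_val_commute:
  assumes "set w \<subseteq> gens m" "m < k" "k < n"
  shows "val w \<otimes> b (Node k) = b (Node k) \<otimes> val w"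
  using assms(1)
proof (induction w)
  case (Cons v w)
  have "{v, Node k} \<notin> D_edges n" "v \<in> gens n" "Node k \<in> gens n"
    using Cons.prems assms by (auto simp: gens_def D_edges_def doubleton_eq_iff)
  then have "b v \<otimes> b (Node k) = b (Node k) \<otimes> b v" by (intro b_commute)
  with Cons show ?case
    by (simp add: m_assoc) (simp add: m_assoc[symmetric])
qed simp

lemma Mon_commute:
  assumes "x \<in> Mon m" "m < k" "k < n"
  shows "x \<otimes> b (Node k) = b (Node k) \<otimes> x"
  using assms(1)
proof (rule Mon_cases)
  fix r w assume "r \<in> carrier R" "set w \<subseteq> gens m" "x = r \<odot> val w"
  then show ?thesis
    using b_val_commute[OF _ assms(2,3)] by (simp add: smult_mult_left smult_mult_right)
qed

lemma braid_Node:
  assumes "1 \<le> k" "Suc k < n"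
  shows "b (Node k) \<otimes> b (Node (Suc k)) \<otimes> b (Node k) = b (Node k)"
    "b (Node (Suc k)) \<otimes> b (Node k) \<otimes> b (Node (Suc k)) = b (Node (Suc k))"
  using assms by (intro b_braid; force simp: gens_def D_edges_def)+

lemma braid_bar:
  assumes "2 < n"
  shows "b Node_bar \<otimes> b (Node 2) \<otimes> b Node_bar = b Node_bar"
    "b (Node 2) \<otimes> b Node_bar \<otimes> b (Node 2) = b (Node 2)"
  using assms by (intro b_braid; force simp: gens_def D_edges_def)+

lemma b_pair': "b Node_bar \<otimes> b (Node 1) = \<zero>"
proof -
  have "{Node_bar, Node 1} \<notin> D_edges n"
    by (auto simp: D_edges_def doubleton_eq_iff)
  then show ?thesis using b_commute[of Node_bar "Node 1"] n2 b_pair by (auto simp: gens_def)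
qed

section \<open>Reduction of monomials along the tower of algebras\<close>

lemma Mon_1: "x \<in> Mon 1 \<Longrightarrow> \<exists>r\<in>carrier R. x = r \<odot> \<one>"
  by (auto simp: Mon_def gens_def)

text \<open>The pair relation makes every word that mixes \<open>Node 1\<close> and
  \<open>Node_bar\<close> vanish, and powers of a single letter collapse to a multiple of
  it.\<close>

lemma Mon_2:
  assumes "x \<in> Mon 2"
  shows "\<exists>r\<in>carrier R. x = r \<odot> \<one> \<or> x = r \<odot> b (Node 1) \<or> x = r \<odot> b Node_bar"
proof -
  have g: "Node 1 \<in> gens n" "Node_bar \<in> gens n" using n2 by (auto simp: gens_def)
  have "\<exists>r\<in>carrier R. val w = r \<odot> \<one> \<or> val w = r \<odot> b (Node 1) \<or> val w = r \<odot> b Node_bar"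
    if "set w \<subseteq> gens 2" for w
    using that
  proof (induction w)
    case Nil
    show ?case by (intro bexI[of _ "\<one>\<^bsub>R\<^esub>"]) auto
  next
    case (Cons v w)
    have v: "v = Node 1 \<or> v = Node_bar" using Cons.prems by (auto simp: gens_def)
    obtain r where r: "r \<in> carrier R"
      and "val w = r \<odot> \<one> \<or> val w = r \<odot> b (Node 1) \<or> val w = r \<odot> b Node_bar"
      using Cons by auto
    then consider "val w = r \<odot> \<one>" | "val w = r \<odot> b (Node 1)" | "val w = r \<odot> b Node_bar" by auto
    then show ?case
    proof cases
      case 1
      then show ?thesis using v r by (intro bexI[of _ r]) (auto simp: smult_mult_right)
    next
      case 2
      from v show ?thesis
      proof
        assume "v = Node 1"
        then show ?thesis using r 2 b_sq[OF g(1)]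
          by (intro bexI[of _ "r \<otimes>\<^bsub>R\<^esub> d"]) (auto simp: smult_mult_right smult_assoc1)
      next
        assume "v = Node_bar"
        then show ?thesis using r 2 b_pair'
          by (intro bexI[of _ "\<zero>\<^bsub>R\<^esub>"]) (auto simp: smult_mult_right)
      qed
    next
      case 3
      from v show ?thesis
      proof
        assume "v = Node_bar"
        then show ?thesis using r 3 b_sq[OF g(2)]
          by (intro bexI[of _ "r \<otimes>\<^bsub>R\<^esub> d"]) (auto simp: smult_mult_right smult_assoc1)
      next
        assume "v = Node 1"
        then show ?thesis using r 3 b_pair
          by (intro bexI[of _ "\<zero>\<^bsub>R\<^esub>"]) (auto simp: smult_mult_right)
      qed
    qed
  qed
  moreover obtain s w where s: "s \<in> carrier R" "set w \<subseteq> gens 2" "x = s \<odot> val w"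
    using assms by (rule Mon_cases)
  ultimately obtain r where "r \<in> carrier R"
    "val w = r \<odot> \<one> \<or> val w = r \<odot> b (Node 1) \<or> val w = r \<odot> b Node_bar" by blast
  with s show ?thesis
    by (intro bexI[of _ "s \<otimes>\<^bsub>R\<^esub> r"]) (auto simp: smult_assoc1)
qed

text \<open>
  Decomposition at \<open>k\<close> needs reduction at \<open>k\<close>, and reduction at \<open>k + 1\<close> needs decomposition at
  \<open>k\<close>; hence the explicit hypothesis here.
\<close>

lemma Mon_decompose_aux:
  assumes k: "2 \<le> k" "k < n"
    and reduce: "\<And>x. x \<in> Mon k \<Longrightarrow> \<exists>y\<in>Mon (k - 1). b (Node k) \<otimes> x \<otimes> b (Node k) = y \<otimes> b (Node k)"
    and x: "x \<in> Mon (Suc k)"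
  shows "x \<in> Mon k \<or> (\<exists>y\<in>Mon k. \<exists>z\<in>Mon k. x = y \<otimes> b (Node k) \<otimes> z)"
proof -
  note cl = Mon_closed[of _ k]
  have "val w \<in> Mon k \<or> (\<exists>y\<in>Mon k. \<exists>z\<in>Mon k. val w = y \<otimes> b (Node k) \<otimes> z)"
    if "set w \<subseteq> gens (Suc k)" for w
    using that
  proof (induction w)
    case Nil
    then show ?case using Mon_one by simp
  next
    case (Cons v w)
    then consider "val w \<in> Mon k" | y z where "y \<in> Mon k" "z \<in> Mon k" "val w = y \<otimes> b (Node k) \<otimes> z"
      by auto
    then show ?case
    proof cases
      case 1
      show ?thesis
      proof (cases "v = Node k")
        case True
        then show ?thesis using 1
          by (intro disjI2 bexI[of _ "\<one>"] bexI[of _ "val w"] Mon_one) auto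
      next
        case False
        then have "b v \<in> Mon k" using Cons.prems k by (auto simp: gens_Suc intro: Mon_b)
        then show ?thesis using 1 Mon_mult by auto
      qed
    next
      case 2
      show ?thesis
      proof (cases "v = Node k")
        case True
        obtain y' where y': "y' \<in> Mon (k - 1)" "b (Node k) \<otimes> y \<otimes> b (Node k) = y' \<otimes> b (Node k)"
          using reduce[OF 2(1)] by blast
        then have "y' \<in> Mon k" using Mon_mono[of "k - 1" k] by auto
        moreover have "val (v # w) = (b (Node k) \<otimes> y \<otimes> b (Node k)) \<otimes> z"
          using 2 cl by (simp add: True m_assoc)
        ultimately show ?thesis using y'(2) 2 by auto
      next
        case False
        then have "b v \<in> Mon k" using Cons.prems k by (auto simp: gens_Suc intro: Mon_b)
        then show ?thesis using 2 Mon_mult[of "b v" k y] cl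
          by (intro disjI2 bexI[of _ "b v \<otimes> y"] bexI[of _ z]) (auto simp: m_assoc)
      qed
    qed
  qed
  moreover obtain r w where r: "r \<in> carrier R" "set w \<subseteq> gens (Suc k)" "x = r \<odot> val w"
    using x by (rule Mon_cases)
  ultimately consider "val w \<in> Mon k"
    | y z where "y \<in> Mon k" "z \<in> Mon k" "val w = y \<otimes> b (Node k) \<otimes> z" by blast
  then show ?thesis
  proof cases
    case 1
    then show ?thesis using r Mon_smult by auto
  next
    case 2
    then show ?thesis using r cl Mon_smult[of y k r]
      by (intro disjI2 bexI[of _ "r \<odot> y"] bexI[of _ z]) (auto simp: smult_mult_left)
  qed
qed

text \<open>Enclosed by two copies of \<open>b (Node k)\<close>, a monomial loses a strand: what
  lies in \<open>Mon (k - 1)\<close> commutes with \<open>b (Node k)\<close> and comes out, and a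
  factor \<open>b (Node (k - 1))\<close> is swallowed by the braid relation.\<close>

lemma Mon_reduce:
  assumes "2 \<le> k" "k < n" "x \<in> Mon k"
  shows "\<exists>y\<in>Mon (k - 1). b (Node k) \<otimes> x \<otimes> b (Node k) = y \<otimes> b (Node k)"
  using assms
proof (induction k arbitrary: x rule: nat_induct_at_least)
  \<comment> \<open>\<open>Mon 1\<close> consists of scalars, so each of the three kinds of monomial
    in \<open>Mon 2\<close> has to leave a multiple of \<open>b (Node 2)\<close>.\<close>
  case base
  obtain r where r: "r \<in> carrier R" and "x = r \<odot> \<one> \<or> x = r \<odot> b (Node 1) \<or> x = r \<odot> b Node_bar"
    using Mon_2[OF base(2)] by blast
  then consider "x = r \<odot> \<one>" | "x = r \<odot> b (Node 1)" | "x = r \<odot> b Node_bar" by auto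
  then show ?case
  proof cases
    case 1
    then show ?thesis using r base(1) Mon_one[of 1] b_sq[of "Node 2"]
      by (intro bexI[of _ "(r \<otimes>\<^bsub>R\<^esub> d) \<odot> \<one>"] Mon_smult)
         (auto simp: smult_mult_left smult_mult_right smult_assoc1 gens_def)
  next
    case 2
    then show ?thesis using r Mon_one[of 1] braid_Node(2)[of 1] base
      by (intro bexI[of _ "r \<odot> \<one>"] Mon_smult)
         (auto simp: smult_mult_left smult_mult_right numeral_2_eq_2)
  next
    case 3
    then show ?thesis using r Mon_one[of 1] braid_bar(2) base
      by (intro bexI[of _ "r \<odot> \<one>"] Mon_smult)
         (auto simp: smult_mult_left smult_mult_right)
  qed
next
  case (Suc k)
  note cl = Mon_closed[of _ k]
  have sq: "b (Node (Suc k)) \<otimes> b (Node (Suc k)) = d \<odot> b (Node (Suc k))"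
    using Suc by (intro b_sq) (auto simp: gens_def)
  consider "x \<in> Mon k" | y z where "y \<in> Mon k" "z \<in> Mon k" "x = y \<otimes> b (Node k) \<otimes> z"
    using Mon_decompose_aux[of k x] Suc by (auto simp del: One_nat_def)
  then show ?case
  proof cases
    case 1
    have "b (Node (Suc k)) \<otimes> x \<otimes> b (Node (Suc k)) = x \<otimes> (b (Node (Suc k)) \<otimes> b (Node (Suc k)))"
      using 1 cl Mon_commute[OF 1, of "Suc k"] Suc by (simp add: m_assoc[symmetric])
    also have "\<dots> = (d \<odot> x) \<otimes> b (Node (Suc k))"
      using 1 cl sq by (simp add: smult_mult_left smult_mult_right)
    finally show ?thesis using Mon_smult[OF 1 d_closed] by auto
  next
    case 2
    let ?b = "b (Node k)" and ?c = "b (Node (Suc k))"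
    have c: "y \<otimes> ?c = ?c \<otimes> y" "z \<otimes> ?c = ?c \<otimes> z"
      using 2 Mon_commute[of _ k "Suc k"] Suc by auto
    have br: "?c \<otimes> ?b \<otimes> ?c = ?c" using Suc by (intro braid_Node) auto
    have "?c \<otimes> x \<otimes> ?c = (?c \<otimes> y) \<otimes> ?b \<otimes> (z \<otimes> ?c)"
      using 2 cl by (simp add: m_assoc)
    also have "\<dots> = y \<otimes> (?c \<otimes> ?b \<otimes> ?c) \<otimes> z"
      using 2 cl by (simp add: c m_assoc lswap[OF c(1)[symmetric]])
    also have "\<dots> = (y \<otimes> z) \<otimes> ?c"
      using 2 cl unfolding br by (simp add: m_assoc c(2))
    finally show ?thesis using Mon_mult 2 by auto
  qed
qed

lemma Mon_decompose:
  assumes "2 \<le> k" "k < n" "x \<in> Mon (Suc k)"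
  shows "x \<in> Mon k \<or> (\<exists>y\<in>Mon k. \<exists>z\<in>Mon k. x = y \<otimes> b (Node k) \<otimes> z)"
  using assms by (intro Mon_decompose_aux Mon_reduce)

text \<open>If \<open>x\<close> contains \<open>b (Node k)\<close>, this factor and the one on the
  right enclose a monomial on \<open>k\<close> strands, which \<open>Mon_reduce\<close> pulls out.
  Left multiples of \<open>b (Node k)\<close> thus need only coefficients from \<open>k\<close>
  strands.\<close>

lemma Mon_absorb:
  assumes k: "2 \<le> k" "k < n" and x: "x \<in> Mon (Suc k)"
  shows "\<exists>y\<in>Mon k. x \<otimes> b (Node k) = y \<otimes> b (Node k)"
proof -
  note cl = Mon_closed[of _ k]
  consider "x \<in> Mon k" | y z where "y \<in> Mon k" "z \<in> Mon k" "x = y \<otimes> b (Node k) \<otimes> z"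
    using Mon_decompose[OF assms] by blast
  then show ?thesis
  proof cases
    case 2
    obtain z' where z': "z' \<in> Mon (k - 1)" "b (Node k) \<otimes> z \<otimes> b (Node k) = z' \<otimes> b (Node k)"
      using Mon_reduce[OF k 2(2)] by blast
    then have z'k: "z' \<in> Mon k" using Mon_mono[of "k - 1" k] by auto
    have "x \<otimes> b (Node k) = y \<otimes> (b (Node k) \<otimes> z \<otimes> b (Node k))"
      using 2 cl by (simp add: m_assoc)
    also have "\<dots> = (y \<otimes> z') \<otimes> b (Node k)"
      using 2 cl z'k by (simp add: z'(2) m_assoc)
    finally show ?thesis using Mon_mult[OF 2(1) z'k] by auto
  qed auto
qed

lemma Mon_sandwich:
  assumes k: "2 \<le> k" "k < n" and x: "x \<in> Mon (Suc k)"
  shows "\<exists>y\<in>Mon (k - 1). b (Node k) \<otimes> x \<otimes> b (Node k) = y \<otimes> b (Node k)"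
proof -
  obtain y where y: "y \<in> Mon k" "x \<otimes> b (Node k) = y \<otimes> b (Node k)"
    using Mon_absorb[OF assms] by blast
  then have "b (Node k) \<otimes> x \<otimes> b (Node k) = b (Node k) \<otimes> y \<otimes> b (Node k)"
    using Mon_closed[OF x] Mon_closed[OF y(1)] by (simp add: m_assoc)
  then show ?thesis using Mon_reduce[OF k y(1)] by simp
qed

section \<open>Cup elements and the filtration by through strands\<close>

abbreviation g :: "nat \<Rightarrow> D_vertex \<Rightarrow> 'a" where
  "g m v \<equiv> val (cups m v)"

text \<open>The products that pass through fewer than \<open>t\<close> through strands. This is a
  set of single products, not their span, in keeping with \<open>Mon\<close>.\<close>

definition lower :: "nat \<Rightarrow> nat \<Rightarrow> 'a set" where
  "lower m t = {x \<otimes> g m v \<otimes> y | x y v. x \<in> Mon m \<and> y \<in> Mon m \<and> shape m v \<and> level v < t}"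

lemma lowerI:
  "x \<in> Mon m \<Longrightarrow> y \<in> Mon m \<Longrightarrow> shape m v \<Longrightarrow> level v < t \<Longrightarrow> x \<otimes> g m v \<otimes> y \<in> lower m t"
  unfolding lower_def by blast

lemma g_Mon: "g m v \<in> Mon m"
  using cups_gens by (rule Mon_val)

lemma g_Suc_Suc:
  assumes "level v \<le> m" "0 < m"
  shows "g (Suc (Suc m)) v = g m v \<otimes> b (Node (Suc m))"
  using assms by (simp add: val_append)

lemma g_2: "level v = 0 \<Longrightarrow> g 2 v = b (if v = Node_bar then Node_bar else Node 1)"
  by (simp add: numeral_2_eq_2)

lemma lower_mult:
  assumes "z \<in> lower m t" "x \<in> Mon m" "y \<in> Mon m"
  shows "x \<otimes> z \<otimes> y \<in> lower m t"
proof -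
  obtain x' y' v where z: "z = x' \<otimes> g m v \<otimes> y'" "x' \<in> Mon m" "y' \<in> Mon m" "shape m v" "level v < t"
    using assms(1) by (auto simp: lower_def)
  then have "x \<otimes> z \<otimes> y = (x \<otimes> x') \<otimes> g m v \<otimes> (y' \<otimes> y)"
    using assms Mon_closed by (simp add: m_assoc)
  then show ?thesis using z assms by (auto intro!: lowerI Mon_mult)
qed

text \<open>A zigzag of arcs pulls straight. The letters \<open>b (Node (m - 1))\<close> and
  \<open>b (Node m)\<close> commute with the remaining cups of \<open>g m v\<close> and can be
  collected, where the braid relation removes them; two strands fewer remain. The identity serves to
  insert a cup element on one strand more next to \<open>g m v\<close>.\<close>

lemma g_zigzag:
  assumes "shape m v" "m < n" "0 < m"
  shows "g m v \<otimes> g (Suc m) (Node (Suc (level v))) \<otimes> g m v = g m v"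
  using assms
proof (induction m rule: less_induct)
  case (less m)
  show ?case
  proof (cases "m = level v")
    case True
    then show ?thesis by simp
  next
    case False
    then obtain k where k: "m = Suc (Suc k)" "level v \<le> k" "shape k v"
      using less.prems by (metis shape_Suc_Suc)
    let ?w = "Node (Suc (level v))"
    show ?thesis
    proof (cases "k = 0")
      case True
      then have v: "level v = 0" "m = 2" using k by auto
      then have "g m v = b (if v = Node_bar then Node_bar else Node 1)" using g_2 by simp
      moreover have "g (Suc m) ?w = b (Node 2)"
        using v by (simp add: numeral_2_eq_2)
      ultimately show ?thesis
        using braid_Node(1)[of 1] braid_bar(1) less.prems v by (simp add: numeral_2_eq_2)
    next
      case False
      let ?b = "b (Node (Suc k))" and ?c = "b (Node (Suc (Suc k)))"
      have g: "g m v = g k v \<otimes> ?b" "g (Suc m) ?w = g (Suc k) ?w \<otimes> ?c"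
        using k False by (simp_all add: g_Suc_Suc del: cups.simps)
      have 1: "g k v \<otimes> ?b = ?b \<otimes> g k v" "g k v \<otimes> ?c = ?c \<otimes> g k v"
        using Mon_commute[OF g_Mon] less.prems k by auto
      have "g m v \<otimes> g (Suc m) ?w \<otimes> g m v
        = (g k v \<otimes> ?b) \<otimes> g (Suc k) ?w \<otimes> (?c \<otimes> g k v) \<otimes> ?b"
        by (simp add: g m_assoc)
      also have "\<dots> = ?b \<otimes> (g k v \<otimes> g (Suc k) ?w \<otimes> g k v) \<otimes> ?c \<otimes> ?b"
        by (simp add: m_assoc lswap[OF 1(1)] lswap[OF 1(2)[symmetric]])
      also have "g k v \<otimes> g (Suc k) ?w \<otimes> g k v = g k v"
        using k less.prems False by (intro less.IH) auto
      also have "?b \<otimes> g k v \<otimes> ?c \<otimes> ?b = g k v \<otimes> (?b \<otimes> ?c \<otimes> ?b)"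
        by (simp add: m_assoc lswap[OF 1(1)[symmetric]])
      also have "?b \<otimes> ?c \<otimes> ?b = ?b"
        using less.prems k by (intro braid_Node) auto
      finally show ?thesis unfolding g .
    qed
  qed
qed

end

declare cups.simps(3) [simp del]

context pair_free begin

lemma lower_closed: "z \<in> lower m t \<Longrightarrow> z \<in> carrier A"
  unfolding lower_def using Mon_closed by auto

lemma lower_mult_left: "z \<in> lower m t \<Longrightarrow> x \<in> Mon m \<Longrightarrow> x \<otimes> z \<in> lower m t"
  using lower_mult[of z m t x \<one>] Mon_one lower_closed Mon_closed by simp

lemma lower_mult_right: "z \<in> lower m t \<Longrightarrow> x \<in> Mon m \<Longrightarrow> z \<otimes> x \<in> lower m t"
  using lower_mult[of z m t \<one> x] Mon_one lower_closed Mon_closed by simp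

lemma lower_smult: "z \<in> lower m t \<Longrightarrow> r \<in> carrier R \<Longrightarrow> r \<odot> z \<in> lower m t"
  using lower_mult_left[OF _ Mon_smult[OF Mon_one], of z m t r] lower_closed
  by (simp add: smult_mult_left)

text \<open>For \<open>m > 2\<close> the top letter \<open>b (Node (m - 1))\<close> is itself the
  cup element of the vertex of level \<open>m - 2\<close>. The other letters follow downwards by
  \<open>b\<^sub>i = b\<^sub>i b\<^sub>i\<^sub>+\<^sub>1 b\<^sub>i\<close>, and
  \<open>Node_bar\<close> follows from \<open>Node 2\<close> in the same way.\<close>

lemma b_lower:
  assumes "2 \<le> m" "m \<le> n" "v \<in> gens m"
  shows "b v \<in> lower m m"
proof (cases "m = 2")
  case True
  define u where "u = (if v = Node_bar then Node_bar else Node 0)"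
  have "v = Node_bar \<or> v = Node 1" using assms True by (auto simp: gens_def)
  then have "g 2 u = b v" using g_2[of u] by (auto simp: u_def)
  moreover have "shape 2 u" "level u < 2" by (auto simp: u_def shape_def)
  ultimately show ?thesis
    using lowerI[OF Mon_one Mon_one, of 2 u 2] True by simp
next
  case False
  then obtain k where k: "m = Suc (Suc k)" "1 \<le> k" using assms by (cases "(m, v)" rule: cups.cases) auto
  have top: "b (Node (Suc k)) \<in> lower m m"
    using lowerI[OF Mon_one Mon_one, of m "Node k" m] k by (simp add: shape_def cups.simps)
  have node: "b (Node i) \<in> lower m m" if "1 \<le> i" "i \<le> Suc k" for i
    using that(2,1)
  proof (induction i rule: inc_induct)
    case (step i)
    have "b (Node i) \<in> Mon m" using step k by (intro Mon_b) (auto simp: gens_def)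
    then have "b (Node i) \<otimes> b (Node (Suc i)) \<otimes> b (Node i) \<in> lower m m"
      using step by (intro lower_mult) auto
    then show ?case using step k assms by (simp add: braid_Node)
  qed (rule top)
  show ?thesis
  proof (cases v)
    case Node_bar
    then have "b Node_bar \<otimes> b (Node 2) \<otimes> b Node_bar \<in> lower m m"
      using k assms by (intro lower_mult node Mon_b) auto
    then show ?thesis using k assms Node_bar by (simp add: braid_bar)
  next
    case (Node i)
    then show ?thesis using node[of i] assms k by (auto simp: gens_def)
  qed
qed

text \<open>A non-empty word contains a generator and therefore loses through strands.\<close>

lemma Mon_scalar_or_lower:
  assumes "1 \<le> m" "m \<le> n" "x \<in> Mon m"
  shows "(\<exists>r\<in>carrier R. x = r \<odot> \<one>) \<or> x \<in> lower m m"
proof (cases "m = 1")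
  case True
  then show ?thesis using Mon_1 assms by auto
next
  case False
  obtain r w where x: "r \<in> carrier R" "set w \<subseteq> gens m" "x = r \<odot> val w"
    using assms(3) by (rule Mon_cases)
  show ?thesis
  proof (cases w)
    case (Cons v w')
    have "b v \<otimes> val w' \<in> lower m m"
      using x False assms Cons by (intro lower_mult_right b_lower Mon_val) auto
    then show ?thesis using x Cons lower_smult by simp
  qed (use x in auto)
qed

text \<open>On two more strands \<open>b (Node (Suc m))\<close> commutes with \<open>Mon m\<close>
  and completes \<open>g m v\<close> to the cup element of the same vertex.\<close>

lemma lower_Suc_Suc:
  assumes "z \<in> lower m t" "0 < m" "Suc m < n"
  shows "z \<otimes> b (Node (Suc m)) \<in> lower (Suc (Suc m)) t"
proof -
  obtain x y v where z: "z = x \<otimes> g m v \<otimes> y" "x \<in> Mon m" "y \<in> Mon m" "shape m v" "level v < t"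
    using assms(1) by (auto simp: lower_def)
  have "z \<otimes> b (Node (Suc m)) = x \<otimes> g m v \<otimes> (y \<otimes> b (Node (Suc m)))"
    using z Mon_closed by (simp add: m_assoc)
  also have "\<dots> = x \<otimes> g (Suc (Suc m)) v \<otimes> y"
    using z assms Mon_closed Mon_commute[OF z(3), of "Suc m"]
    by (simp add: g_Suc_Suc shape_def m_assoc)
  also have "\<dots> \<in> lower (Suc (Suc m)) t"
    using z Mon_mono[of m "Suc (Suc m)"] by (intro lowerI) (auto simp: shape_def)
  finally show ?thesis .
qed

text \<open>\<open>g 2 v\<close> is one of \<open>b (Node 1)\<close> and \<open>b Node_bar\<close>.
  That letter multiplies it by \<open>d\<close>, the other one annihilates it.\<close>

lemma Mon_2_mult_g:
  assumes "x \<in> Mon 2" "level v = 0"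
  shows "\<exists>r\<in>carrier R. x \<otimes> g 2 v = r \<odot> g 2 v"
proof -
  have g: "Node 1 \<in> gens n" "Node_bar \<in> gens n" using n2 by (auto simp: gens_def)
  obtain r where r: "r \<in> carrier R" and "x = r \<odot> \<one> \<or> x = r \<odot> b (Node 1) \<or> x = r \<odot> b Node_bar"
    using Mon_2[OF assms(1)] by blast
  moreover have "\<exists>s\<in>carrier R. b u \<otimes> g 2 v = s \<odot> g 2 v" if "u = Node 1 \<or> u = Node_bar" for u
  proof (cases "g 2 v = b u")
    case True
    then show ?thesis using that g b_sq by (intro bexI[of _ d]) auto
  next
    case False
    then show ?thesis using that b_pair b_pair' g_2[OF assms(2)]
      by (intro bexI[of _ "\<zero>\<^bsub>R\<^esub>"]) (auto split: if_splits)
  qed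
  ultimately consider "x = r \<odot> \<one>"
    | u s where "x = r \<odot> b u" "s \<in> carrier R" "b u \<otimes> g 2 v = s \<odot> g 2 v" by blast
  then show ?thesis
  proof cases
    case 1
    then show ?thesis using r by (intro bexI[of _ r]) (auto simp: smult_mult_left)
  next
    case 2
    then show ?thesis using r
      by (intro bexI[of _ "r \<otimes>\<^bsub>R\<^esub> s"]) (auto simp: smult_mult_left smult_assoc1)
  qed
qed

text \<open>The scalar is a value of the bilinear form of the cell. Splitting off the last letter of
  the cup word, \<open>Mon_sandwich\<close> turns the middle into a monomial on two strands fewer.
  At \<open>m = level v\<close> the cup word is empty, and \<open>Mon_scalar_or_lower\<close>
  decides.\<close>

lemma g_sandwich:
  assumes "1 \<le> m" "m \<le> n" "shape m v" "x \<in> Mon m"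
  shows "(\<exists>r\<in>carrier R. g m v \<otimes> x \<otimes> g m v = r \<odot> g m v) \<or> g m v \<otimes> x \<otimes> g m v \<in> lower m (level v)"
  using assms
proof (induction m arbitrary: x rule: less_induct)
  case (less m)
  note cl = Mon_closed[OF less.prems(4)]
  show ?case
  proof (cases "m = level v")
    case True
    then show ?thesis using Mon_scalar_or_lower[OF less.prems(1,2,4)] cl by simp
  next
    case False
    then obtain k where k: "m = Suc (Suc k)" "level v \<le> k" "shape k v"
      using less.prems by (metis shape_Suc_Suc)
    show ?thesis
    \<comment> \<open>With two strands and level \<open>0\<close> nothing can be split off, but
      there all of \<open>Mon 2\<close> acts on \<open>g 2 v\<close> by scalars.\<close>
    proof (cases "k = 0")
      case True
      then have v: "level v = 0" "m = 2" using k by auto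
      have "g m v \<otimes> x \<in> Mon 2" using Mon_mult[OF g_Mon less.prems(4)] v by simp
      then show ?thesis using Mon_2_mult_g v by blast
    next
      case False
      let ?b = "b (Node (Suc k))"
      have g: "g m v = g k v \<otimes> ?b" using k False by (simp add: g_Suc_Suc)
      have c: "g k v \<otimes> ?b = ?b \<otimes> g k v"
        using Mon_commute[OF g_Mon] less.prems k by auto
      obtain y where y: "y \<in> Mon k" "?b \<otimes> x \<otimes> ?b = y \<otimes> ?b"
        using Mon_sandwich[of "Suc k" x] less.prems k False by auto
      note ycl = Mon_closed[OF y(1)]
      have "g m v \<otimes> x \<otimes> g m v = g k v \<otimes> (?b \<otimes> x \<otimes> ?b) \<otimes> g k v"
        using cl by (simp add: g m_assoc flip: c)
      also have "\<dots> = (g k v \<otimes> y \<otimes> g k v) \<otimes> ?b"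
        using ycl by (simp add: y(2) m_assoc c)
      finally have eq: "g m v \<otimes> x \<otimes> g m v = (g k v \<otimes> y \<otimes> g k v) \<otimes> ?b" .
      have "(\<exists>r\<in>carrier R. g k v \<otimes> y \<otimes> g k v = r \<odot> g k v) \<or> g k v \<otimes> y \<otimes> g k v \<in> lower k (level v)"
        using less.prems k False y by (intro less.IH) auto
      then show ?thesis
      proof
        assume "\<exists>r\<in>carrier R. g k v \<otimes> y \<otimes> g k v = r \<odot> g k v"
        then show ?thesis using eq by (auto simp: g smult_mult_left)
      next
        assume "g k v \<otimes> y \<otimes> g k v \<in> lower k (level v)"
        then show ?thesis using lower_Suc_Suc[of _ k] less.prems k False eq by auto
      qed
    qed
  qed
qed

end

section \<open>The anti-involution fixing the generators\<close>

locale pair_free_star = pair_free R A n d b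
  for R :: "('r, 'p) ring_scheme" and A :: "('r, 'a, 'q) module_scheme" (structure) and n d b +
  fixes star :: "'a \<Rightarrow> 'a"
  assumes star_closed [simp]: "x \<in> carrier A \<Longrightarrow> star x \<in> carrier A"
    and star_smult: "\<lbrakk>c \<in> carrier R; x \<in> carrier A\<rbrakk> \<Longrightarrow> star (c \<odot> x) = c \<odot> star x"
    and star_mult: "\<lbrakk>x \<in> carrier A; y \<in> carrier A\<rbrakk> \<Longrightarrow> star (x \<otimes> y) = star y \<otimes> star x"
    and star_star: "x \<in> carrier A \<Longrightarrow> star (star x) = x"
    and star_b: "star (b v) = b v"
begin

lemma star_one: "star \<one> = \<one>"
  using star_mult[of "star \<one>" \<one>] by (simp add: star_star)

lemma star_val: "star (val w) = val (rev w)"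
  by (induction w) (auto simp: star_one star_mult star_b val_append)

lemma star_Mon: "x \<in> Mon m \<Longrightarrow> star x \<in> Mon m"
  unfolding Mon_def by (auto simp: star_smult star_val) (metis set_rev)

text \<open>The letters of a cup word are pairwise non-adjacent in the Coxeter graph, so their order
  does not matter.\<close>

lemma val_rev_cups: "m \<le> n \<Longrightarrow> val (rev (cups m v)) = g m v"
proof (induction m v rule: cups.induct)
  case (3 m v)
  show ?case
  proof (cases "m = 0")
    case False
    then show ?thesis using 3 b_val_commute[OF cups_gens, of m "Suc m" v]
      by (auto simp: val_append cups.simps)
  qed (auto simp: cups.simps)
qed auto

lemma star_g: "m \<le> n \<Longrightarrow> star (g m v) = g m v"
  by (simp add: star_val val_rev_cups)

lemma star_lower:
  assumes "z \<in> lower m t" "m \<le> n"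
  shows "star z \<in> lower m t"
proof -
  obtain x y v where z: "z = x \<otimes> g m v \<otimes> y" "x \<in> Mon m" "y \<in> Mon m" "shape m v" "level v < t"
    using assms(1) by (auto simp: lower_def)
  then have "star z = star y \<otimes> g m v \<otimes> star x"
    using assms(2) Mon_closed by (simp add: star_mult star_g m_assoc)
  then show ?thesis using z star_Mon by (auto intro: lowerI)
qed

section \<open>Straightening of monomials into cell elements\<close>

abbreviation u :: "nat \<Rightarrow> (nat \<Rightarrow> D_vertex) \<Rightarrow> 'a" where
  "u m S \<equiv> val (path_word m S)"

abbreviation cel :: "nat \<Rightarrow> (nat \<Rightarrow> D_vertex) \<Rightarrow> (nat \<Rightarrow> D_vertex) \<Rightarrow> 'a" where
  "cel m S T \<equiv> val (cell_word m S T)"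

lemma cel_eq: "cel m S T = u m S \<otimes> g m (S m) \<otimes> star (u m T)"
  by (simp add: cell_word_def val_append star_val m_assoc)

lemma star_cel: "m \<le> n \<Longrightarrow> S m = T m \<Longrightarrow> star (cel m S T) = cel m T S"
  by (simp add: cel_eq star_mult star_star star_g m_assoc)

lemma u_Mon: "u m S \<in> Mon m"
  using path_word_gens[of m S] gens_mono[of "m - 1" m] by (intro Mon_val) auto

lemma u_Suc: "2 \<le> m \<Longrightarrow> u (Suc m) (S(Suc m := v)) = u m S \<otimes> g m (S m)"
  using path_word_cong[of m "S(Suc m := v)" S] by (simp add: path_word_Suc val_append)

text \<open>Modulo lower cells, \<open>z\<close> is a multiple of one vector of the cell module at
  \<open>v\<close>. The notion is one-sided: the factor that belongs to the second path is
  absent.\<close>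

definition straight :: "nat \<Rightarrow> D_vertex \<Rightarrow> 'a \<Rightarrow> bool" where
  "straight m v z \<longleftrightarrow>
    (\<exists>r\<in>carrier R. \<exists>S\<in>paths m. S m = v \<and> z = r \<odot> (u m S \<otimes> g m v)) \<or> z \<in> lower m (level v)"

lemma straight_smult:
  assumes "straight m v z" "r \<in> carrier R"
  shows "straight m v (r \<odot> z)"
  using assms(1) unfolding straight_def
proof
  assume "\<exists>s\<in>carrier R. \<exists>S\<in>paths m. S m = v \<and> z = s \<odot> (u m S \<otimes> g m v)"
  then obtain s S where "s \<in> carrier R" "S \<in> paths m" "S m = v" "z = s \<odot> (u m S \<otimes> g m v)" by blast
  then show "(\<exists>s\<in>carrier R. \<exists>S\<in>paths m. S m = v \<and> r \<odot> z = s \<odot> (u m S \<otimes> g m v)) \<or> r \<odot> z \<in> lower m (level v)"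
    using assms(2) by (intro disjI1 bexI[of _ "r \<otimes>\<^bsub>R\<^esub> s"] bexI[of _ S]) (auto simp: smult_assoc1)
qed (use lower_smult assms in auto)

lemma straight_step:
  assumes "S \<in> paths m" "2 \<le> m" "adj (S m) v" "r \<in> carrier R"
  shows "straight (Suc m) v (r \<odot> (u m S \<otimes> g m (S m) \<otimes> g (Suc m) v))"
proof -
  have "S(Suc m := v) \<in> paths (Suc m)" using assms by (intro paths_step) auto
  then show ?thesis unfolding straight_def using assms
    by (intro disjI1 bexI[of _ r] bexI[of _ "S(Suc m := v)"]) (auto simp: u_Suc)
qed

text \<open>The bound \<open>below (S m) v\<close> keeps track of the cell: when this is used for
  the inductive step, it separates the cell of \<open>v\<close> itself from cells of smaller
  level.\<close>

definition spanned :: "nat \<Rightarrow> bool" where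
  "spanned m \<longleftrightarrow> (\<forall>x\<in>Mon m. \<forall>y\<in>Mon m. \<forall>v. shape m v \<longrightarrow>
    (\<exists>r\<in>carrier R. \<exists>S\<in>paths m. \<exists>T\<in>paths m. S m = T m \<and> below (S m) v \<and>
      x \<otimes> g m v \<otimes> y = r \<odot> cel m S T))"

text \<open>Straightening \<open>x\<close> from the left and, through \<open>star\<close>,
  \<open>y\<close> from the right gives a cell element, unless one of them drops to a smaller level;
  the induction on \<open>level v\<close> takes over then.\<close>

lemma straight_imp_spanned:
  assumes "m \<le> n" and straight: "\<And>x v. x \<in> Mon m \<Longrightarrow> shape m v \<Longrightarrow> straight m v (x \<otimes> g m v)"
  shows "spanned m"
proof -
  have "\<exists>r\<in>carrier R. \<exists>S\<in>paths m. \<exists>T\<in>paths m. S m = T m \<and> below (S m) v \<and>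
      x \<otimes> g m v \<otimes> y = r \<odot> cel m S T"
    if "shape m v" "x \<in> Mon m" "y \<in> Mon m" for x y v
    using that
  proof (induction "level v" arbitrary: v x y rule: less_induct)
    case less
    note cl = Mon_closed[OF less.prems(2)] Mon_closed[OF less.prems(3)]
    have low: "\<exists>r\<in>carrier R. \<exists>S\<in>paths m. \<exists>T\<in>paths m. S m = T m \<and> below (S m) v \<and> z = r \<odot> cel m S T"
      if "z \<in> lower m (level v)" for z
    proof -
      obtain x' y' v' where z: "z = x' \<otimes> g m v' \<otimes> y'" "x' \<in> Mon m" "y' \<in> Mon m" "shape m v'" "level v' < level v"
        using \<open>z \<in> lower m (level v)\<close> by (auto simp: lower_def)
      obtain r S T where "r \<in> carrier R" "S \<in> paths m" "T \<in> paths m" "S m = T m" "below (S m) v'"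
        "z = r \<odot> cel m S T"
        using less.hyps[OF z(5,4,2,3)] z(1) by blast
      moreover from this have "below (S m) v" using z(5) by (auto simp: below_def)
      ultimately show ?thesis by blast
    qed
    from straight[OF less.prems(2,1)] consider r S where "r \<in> carrier R" "S \<in> paths m" "S m = v"
        "x \<otimes> g m v = r \<odot> (u m S \<otimes> g m v)" | "x \<otimes> g m v \<in> lower m (level v)"
      unfolding straight_def by blast
    then show ?case
    proof cases
      case 1
      from straight[OF star_Mon[OF less.prems(3)] less.prems(1)]
      consider s T where "s \<in> carrier R" "T \<in> paths m" "T m = v"
        "star y \<otimes> g m v = s \<odot> (u m T \<otimes> g m v)" | "star y \<otimes> g m v \<in> lower m (level v)"
        unfolding straight_def by blast
      then show ?thesis
      proof cases
        case 2
        have "g m v \<otimes> y = star (star y \<otimes> g m v)"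
          using cl assms(1) by (simp add: star_mult star_star star_g)
        then have "g m v \<otimes> y \<in> lower m (level v)" using star_lower[OF 2 assms(1)] by simp
        then have "x \<otimes> (g m v \<otimes> y) \<in> lower m (level v)" using less.prems lower_mult_left by blast
        then show ?thesis using low cl by (simp add: m_assoc)
      next
        case T: 1
        have "g m v \<otimes> y = star (star y \<otimes> g m v)"
          using cl assms(1) by (simp add: star_mult star_star star_g)
        also have "\<dots> = s \<odot> (g m v \<otimes> star (u m T))"
          using T assms(1) by (simp add: star_smult star_mult star_g)
        finally have *: "g m v \<otimes> y = s \<odot> (g m v \<otimes> star (u m T))" .
        have "x \<otimes> g m v \<otimes> y = r \<odot> (u m S \<otimes> (g m v \<otimes> y))"
          using 1 cl by (simp add: smult_mult_left m_assoc)
        also have "\<dots> = (r \<otimes>\<^bsub>R\<^esub> s) \<odot> cel m S T"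
          using 1 T by (simp add: * cel_eq smult_mult_right smult_assoc1 m_assoc)
        finally show ?thesis using 1 T
          by (intro bexI[of _ "r \<otimes>\<^bsub>R\<^esub> s"] bexI[of _ S] bexI[of _ T]) (auto simp: below_def)
      qed
    next
      case 2
      then show ?thesis using low lower_mult_right less.prems by blast
    qed
  qed
  then show ?thesis by (simp add: spanned_def)
qed

text \<open>The cup word of \<open>v\<close> is empty, and so are all cup words along the path that
  rises at every step.\<close>

lemma straight_full:
  assumes "2 \<le> m" "m \<le> n" "shape m v" "level v = m" "x \<in> Mon m"
  shows "straight m v (x \<otimes> g m v)"
proof -
  define S where "S = (\<lambda>j. if 1 \<le> j \<and> j \<le> m then Node j else Node_bar)"
  have "S \<in> paths m" using assms by (auto simp: S_def paths_def is_path_def adj_def)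
  moreover have "v = Node m" using assms by (cases v) auto
  moreover have "path_word m S = []" by (auto simp: path_word_def S_def)
  ultimately show ?thesis
    using Mon_scalar_or_lower[of m x] assms Mon_closed[OF assms(5)] unfolding straight_def
    by (auto simp: S_def intro!: bexI[of _ S])
qed

lemma straight_2:
  assumes "level v = 0" "x \<in> Mon 2"
  shows "straight 2 v (x \<otimes> g 2 v)"
proof -
  define S :: "nat \<Rightarrow> D_vertex" where "S = (\<lambda>j. if j = 1 then Node 1 else if j = 2 then v else Node_bar)"
  have "S \<in> paths 2" using assms by (auto simp: S_def paths_def is_path_def adj_def less_2_cases_iff)
  moreover have "S 2 = v" by (simp add: S_def)
  ultimately show ?thesis
    using Mon_2_mult_g[OF assms(2,1)] unfolding straight_def by (auto intro!: bexI[of _ S] disjI1)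
qed

text \<open>By parity \<open>S m\<close> lies one level under \<open>v\<close> or further down. The
  zigzag identity places \<open>g (Suc m) ?w\<close> between two copies of \<open>?h\<close>. If
  \<open>?w = v\<close>, this creates a sandwich at \<open>v\<close>, and \<open>S\<close> extends
  by a step up to \<open>v\<close>; otherwise it shows that \<open>?h\<close> already lies in
  \<open>lower\<close>.\<close>

lemma straight_lower_cell:
  assumes S: "S \<in> paths m" and m: "2 \<le> m" "m < n" and v: "shape (Suc m) v"
    and lt: "level (S m) < Suc (level v)" and z: "z \<in> Mon m"
  shows "straight (Suc m) v (u m S \<otimes> g m (S m) \<otimes> z \<otimes> g (Suc m) v)"
proof -
  let ?h = "g m (S m)" and ?w = "Node (Suc (level (S m)))"
  have sh: "shape m (S m)" using S m is_path_shape by (auto simp: paths_def)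
  have zig: "?h \<otimes> g (Suc m) ?w \<otimes> ?h = ?h" using g_zigzag[OF sh] m by simp
  have M: "?h \<in> Mon (Suc m)" "z \<in> Mon (Suc m)" "u m S \<in> Mon (Suc m)"
    using g_Mon[of m] u_Mon[of m S] z Mon_mono[of m "Suc m"] by auto
  note cl = Mon_closed[OF z]
  have "Suc (level (S m)) = level v \<or> Suc (level (S m)) < level v"
    using shape_neighbour_cases[OF sh v] lt by auto
  then show ?thesis
  proof
    assume l: "Suc (level (S m)) = level v"
    \<comment> \<open>The level is positive, and only level \<open>0\<close> has more than one
      vertex.\<close>
    then have v': "?w = v" by (cases v) auto
    have "u m S \<otimes> ?h \<otimes> z \<otimes> g (Suc m) v
      = u m S \<otimes> (?h \<otimes> g (Suc m) v \<otimes> ?h) \<otimes> z \<otimes> g (Suc m) v"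
      using zig by (simp add: v')
    also have "\<dots> = (u m S \<otimes> ?h) \<otimes> (g (Suc m) v \<otimes> (?h \<otimes> z) \<otimes> g (Suc m) v)"
      using cl by (simp add: m_assoc)
    finally have eq: "u m S \<otimes> ?h \<otimes> z \<otimes> g (Suc m) v
      = (u m S \<otimes> ?h) \<otimes> (g (Suc m) v \<otimes> (?h \<otimes> z) \<otimes> g (Suc m) v)" .
    from g_sandwich[OF _ _ v Mon_mult[OF M(1,2)]] m
    consider r where "r \<in> carrier R" "g (Suc m) v \<otimes> (?h \<otimes> z) \<otimes> g (Suc m) v = r \<odot> g (Suc m) v"
      | "g (Suc m) v \<otimes> (?h \<otimes> z) \<otimes> g (Suc m) v \<in> lower (Suc m) (level v)" by auto
    then show ?thesis
    proof cases
      case 1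
      then show ?thesis using straight_step[OF S m(1), of v r] l
        by (simp add: eq smult_mult_right adj_def)
    next
      case 2
      then show ?thesis unfolding straight_def using eq lower_mult_left Mon_mult M by auto
    qed
  next
    assume l: "Suc (level (S m)) < level v"
    have "?h \<in> lower (Suc m) (level v)"
      using lowerI[OF M(1) M(1), of ?w "level v"] l sh zig by (auto simp: shape_def)
    then have "u m S \<otimes> ?h \<otimes> z \<otimes> g (Suc m) v \<in> lower (Suc m) (level v)"
      using M g_Mon[of "Suc m" v] by (intro lower_mult_right lower_mult_left)
    then show ?thesis by (simp add: straight_def)
  qed
qed

text \<open>The inductive step. \<open>Mon_absorb\<close> replaces \<open>x\<close> by a monomial on
  \<open>k + 1\<close> strands and the zigzag identity exposes \<open>g (Suc k) ?w\<close>, so that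
  spanning on \<open>k + 1\<close> strands applies. The cell found is either of smaller level than
  \<open>?w\<close>, where \<open>straight_lower_cell\<close> finishes, or it is \<open>?w\<close>,
  from where a step down leads to \<open>v\<close>.\<close>

lemma straight_all:
  assumes sp: "spanned (Suc k)" and k: "1 \<le> k" "Suc (Suc k) \<le> n"
    and v: "shape k v" and x: "x \<in> Mon (Suc (Suc k))"
  shows "straight (Suc (Suc k)) v (x \<otimes> g (Suc (Suc k)) v)"
proof -
  let ?m = "Suc (Suc k)" and ?b = "b (Node (Suc k))" and ?w = "Node (Suc (level v))"
  have g: "g ?m v = g k v \<otimes> ?b" using v k by (intro g_Suc_Suc) (auto simp: shape_def)
  have c: "g k v \<otimes> ?b = ?b \<otimes> g k v"
    using Mon_commute[OF g_Mon] k by auto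
  have v': "shape ?m v" "shape (Suc k) ?w" using v by (auto simp: shape_def)
  have zig: "g k v \<otimes> g (Suc k) ?w \<otimes> g k v = g k v"
    using v k by (intro g_zigzag) auto
  have gk: "g k v \<in> Mon (Suc k)" using g_Mon[of k v] Mon_mono[of k "Suc k"] by auto
  obtain y where y: "y \<in> Mon (Suc k)" "x \<otimes> ?b = y \<otimes> ?b"
    using Mon_absorb[of "Suc k" x] k x by auto
  note cl = Mon_closed[OF x] Mon_closed[OF y(1)]
  have cell: "straight ?m v (u (Suc k) S \<otimes> g (Suc k) (S (Suc k)) \<otimes> z \<otimes> g ?m v)"
    if "S \<in> paths (Suc k)" "level (S (Suc k)) < Suc (level v)" "z \<in> Mon (Suc k)" for S z
    using straight_lower_cell[OF that(1) _ _ v'(1) that(2,3)] k by simp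
  have M: "star (u (Suc k) T) \<in> Mon (Suc k)" for T by (intro star_Mon u_Mon)
  obtain r S T where r: "r \<in> carrier R" and S: "S \<in> paths (Suc k)" and T: "T \<in> paths (Suc k)"
    and bel: "below (S (Suc k)) ?w"
    and eq: "(y \<otimes> g k v) \<otimes> g (Suc k) ?w \<otimes> \<one> = r \<odot> cel (Suc k) S T"
    using sp v'(2) Mon_mult[OF y(1) gk] Mon_one unfolding spanned_def by blast
  let ?h = "g (Suc k) (S (Suc k))" and ?t = "star (u (Suc k) T)"
  have "x \<otimes> g ?m v = (x \<otimes> ?b) \<otimes> g k v"
    using cl by (simp add: g c m_assoc)
  also have "\<dots> = y \<otimes> (g k v \<otimes> g (Suc k) ?w \<otimes> g k v) \<otimes> ?b"
    using cl by (simp add: y(2) zig) (simp add: m_assoc c)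
  also have "\<dots> = ((y \<otimes> g k v) \<otimes> g (Suc k) ?w \<otimes> \<one>) \<otimes> g ?m v"
    using cl by (simp add: g m_assoc)
  also have "\<dots> = r \<odot> (u (Suc k) S \<otimes> ?h \<otimes> ?t \<otimes> g ?m v)"
    using r unfolding eq by (simp add: cel_eq smult_mult_left)
  finally have xeq: "x \<otimes> g ?m v = r \<odot> (u (Suc k) S \<otimes> ?h \<otimes> ?t \<otimes> g ?m v)" .
  have "straight ?m v (u (Suc k) S \<otimes> ?h \<otimes> ?t \<otimes> g ?m v)"
  proof (cases "level (S (Suc k)) < Suc (level v)")
    case True
    then show ?thesis using cell S M by blast
  next
    case False
    then have Sw: "S (Suc k) = ?w" using bel by (auto simp: below_def)
    \<comment> \<open>The zigzag identity supplies a second copy of \<open>?h\<close>, which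
      encloses the unwanted factor \<open>?t\<close> in a sandwich.\<close>
    have "u (Suc k) S \<otimes> ?h \<otimes> ?t \<otimes> g ?m v
      = u (Suc k) S \<otimes> ?h \<otimes> ?t \<otimes> (g k v \<otimes> ?h \<otimes> g k v) \<otimes> ?b"
      using zig by (simp add: g Sw m_assoc)
    also have "\<dots> = u (Suc k) S \<otimes> (?h \<otimes> (?t \<otimes> g k v) \<otimes> ?h) \<otimes> g ?m v"
      by (simp add: g m_assoc)
    finally have eq2: "u (Suc k) S \<otimes> ?h \<otimes> ?t \<otimes> g ?m v
      = u (Suc k) S \<otimes> (?h \<otimes> (?t \<otimes> g k v) \<otimes> ?h) \<otimes> g ?m v" .
    from g_sandwich[of "Suc k" "S (Suc k)" "?t \<otimes> g k v"] k v' Sw Mon_mult[OF M gk]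
    consider s where "s \<in> carrier R" "?h \<otimes> (?t \<otimes> g k v) \<otimes> ?h = s \<odot> ?h"
      | "?h \<otimes> (?t \<otimes> g k v) \<otimes> ?h \<in> lower (Suc k) (level ?w)" by auto
    then show ?thesis
    proof cases
      case 1
      have "u (Suc k) S \<otimes> ?h \<otimes> ?t \<otimes> g ?m v = s \<odot> (u (Suc k) S \<otimes> ?h \<otimes> g ?m v)"
        using 1(1) unfolding eq2 1(2) by (simp add: smult_mult_right smult_mult_left)
      then show ?thesis using straight_step[OF S, of v s] k Sw 1(1) by (simp add: adj_def)
    next
      case 2
      \<comment> \<open>A lower product is again a two-sided monomial on \<open>k + 1\<close>
        strands, so spanning puts it into a cell of smaller level than \<open>?w\<close>, where the
        first case applies.\<close>
      then obtain x' y' v2 where z: "?h \<otimes> (?t \<otimes> g k v) \<otimes> ?h = x' \<otimes> g (Suc k) v2 \<otimes> y'"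
          "x' \<in> Mon (Suc k)" "y' \<in> Mon (Suc k)" "shape (Suc k) v2" "level v2 < Suc (level v)"
        by (auto simp: lower_def)
      note cl' = Mon_closed[OF z(2)] Mon_closed[OF z(3)]
      obtain s S' T' where s: "s \<in> carrier R" "S' \<in> paths (Suc k)" "below (S' (Suc k)) v2"
        "(u (Suc k) S \<otimes> x') \<otimes> g (Suc k) v2 \<otimes> y' = s \<odot> cel (Suc k) S' T'"
        using sp z(3,4) Mon_mult[OF u_Mon z(2)] unfolding spanned_def by blast
      have "u (Suc k) S \<otimes> ?h \<otimes> ?t \<otimes> g ?m v
        = ((u (Suc k) S \<otimes> x') \<otimes> g (Suc k) v2 \<otimes> y') \<otimes> g ?m v"
        using cl' unfolding eq2 z(1) by (simp add: m_assoc)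
      also have "\<dots> = s \<odot> (u (Suc k) S' \<otimes> g (Suc k) (S' (Suc k)) \<otimes> star (u (Suc k) T') \<otimes> g ?m v)"
        using s(1) unfolding s(4) by (simp add: cel_eq smult_mult_left)
      finally show ?thesis
        using cell[OF s(2) _ M] straight_smult[OF _ s(1)] s(3) z(5) by (auto simp: below_def)
    qed
  qed
  then show ?thesis using xeq r straight_smult by simp
qed

lemma spanned_all: "2 \<le> m \<Longrightarrow> m \<le> n \<Longrightarrow> spanned m"
proof (induction m rule: nat_induct_at_least)
  case base
  show ?case
  proof (rule straight_imp_spanned)
    show "straight 2 v (x \<otimes> g 2 v)" if "x \<in> Mon 2" "shape 2 v" for x v
    proof -
      have "level v = 0 \<or> level v = 2" using that unfolding shape_def by presburger
      then show ?thesis using straight_2 straight_full[of 2] that n2 by auto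
    qed
  qed (rule n2)
next
  case (Suc m)
  show ?case
  proof (rule straight_imp_spanned[OF Suc.prems])
    fix x v assume x: "x \<in> Mon (Suc m)" and v: "shape (Suc m) v"
    show "straight (Suc m) v (x \<otimes> g (Suc m) v)"
    proof (cases "Suc m = level v")
      case True
      then show ?thesis using straight_full Suc x v by auto
    next
      case False
      then obtain k where "Suc m = Suc (Suc k)" "shape k v" using v by (metis shape_Suc_Suc)
      then show ?thesis using straight_all[of k v x] Suc x by auto
    qed
  qed
qed

end


section \<open>The path representation\<close>

text \<open>Entries of an eigenvector of the graph for the eigenvalue \<open>d\<close>, by level.
  Weight \<open>1\<close> at both ends forces \<open>d\<close> at \<open>Node 1\<close> and
  \<open>d\<^sup>2 - 2\<close> at \<open>Node 2\<close>, where two ends are subtracted. From index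
  \<open>1\<close> on these are the Chebyshev values \<open>2 T\<^sub>m(d/2)\<close>.\<close>

fun wt :: "real \<Rightarrow> nat \<Rightarrow> real" where
  "wt d 0 = 1"
| "wt d (Suc 0) = d"
| "wt d (Suc (Suc 0)) = d\<^sup>2 - 2"
| "wt d (Suc (Suc (Suc m))) = d * wt d (Suc (Suc m)) - wt d (Suc m)"

text \<open>Positivity is carried along with growth: for \<open>0 < x'\<close>,
  \<open>x \<le> x'\<close> and \<open>2 \<le> d\<close>, the next value \<open>d x' - x\<close> is
  at least \<open>2 x' - x\<close>, hence at least \<open>x'\<close>.\<close>

lemma wt_mono:
  assumes "2 \<le> d"
  shows "0 < wt d m" "0 < m \<Longrightarrow> wt d m \<le> wt d (Suc m)"
proof -
  have *: "0 < wt d (Suc m) \<and> wt d (Suc m) \<le> wt d (Suc (Suc m))" for m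
  proof (induction m)
    case 0
    have "0 \<le> (d - 2) * (d + 1)" using assms by (intro mult_nonneg_nonneg) auto
    then show ?case using assms by (simp add: algebra_simps power2_eq_square)
  next
    case (Suc m)
    have "2 * wt d (Suc (Suc m)) \<le> d * wt d (Suc (Suc m))"
      using assms Suc by (intro mult_right_mono) linarith+
    then show ?case using Suc unfolding wt.simps(4) by linarith
  qed
  from * show "0 < wt d m" by (cases m) auto
  from * show "0 < m \<Longrightarrow> wt d m \<le> wt d (Suc m)" by (cases m) auto
qed

section \<open>Neighbourhoods and local changes of paths\<close>

definition nbrs :: "D_vertex \<Rightarrow> D_vertex set" where
  "nbrs v = {w. adj v w}"

lemma level_eq_iff:
  "level v = 0 \<longleftrightarrow> v = Node_bar \<or> v = Node 0" "0 = level v \<longleftrightarrow> v = Node_bar \<or> v = Node 0"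
  "level v = Suc t \<longleftrightarrow> v = Node (Suc t)" "Suc t = level v \<longleftrightarrow> v = Node (Suc t)"
  by (cases v; auto)+

lemma nbrs_bar: "nbrs Node_bar = {Node 1}"
  and nbrs_0: "nbrs (Node 0) = {Node 1}"
  and nbrs_1: "nbrs (Node 1) = {Node_bar, Node 0, Node 2}"
  and nbrs_Suc_Suc: "nbrs (Node (Suc (Suc t))) = {Node (Suc t), Node (Suc (Suc (Suc t)))}"
  unfolding set_eq_iff nbrs_def adj_def by (auto simp: level_eq_iff)

lemma finite_nbrs: "finite (nbrs v)"
proof (rule finite_subset)
  have "w \<in> insert Node_bar (Node ` {..Suc (level v)})" if "adj v w" for w
    using that by (cases w) (auto simp: adj_def)
  then show "nbrs v \<subseteq> insert Node_bar (Node ` {..Suc (level v)})"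
    by (auto simp: nbrs_def)
qed auto

lemma adj_sym: "adj v w \<longleftrightarrow> adj w v"
  by (auto simp: adj_def)

lemma in_nbrs: "w \<in> nbrs v \<longleftrightarrow> adj v w"
  by (simp add: nbrs_def)

lemma is_path_adj: "is_path n P \<Longrightarrow> 1 \<le> j \<Longrightarrow> j < n \<Longrightarrow> adj (P j) (P (Suc j))"
  by (simp add: is_path_def)

text \<open>These are the moves made by \<open>mid_act\<close>. The bound \<open>2 \<le> i\<close>
  protects the starting vertex.\<close>

lemma is_path_upd:
  assumes "is_path n P" "2 \<le> i" "i < n" "P (i - 1) = P (Suc i)" "adj (P (i - 1)) w"
  shows "is_path n (P(i := w))"
  unfolding is_path_def
proof (intro conjI allI impI)
  fix j assume "1 \<le> j" "j < n"
  then show "adj ((P(i := w)) j) ((P(i := w)) (Suc j))"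
    using assms is_path_adj[OF assms(1), of j] adj_sym
    by (cases "j = i"; cases "Suc j = i") auto
qed (use assms in \<open>auto simp: is_path_def\<close>)

locale path_rep =
  fixes d :: real and n :: nat
  assumes d: "2 \<le> d"
begin

definition W :: "D_vertex \<Rightarrow> real" where
  "W v = wt d (level v)"

lemma W_pos: "0 < W v"
  using wt_mono(1)[OF d] by (simp add: W_def)

lemma sum_W: "(\<Sum>w\<in>nbrs v. W w) = d * W v"
proof (cases v)
  case (Node t)
  consider "t = 0" | "t = 1" | k where "t = Suc (Suc k)"
    by (metis One_nat_def not0_implies_Suc)
  then show ?thesis
  proof cases
    case 1 then show ?thesis using nbrs_0 Node by (simp add: W_def)
  next
    case 2 then show ?thesis using nbrs_1 Node
      by (simp add: W_def numeral_2_eq_2 power2_eq_square)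
  next
    case 3 then show ?thesis using nbrs_Suc_Suc Node by (simp add: W_def)
  qed
qed (simp add: nbrs_bar W_def)

text \<open>The first two generators would change step \<open>1\<close>, which is pinned to
  \<open>Node 1\<close>. So they act diagonally, as \<open>d\<close> times the projection to the
  paths visiting a given end vertex at step \<open>2\<close>.\<close>

definition end_act :: "D_vertex \<Rightarrow> ((nat \<Rightarrow> D_vertex) \<Rightarrow> real) \<Rightarrow> (nat \<Rightarrow> D_vertex) \<Rightarrow> real" where
  "end_act e \<phi> P = (if is_path n P \<and> P 2 = e then d * \<phi> P else 0)"

text \<open>Jones's path model: step \<open>i\<close> is rerouted between two equal neighbours. The
  ratio of weights is a diagonal rescaling of the usual symmetric matrix entries and needs no square
  roots. The test on \<open>P\<close> makes the result vanish off the paths.\<close>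

definition mid_act :: "nat \<Rightarrow> ((nat \<Rightarrow> D_vertex) \<Rightarrow> real) \<Rightarrow> (nat \<Rightarrow> D_vertex) \<Rightarrow> real" where
  "mid_act i \<phi> P = (if is_path n P \<and> P (i - 1) = P (Suc i)
     then \<Sum>w\<in>nbrs (P (i - 1)). W w / W (P (i - 1)) * \<phi> (P(i := w)) else 0)"

text \<open>Generator \<open>Node 1\<close> acts through the end vertex \<open>Node 0\<close>; here
  the shift between generators and vertices of the path graph shows.\<close>

definition act :: "D_vertex \<Rightarrow> ((nat \<Rightarrow> D_vertex) \<Rightarrow> real) \<Rightarrow> (nat \<Rightarrow> D_vertex) \<Rightarrow> real" where
  "act v = (case v of Node_bar \<Rightarrow> end_act Node_bar | Node i \<Rightarrow> if i \<le> 1 then end_act (Node 0) else mid_act i)"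

lemma act_simps:
  "act Node_bar = end_act Node_bar" "act (Node (Suc 0)) = end_act (Node 0)"
  "2 \<le> i \<Longrightarrow> act (Node i) = mid_act i"
  by (auto simp: act_def)

text \<open>The sum runs over all values of step \<open>i\<close>, so it forgets the value that step
  had before.\<close>

lemma mid_act_upd:
  assumes "is_path n P" "2 \<le> i" "i < n" "P (i - 1) = P (Suc i)" "w \<in> nbrs (P (i - 1))"
  shows "mid_act i \<phi> (P(i := w)) = mid_act i \<phi> P"
proof -
  have "is_path n (P(i := w))" using assms by (intro is_path_upd) (auto simp: in_nbrs)
  moreover have "i - 1 \<noteq> i" using assms by simp
  ultimately show ?thesis using assms by (simp add: mid_act_def)
qed

lemma end_act_sq: "end_act e (end_act e \<phi>) P = d * end_act e \<phi> P"
  by (simp add: end_act_def)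

text \<open>By \<open>mid_act_upd\<close> the inner value is constant along the outer sum, whose
  coefficients add up to \<open>d\<close> by the eigenvalue equation \<open>sum_W\<close>.\<close>

lemma mid_act_sq:
  assumes "2 \<le> i" "i < n"
  shows "mid_act i (mid_act i \<phi>) P = d * mid_act i \<phi> P"
proof (cases "is_path n P \<and> P (i - 1) = P (Suc i)")
  case True
  have "mid_act i (mid_act i \<phi>) P = (\<Sum>w\<in>nbrs (P (i - 1)). W w / W (P (i - 1)) * mid_act i \<phi> P)"
    unfolding mid_act_def[of i "mid_act i \<phi>"] using True assms
    by (auto intro!: sum.cong simp: mid_act_upd)
  also have "\<dots> = (\<Sum>w\<in>nbrs (P (i - 1)). W w) / W (P (i - 1)) * mid_act i \<phi> P"
    by (simp add: sum_divide_distrib sum_distrib_right)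
  also have "\<dots> = d * mid_act i \<phi> P"
    using W_pos[of "P (i - 1)"] by (simp add: sum_W)
  finally show ?thesis .
qed (auto simp: mid_act_def)

lemma act_sq: "v \<in> gens n \<Longrightarrow> act v (act v \<phi>) P = d * act v \<phi> P"
  using end_act_sq mid_act_sq by (auto simp: gens_def act_def)

lemma end_act_pair: "e \<noteq> e' \<Longrightarrow> end_act e (end_act e' \<phi>) P = 0"
  by (simp add: end_act_def)

text \<open>Rerouting a step \<open>i \<ge> 3\<close> leaves step \<open>2\<close> alone.\<close>

lemma end_mid_commute:
  assumes "3 \<le> i" "i < n"
  shows "end_act e (mid_act i \<phi>) P = mid_act i (end_act e \<phi>) P"
proof (cases "is_path n P \<and> P (i - 1) = P (Suc i)")
  case True
  have *: "end_act e \<phi> (P(i := w)) = (if P 2 = e then d * \<phi> (P(i := w)) else 0)"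
    if "w \<in> nbrs (P (i - 1))" for w
    using that assms True is_path_upd[of n P i w] by (auto simp: end_act_def in_nbrs)
  have "mid_act i (end_act e \<phi>) P
    = (\<Sum>w\<in>nbrs (P (i - 1)). W w / W (P (i - 1)) * (if P 2 = e then d * \<phi> (P(i := w)) else 0))"
    using True by (simp add: mid_act_def * cong: sum.cong)
  then show ?thesis using True
    by (auto simp: end_act_def mid_act_def sum_distrib_left mult_ac)
qed (auto simp: mid_act_def end_act_def)

text \<open>The condition and the coefficients of this double sum are symmetric in \<open>i\<close>
  and \<open>j\<close>, which gives commutation once the sums are interchanged.\<close>

lemma mid_mid_eq:
  assumes "2 \<le> i" "2 \<le> j" "i < n" "j < n" "Suc i < j \<or> Suc j < i"
  shows "mid_act i (mid_act j \<phi>) P =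
    (if is_path n P \<and> P (i - 1) = P (Suc i) \<and> P (j - 1) = P (Suc j) then
      \<Sum>w\<in>nbrs (P (i - 1)). \<Sum>x\<in>nbrs (P (j - 1)).
        W w / W (P (i - 1)) * (W x / W (P (j - 1))) * \<phi> (P(i := w, j := x)) else 0)"
proof (cases "is_path n P \<and> P (i - 1) = P (Suc i)")
  case True
  have "mid_act j \<phi> (P(i := w)) = (if P (j - 1) = P (Suc j) then
      \<Sum>x\<in>nbrs (P (j - 1)). W x / W (P (j - 1)) * \<phi> (P(i := w, j := x)) else 0)"
    if "w \<in> nbrs (P (i - 1))" for w
  proof -
    have "is_path n (P(i := w))" "j - 1 \<noteq> i" "Suc j \<noteq> i"
      using that assms True is_path_upd[of n P i w] by (auto simp: in_nbrs)
    then show ?thesis by (auto simp: mid_act_def)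
  qed
  then show ?thesis using True
    by (auto simp: mid_act_def[of i] sum_distrib_left sum_divide_distrib mult_ac intro!: sum.cong)
qed (auto simp: mid_act_def)

lemma mid_mid_commute:
  assumes "2 \<le> i" "2 \<le> j" "i < n" "j < n" "Suc i < j \<or> Suc j < i"
  shows "mid_act i (mid_act j \<phi>) P = mid_act j (mid_act i \<phi>) P"
proof -
  have "i \<noteq> j" "Suc j < i \<or> Suc i < j" using assms by auto
  then show ?thesis
    using sum.swap[of "\<lambda>w x. W w / W (P (i - 1)) * (W x / W (P (j - 1))) * \<phi> (P(i := w, j := x))"
        "nbrs (P (j - 1))" "nbrs (P (i - 1))"]
    unfolding mid_mid_eq[OF assms] mid_mid_eq[OF assms(2,1,4,3) \<open>Suc j < i \<or> Suc i < j\<close>]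
    by (auto simp: fun_upd_twist mult_ac)
qed

lemma act_commute:
  assumes "v \<in> gens n" "w \<in> gens n" "{v, w} \<notin> D_edges n"
  shows "act v (act w \<phi>) P = act w (act v \<phi>) P"
proof (cases "v = w")
  case False
  have sym: "{w, v} \<notin> D_edges n" using assms(3) by (metis insert_commute)
  have far: "3 \<le> i" if "v' = Node_bar \<or> v' = Node 1" "i < n" "2 \<le> i" "{v', Node i} \<notin> D_edges n" for v' i
    using that by (force simp: D_edges_def numeral_2_eq_2 numeral_3_eq_3)
  have e: "act v (act w \<phi>) P = act w (act v \<phi>) P"
    if "v = Node_bar \<or> v = Node 1" "w = Node i" "2 \<le> i" "i < n" "{v, w} \<notin> D_edges n" for v w i
    using far[of v i] that end_mid_commute by (auto simp: act_simps)
  have m: "act (Node i) (act (Node j) \<phi>) P = act (Node j) (act (Node i) \<phi>) P"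
    if "2 \<le> i" "2 \<le> j" "i < n" "j < n" "{Node i, Node j} \<notin> D_edges n" "i \<noteq> j" for i j
  proof -
    have "{Node k, Node (Suc k)} \<in> D_edges n" "{Node (Suc k), Node k} \<in> D_edges n"
      if "1 \<le> k" "Suc k < n" for k
      using that by (auto simp: D_edges_def)
    then have "Suc i \<noteq> j" "Suc j \<noteq> i" using that by auto
    then have "Suc i < j \<or> Suc j < i" using that by linarith
    then show ?thesis using that mid_mid_commute by (simp add: act_simps)
  qed
  have c: "v = Node_bar \<or> v = Node 1 \<or> (\<exists>i. v = Node i \<and> 2 \<le> i \<and> i < n)" if "v \<in> gens n" for v
  proof (cases v)
    case (Node i)
    then show ?thesis using that by (cases "i = 1") (auto simp: gens_def)
  qed simp
  show ?thesis
    using c[OF assms(1)] c[OF assms(2)]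
  proof (elim disjE exE conjE)
    fix i assume "v = Node_bar" "w = Node i" "2 \<le> i" "i < n"
    then show ?thesis using e[of v w i] assms(3) by simp
  next
    fix i assume "v = Node 1" "w = Node i" "2 \<le> i" "i < n"
    then show ?thesis using e[of v w i] assms(3) by simp
  next
    fix i assume "v = Node i" "w = Node_bar" "2 \<le> i" "i < n"
    then show ?thesis using e[of w v i] sym by simp
  next
    fix i assume "v = Node i" "w = Node 1" "2 \<le> i" "i < n"
    then show ?thesis using e[of w v i] sym by simp
  next
    fix i j assume "v = Node i" "2 \<le> i" "i < n" "w = Node j" "2 \<le> j" "j < n"
    then show ?thesis using m[of i j] assms(3) False by simp
  qed (use False end_act_pair[of Node_bar "Node 0"] end_act_pair[of "Node 0" Node_bar]
    in \<open>simp_all add: act_simps\<close>)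
qed simp

text \<open>Among the values of step \<open>i\<close>, only \<open>w\<close>, the vertex on the far
  side of \<open>j\<close>, lets \<open>j\<close> act. After that, only resetting step
  \<open>j\<close> to \<open>p\<close> lets \<open>i\<close> act again. A single term survives, and
  its two weight ratios cancel.\<close>

lemma mid_mid_braid:
  assumes "2 \<le> i" "2 \<le> j" "i < n" "j < n" "j = Suc i \<or> i = Suc j"
  shows "mid_act i (mid_act j (mid_act i \<phi>)) P = mid_act i \<phi> P"
proof (cases "is_path n P \<and> P (i - 1) = P (Suc i)")
  case True
  define p where "p = P (i - 1)"
  \<comment> \<open>\<open>k\<close> is the step next to \<open>j\<close> on the side away from
    \<open>i\<close>.\<close>
  define k where "k = (if j = Suc i then Suc j else j - 1)"
  define w where "w = P k"
  define Q where "Q = P(i := w)"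
  have Pj: "P j = p" using assms True by (auto simp: p_def)
  have "adj p w"
  proof (cases "j = Suc i")
    case True
    then show ?thesis using is_path_adj[of n P j] assms Pj \<open>is_path n P \<and> _\<close> by (simp add: w_def k_def)
  next
    case False
    then have "adj (P k) (P (Suc k))" "Suc k = j"
      using is_path_adj[of n P k] assms True by (auto simp: k_def)
    then show ?thesis using Pj adj_sym by (simp add: w_def)
  qed
  then have w: "w \<in> nbrs p" by (simp add: in_nbrs)
  have pathQ: "is_path n (P(i := x))" if "x \<in> nbrs p" for x
    using that is_path_upd[of n P i x] assms True by (simp add: in_nbrs p_def)
  have jcond: "(P(i := x)) (j - 1) = (P(i := x)) (Suc j) \<longleftrightarrow> x = w" for x
    using assms by (auto simp: w_def k_def)
  have Qj: "Q (j - 1) = w" using assms by (auto simp: w_def k_def Q_def)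
  have psi: "mid_act i \<phi> Q = mid_act i \<phi> P"
    unfolding Q_def using assms True w by (intro mid_act_upd) (auto simp: p_def)
  have QQ: "Q(j := p) = Q" using Pj assms by (auto simp: Q_def fun_upd_idem_iff)
  have inner: "mid_act i \<phi> (Q(j := x)) = (if x = p then mid_act i \<phi> P else 0)" for x
  proof (cases "x = p")
    case False
    then have "(Q(j := x)) (i - 1) \<noteq> (Q(j := x)) (Suc i)"
      using assms True by (auto simp: Q_def p_def)
    then show ?thesis using False by (simp add: mid_act_def)
  qed (simp add: QQ psi)
  have pw: "p \<in> nbrs w" using w adj_sym by (simp add: in_nbrs)
  have "mid_act j (mid_act i \<phi>) (P(i := x)) = (if x = w then W p / W w * mid_act i \<phi> P else 0)"
    if "x \<in> nbrs p" for x
  proof (cases "x = w")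
    case True
    have "mid_act j (mid_act i \<phi>) Q = (\<Sum>x\<in>nbrs w. W x / W w * (if x = p then mid_act i \<phi> P else 0))"
      unfolding mid_act_def[of j "mid_act i \<phi>"] using pathQ[OF w] jcond[of w] Qj
      by (simp add: inner Q_def[symmetric])
    also have "\<dots> = W p / W w * mid_act i \<phi> P"
      using pw finite_nbrs by (simp add: if_distrib[of "\<lambda>z. _ * z"] sum.delta cong: if_cong)
    finally show ?thesis using True by (simp add: Q_def)
  next
    case False
    then show ?thesis using jcond[of x] by (simp add: mid_act_def)
  qed
  then have "mid_act i (mid_act j (mid_act i \<phi>)) P
    = (\<Sum>x\<in>nbrs p. W x / W p * (if x = w then W p / W w * mid_act i \<phi> P else 0))"
    using True unfolding mid_act_def[of i "mid_act j _"] by (simp add: p_def)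
  also have "\<dots> = W w / W p * (W p / W w * mid_act i \<phi> P)"
    using w finite_nbrs by (simp add: if_distrib[of "\<lambda>z. _ * z"] sum.delta cong: if_cong)
  also have "\<dots> = mid_act i \<phi> P" using W_pos[of w] W_pos[of p] by simp
  finally show ?thesis .
qed (auto simp: mid_act_def)

text \<open>Only rerouting to \<open>e\<close> survives, and its coefficient \<open>1 / d\<close>
  cancels the factor \<open>d\<close> of \<open>end_act\<close>.\<close>

lemma end_mid_sum:
  assumes "2 < n" "is_path n P" "P 3 = Node 1" "level e = 0"
  shows "mid_act 2 (end_act e \<phi>) P = \<phi> (P(2 := e))"
proof -
  have P1: "P (Suc 0) = Node (Suc 0)" using assms by (simp add: is_path_def)
  have e: "e \<in> nbrs (Node (Suc 0))" using assms by (auto simp: in_nbrs adj_def)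
  have "end_act e \<phi> (P(2 := w)) = (if w = e then d * \<phi> (P(2 := e)) else 0)"
    if "w \<in> nbrs (Node (Suc 0))" for w
    using that assms P1 is_path_upd[of n P 2 w] by (simp add: end_act_def in_nbrs numeral_3_eq_3 numeral_2_eq_2)
  then have "mid_act 2 (end_act e \<phi>) P
    = (\<Sum>w\<in>nbrs (Node (Suc 0)). W w / W (Node (Suc 0)) * (if w = e then d * \<phi> (P(2 := e)) else 0))"
    using assms P1 by (simp add: mid_act_def numeral_3_eq_3)
  also have "\<dots> = W e / W (Node (Suc 0)) * (d * \<phi> (P(2 := e)))"
    using e finite_nbrs by (simp add: if_distrib[of "\<lambda>z. _ * z"] sum.delta cong: if_cong)
  also have "\<dots> = \<phi> (P(2 := e))" using assms d by (simp add: W_def)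
  finally show ?thesis .
qed

lemma mid_2_cond: "2 < n \<Longrightarrow> mid_act 2 \<phi> P \<noteq> 0 \<Longrightarrow> is_path n P \<and> P 3 = Node 1"
  by (auto simp: mid_act_def is_path_def numeral_3_eq_3 split: if_splits)

lemma end_braid:
  assumes "2 < n" "level e = 0"
  shows "end_act e (mid_act 2 (end_act e \<phi>)) P = end_act e \<phi> P"
    and "mid_act 2 (end_act e (mid_act 2 \<phi>)) P = mid_act 2 \<phi> P"
proof -
  show "end_act e (mid_act 2 (end_act e \<phi>)) P = end_act e \<phi> P"
  proof (cases "is_path n P \<and> P 2 = e")
    case True
    then have "adj e (P 3)" using is_path_adj[of n P 2] assms by (simp add: numeral_3_eq_3)
    then have "P 3 = Node 1" using assms by (cases "P 3") (auto simp: adj_def)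
    moreover have "P(2 := e) = P" using True by auto
    ultimately show ?thesis using True assms end_mid_sum[of P e] by (simp add: end_act_def[of e])
  qed (auto simp: end_act_def)
  show "mid_act 2 (end_act e (mid_act 2 \<phi>)) P = mid_act 2 \<phi> P"
  proof (cases "is_path n P \<and> P 3 = Node 1")
    case True
    then have P1: "P (Suc 0) = Node (Suc 0)" by (simp add: is_path_def)
    have "e \<in> nbrs (Node (Suc 0))" using assms by (auto simp: in_nbrs adj_def)
    then have "mid_act 2 \<phi> (P(2 := e)) = mid_act 2 \<phi> P"
      using assms True P1 by (intro mid_act_upd) (auto simp: numeral_3_eq_3)
    then show ?thesis using True assms by (simp add: end_mid_sum)
  next
    case False
    then show ?thesis using mid_2_cond[OF assms(1)] by metis
  qed
qed

lemma act_braid: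
  assumes "v \<in> gens n" "w \<in> gens n" "{v, w} \<in> D_edges n"
  shows "act v (act w (act v \<phi>)) P = act v \<phi> P"
proof -
  have bar: "(v = Node_bar \<and> w = Node 2) \<or> (w = Node_bar \<and> v = Node 2) \<or>
    (\<exists>i. 1 \<le> i \<and> ((v = Node i \<and> w = Node (Suc i)) \<or> (w = Node i \<and> v = Node (Suc i))))"
    using assms(3) by (auto simp: D_edges_def doubleton_eq_iff)
  have n: "2 < n" if "v = Node 2 \<or> w = Node 2" using that assms by (auto simp: gens_def)
  have i: "act v (act w (act v \<phi>)) P = act v \<phi> P"
    if "1 \<le> i" "(v = Node i \<and> w = Node (Suc i)) \<or> (w = Node i \<and> v = Node (Suc i))" for i
  proof (cases "i = 1")
    case True
    then show ?thesis using that end_braid[of "Node 0" \<phi> P] n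
      by (auto simp: act_simps numeral_2_eq_2)
  next
    case False
    then show ?thesis
      using that assms mid_mid_braid[of i "Suc i"] mid_mid_braid[of "Suc i" i]
      by (auto simp: act_simps gens_def)
  qed
  show ?thesis using bar i n end_braid[of Node_bar \<phi> P] by (auto simp: act_simps)
qed

lemma act_pair: "act (Node 1) (act Node_bar \<phi>) P = 0"
  by (simp add: act_simps end_act_pair)

section \<open>Linearity, support and positivity of the action of words\<close>

lemma act_linear: "act v (\<lambda>P. a * \<phi> P + b * \<psi> P) P = a * act v \<phi> P + b * act v \<psi> P"
  by (auto simp: act_def end_act_def mid_act_def algebra_simps sum.distrib sum_distrib_left
      split: D_vertex.split)

lemma act_nonneg:
  assumes "\<And>P. 0 \<le> \<phi> P"
  shows "0 \<le> act v \<phi> P"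
proof -
  have "0 \<le> end_act e \<phi> P" for e using d assms by (simp add: end_act_def)
  moreover have "0 \<le> W x / W y * \<phi> Q" for x y Q
    using W_pos[of x] W_pos[of y] assms by simp
  then have "0 \<le> mid_act i \<phi> P" for i by (simp add: mid_act_def sum_nonneg del: times_divide_eq_left)
  ultimately show ?thesis by (simp add: act_def split: D_vertex.split)
qed

definition op :: "D_vertex list \<Rightarrow> ((nat \<Rightarrow> D_vertex) \<Rightarrow> real) \<Rightarrow> (nat \<Rightarrow> D_vertex) \<Rightarrow> real" where
  "op w = foldr act w"

lemma op_Nil [simp]: "op [] = id"
  and op_Cons: "op (v # w) \<phi> = act v (op w \<phi>)"
  and op_append: "op (w @ w') \<phi> = op w (op w' \<phi>)"
  by (simp_all add: op_def)

lemma op_nonneg: "(\<And>P. 0 \<le> \<phi> P) \<Longrightarrow> 0 \<le> op w \<phi> P"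
  by (induction w arbitrary: P) (auto simp: op_Cons intro: act_nonneg)

text \<open>The letter of \<open>cups (m + 2) v\<close> that is not in \<open>cups m v\<close>.\<close>

definition last_cup :: "nat \<Rightarrow> D_vertex \<Rightarrow> D_vertex" where
  "last_cup m v = (if m = 0 \<and> v = Node_bar then Node_bar else Node (Suc m))"

lemma cups_Suc_Suc: "level v \<le> m \<Longrightarrow> cups (Suc (Suc m)) v = cups m v @ [last_cup m v]"
  by (simp add: cups.simps last_cup_def)

text \<open>A letter of a cup word touches at most step \<open>m + 1\<close> and fixes the step
  after it: to \<open>v\<close> if it is the first letter for an end vertex, and otherwise to the
  value of step \<open>m\<close>.\<close>

lemma act_last_cup_support:
  assumes "shape m v" "Suc m < n" "act (last_cup m v) \<phi> P \<noteq> 0"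
  shows "is_path n P \<and> (if m = 0 then P (Suc (Suc m)) = v else P (Suc (Suc m)) = P m) \<and>
    (\<exists>x. is_path n (P(Suc m := x)) \<and> \<phi> (P(Suc m := x)) \<noteq> 0)"
proof (cases "m = 0")
  case True
  then have "v = Node_bar \<or> v = Node 0" using assms level_zero_cases by (auto simp: shape_def)
  then have "end_act v \<phi> P \<noteq> 0" using assms True by (auto simp: last_cup_def act_simps)
  then show ?thesis using True
    by (auto simp: end_act_def numeral_2_eq_2 split: if_splits intro!: exI[of _ "P (Suc m)"])
next
  case False
  then have nz: "mid_act (Suc m) \<phi> P \<noteq> 0" using assms by (auto simp: last_cup_def act_simps)
  then have P: "is_path n P" "P m = P (Suc (Suc m))" by (auto simp: mid_act_def split: if_splits)
  have "\<exists>x\<in>nbrs (P m). \<phi> (P(Suc m := x)) \<noteq> 0"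
  proof (rule ccontr)
    assume "\<not> ?thesis"
    then have "mid_act (Suc m) \<phi> P = 0" by (simp add: mid_act_def)
    with nz show False by simp
  qed
  then obtain x where x: "adj (P m) x" "\<phi> (P(Suc m := x)) \<noteq> 0" by (auto simp: in_nbrs)
  then have "is_path n (P(Suc m := x))"
    using P assms False by (intro is_path_upd) auto
  then show ?thesis using P x False by auto
qed

text \<open>All terms of the sum are non-negative, so the one that reroutes step
  \<open>m + 1\<close> to \<open>x\<close> makes it positive.\<close>

lemma act_last_cup_pos:
  assumes "shape m v" "Suc m < n" "is_path n P" "\<And>P. 0 \<le> \<phi> P"
    "P (Suc (Suc m)) = v" "m \<noteq> 0 \<Longrightarrow> P m = v"
    "is_path n (P(Suc m := x))" "0 < \<phi> (P(Suc m := x))"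
  shows "0 < act (last_cup m v) \<phi> P"
proof (cases "m = 0")
  case True
  then have "v = Node_bar \<or> v = Node 0" using assms level_zero_cases by (auto simp: shape_def)
  \<comment> \<open>For \<open>m = 0\<close> the step concerned is step \<open>1\<close>, where
    every path has the value \<open>Node 1\<close>.\<close>
  moreover have "P(Suc m := x) = P" using assms(3,7) True by (auto simp: is_path_def)
  then have "0 < end_act v \<phi> P" using assms True d by (simp add: end_act_def numeral_2_eq_2)
  ultimately show ?thesis using True by (auto simp: last_cup_def act_simps)
next
  case False
  have "adj v x" using is_path_adj[OF assms(7), of m] assms False by simp
  then have x: "x \<in> nbrs v" by (simp add: in_nbrs)
  have nn: "0 \<le> W w / W v * \<phi> (P(Suc m := w))" for w
    using W_pos[of w] W_pos[of v] assms(4) by simp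
  have "0 < W x / W v * \<phi> (P(Suc m := x))" using W_pos[of x] W_pos[of v] assms(8) by simp
  also have "\<dots> \<le> (\<Sum>w\<in>nbrs v. W w / W v * \<phi> (P(Suc m := w)))"
    using x nn by (intro member_le_sum finite_nbrs) auto
  also have "\<dots> = mid_act (Suc m) \<phi> P" using assms False by (simp add: mid_act_def)
  finally show ?thesis using False by (simp add: last_cup_def act_simps)
qed

text \<open>Each letter forces two steps at distance two to agree, so the value at step
  \<open>m\<close> is that of step \<open>level v\<close>, where a path cannot be higher than
  \<open>level v\<close>. For level \<open>0\<close> the first letter forces \<open>v\<close>
  itself. Both orders of the letters are treated because \<open>cell_word\<close> ends in a reversed
  word.\<close>

lemma cups_support:
  assumes "shape m v" "1 \<le> m" "m \<le> n" "is_path n P" "ws = cups m v \<or> ws = rev (cups m v)"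
    "op ws \<phi> P \<noteq> 0"
  shows "below (P m) v \<and> (\<exists>Q. is_path n Q \<and> \<phi> Q \<noteq> 0 \<and> (\<forall>j\<ge>m. Q j = P j))"
  using assms
proof (induction m arbitrary: P \<phi> ws rule: less_induct)
  case (less m)
  show ?case
  proof (cases "m = level v")
    case True
    then have "op ws \<phi> = \<phi>" using less.prems by auto
    moreover have "level (P m) \<le> m" "shape m (P m)"
      using is_path_shape less.prems by (auto simp: shape_def)
    \<comment> \<open>Since \<open>m\<close> is positive, equal levels mean equal vertices
      here.\<close>
    then have "below (P m) v" using True less.prems(2)
      by (cases v; cases "P m") (auto simp: below_def)
    ultimately show ?thesis using less.prems by auto
  next
    case False
    then obtain k where k: "m = Suc (Suc k)" "level v \<le> k" "shape k v"
      using less.prems by (metis shape_Suc_Suc)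
    note c = cups_Suc_Suc[OF k(2)]
    show ?thesis
    proof (cases "k = 0")
      case True
      then have "op ws \<phi> = act (last_cup k v) \<phi>" using less.prems c k by (auto simp: op_Cons)
      then obtain x where "P m = v" "is_path n (P(Suc k := x))" "\<phi> (P(Suc k := x)) \<noteq> 0"
        using act_last_cup_support[OF k(3), of \<phi> P] less.prems k True by auto
      then show ?thesis using k by (auto simp: below_def intro!: exI[of _ "P(Suc k := x)"])
    next
      case False
      have IH: "below (P' k) v \<and> (\<exists>Q. is_path n Q \<and> \<phi>' Q \<noteq> 0 \<and> (\<forall>j\<ge>k. Q j = P' j))"
        if "is_path n P'" "ws' = cups k v \<or> ws' = rev (cups k v)" "op ws' \<phi>' P' \<noteq> 0" for P' \<phi>' ws'
        using less.IH[OF _ k(3) _ _ that] less.prems k False by auto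
      from less.prems(5) show ?thesis
      proof
        assume "ws = cups m v"
        then have "op (cups k v) (act (last_cup k v) \<phi>) P \<noteq> 0"
          using less.prems c k by (simp add: op_append op_Cons)
        from IH[OF less.prems(4) _ this] obtain Q where Q: "below (P k) v" "is_path n Q"
          "act (last_cup k v) \<phi> Q \<noteq> 0" "\<forall>j\<ge>k. Q j = P j" by blast
        from act_last_cup_support[OF k(3) _ Q(3)] less.prems k False obtain x where
          "Q m = Q k" "is_path n (Q(Suc k := x))" "\<phi> (Q(Suc k := x)) \<noteq> 0" by auto
        then show ?thesis using Q k by (auto intro!: exI[of _ "Q(Suc k := x)"])
      next
        assume "ws = rev (cups m v)"
        then have "act (last_cup k v) (op (rev (cups k v)) \<phi>) P \<noteq> 0"
          using less.prems c k by (simp add: op_Cons)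
        from act_last_cup_support[OF k(3) _ this] less.prems k False obtain x where
          x: "P m = P k" "is_path n (P(Suc k := x))" "op (rev (cups k v)) \<phi> (P(Suc k := x)) \<noteq> 0"
          by auto
        from IH[OF x(2) _ x(3)] obtain Q where
          "below (P k) v" "is_path n Q" "\<phi> Q \<noteq> 0" "\<forall>j\<ge>k. Q j = (P(Suc k := x)) j" by auto
        then show ?thesis using k x(1) by auto
      qed
    qed
  qed
qed

text \<open>The letters of \<open>cups m v\<close> can move only the steps
  \<open>level v + 1\<close>, \<open>level v + 3\<close>, up to \<open>m - 1\<close>. If
  \<open>P\<close> and \<open>Q\<close> differ at most there and pass through \<open>v\<close> at
  the steps between, each letter in turn corrects one step, with a positive matrix entry.\<close>

lemma cups_pos:
  assumes "shape m v" "1 \<le> m" "m \<le> n" "is_path n P" "is_path n Q"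
    "ws = cups m v \<or> ws = rev (cups m v)"
    "\<forall>P. 0 \<le> \<phi> P" "0 < \<phi> Q"
    "\<forall>j. \<not> (level v < j \<and> j < m \<and> odd (m + j)) \<longrightarrow> P j = Q j"
    "\<forall>j. 1 \<le> j \<and> level v \<le> j \<and> j \<le> m \<and> even (m + j) \<longrightarrow> P j = v"
  shows "0 < op ws \<phi> P"
  using assms
proof (induction m arbitrary: P Q \<phi> ws rule: less_induct)
  case (less m)
  note agree = less.prems(9)[rule_format] and val = less.prems(10)[rule_format, OF conjI, OF _ conjI, OF _ _ conjI]
  show ?case
  proof (cases "m = level v")
    case True
    then have "op ws \<phi> = \<phi>" using less.prems by auto
    moreover have "P = Q" using agree True by auto
    ultimately show ?thesis using less.prems by auto
  next
    case False
    then obtain k where k: "m = Suc (Suc k)" "level v \<le> k" "shape k v"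
      using less.prems by (metis shape_Suc_Suc)
    note c = cups_Suc_Suc[OF k(2)]
    have Pm: "P m = v" "Q m = v" and Pk: "k \<noteq> 0 \<Longrightarrow> P k = v" "k \<noteq> 0 \<Longrightarrow> Q k = v"
      using agree[of m] agree[of k] val[of m] val[of k] k by auto
    show ?thesis
    proof (cases "k = 0")
      case True
      have "P j = Q j" for j
      proof (cases "j = 1")
        case True
        then show ?thesis using less.prems(4,5) by (simp add: is_path_def)
      next
        case False
        then have "\<not> (level v < j \<and> j < m \<and> odd (m + j))" using k True by auto
        then show ?thesis by (rule agree)
      qed
      then have "P = Q" by auto
      then have "0 < act (last_cup k v) \<phi> P"
        using less.prems k Pm Pk True
        by (intro act_last_cup_pos[of k v P \<phi> "P (Suc k)"]) (auto simp: fun_upd_triv)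
      then show ?thesis using less.prems c k True by (auto simp: op_Cons)
    next
      case False
      have adj: "adj v (P (Suc k))" "adj v (Q (Suc k))"
        using is_path_adj[OF less.prems(4), of k] is_path_adj[OF less.prems(5), of k] Pk False less.prems k
        by auto
      have agree': "P j = Q j" if "\<not> (level v < j \<and> j < k \<and> odd (k + j))" "j \<noteq> Suc k" for j
      proof (rule agree)
        show "\<not> (level v < j \<and> j < m \<and> odd (m + j))"
          using that k by (auto simp: less_Suc_eq)
      qed
      have val': "P j = v" if "1 \<le> j" "level v \<le> j" "j \<le> k" "even (k + j)" for j
      proof (rule val)
        show "1 \<le> j" "level v \<le> j" "j \<le> m" "even (m + j)" using that k(1) by simp_all
      qed
      have upd: "is_path n (P(Suc k := Q (Suc k)))" "is_path n (Q(Suc k := P (Suc k)))"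
        using less.prems(3-5) k(1) adj Pk[OF False] Pm False by (intro is_path_upd; simp)+
      \<comment> \<open>The half-way paths between \<open>P\<close> and \<open>Q\<close>. Step
        \<open>k + 1\<close> is corrected last for \<open>cups m v\<close>, which passes through
        \<open>Q'\<close>, and first for the reversed word, which passes through
        \<open>P'\<close>.\<close>
      define P' Q' where "P' = P(Suc k := Q (Suc k))" and "Q' = Q(Suc k := P (Suc k))"
      have path: "is_path n P'" "is_path n Q'" using upd by (simp_all add: P'_def Q'_def)
      have P': "P' i = v" if "1 \<le> i" "level v \<le> i" "i \<le> k" "even (k + i)" for i
        using val'[OF that] that by (simp add: P'_def)
      have PQ: "P' j = Q j" "P j = Q' j" if "\<not> (level v < j \<and> j < k \<and> odd (k + j))" for j
        using agree'[OF that] by (auto simp: P'_def Q'_def)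
      have k': "k < m" "1 \<le> k" "k \<le> n" "Suc k < n" using k(1) less.prems(3) False by simp_all
      from less.prems(6) show ?thesis
      proof
        assume ws: "ws = cups m v"
        have "0 < act (last_cup k v) \<phi> Q'"
          using less.prems(5,7,8) k k' path Pm Pk
          by (intro act_last_cup_pos[of k v _ \<phi> "Q (Suc k)"]) (auto simp: Q'_def)
        then have "0 < op (cups k v) (act (last_cup k v) \<phi>) P"
          using k k' less.prems(4,7) path PQ val'
          by (intro less.IH[of k P Q' "cups k v" "act (last_cup k v) \<phi>"]) (simp_all add: act_nonneg)
        then show ?thesis using ws c k by (simp add: op_append op_Cons)
      next
        assume ws: "ws = rev (cups m v)"
        have "0 < op (rev (cups k v)) \<phi> P'"
          using k k' less.prems(5,7,8) path PQ P'
          by (intro less.IH[of k P' Q "rev (cups k v)" \<phi>]) simp_all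
        then have "0 < act (last_cup k v) (op (rev (cups k v)) \<phi>) P"
          using less.prems(4,7) k k' path Pm Pk
          by (intro act_last_cup_pos[of k v _ _ "Q (Suc k)"]) (auto simp: P'_def op_nonneg)
        then show ?thesis using ws c k by (simp add: op_Cons)
      qed
    qed
  qed
qed

end

section \<open>Truncated vertices and paths interpolated from them\<close>

definition clip :: "D_vertex \<Rightarrow> nat \<Rightarrow> D_vertex" where
  "clip x j = (if level x \<le> j then x else Node j)"

lemma clip_below: "1 \<le> j \<Longrightarrow> j \<le> level x \<Longrightarrow> clip x j = Node j"
  by (cases x) (auto simp: clip_def)

lemma clip_above: "level x \<le> j \<Longrightarrow> clip x j = x"
  by (simp add: clip_def)

text \<open>By parity \<open>level x\<close> is not \<open>j + 1\<close>. So either both vertices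
  are kept, or the results are \<open>Node j\<close> and \<open>Node (j + 1)\<close>.\<close>

lemma adj_clip:
  assumes "adj x y" "even (level x + j)"
  shows "adj (clip x j) (clip y (Suc j))"
proof -
  have "level x \<noteq> Suc j" using assms(2) by auto
  then show ?thesis using assms(1) by (auto simp: clip_def adj_def)
qed

text \<open>
  The path \<open>S\<close>, with everything before its steps \<open>m\<close> and \<open>m + 1\<close> replaced by the path that rises
  as long as possible and then alternates between \<open>S m\<close> and \<open>S (m + 1)\<close>.
\<close>

definition stage :: "nat \<Rightarrow> (nat \<Rightarrow> D_vertex) \<Rightarrow> nat \<Rightarrow> D_vertex" where
  "stage m S j = (if m < j \<or> j = 0 then S j else if even (m + j) then clip (S m) j else clip (S (Suc m)) j)"

lemma is_path_stage:
  assumes "is_path n S" "1 \<le> m" "m < n"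
  shows "is_path n (stage m S)"
proof -
  have sh: "shape m (S m)" "shape (Suc m) (S (Suc m))" using is_path_shape assms by auto
  have "adj (S m) (S (Suc m))" using is_path_adj assms by auto
  then have "adj (stage m S j) (stage m S (Suc j))" if "1 \<le> j" "j < n" for j
  proof -
    consider "m < j" | "j = m" | "j < m" "even (m + j)" | "j < m" "odd (m + j)" by linarith
    then show ?thesis
    proof cases
      case 1
      then show ?thesis using is_path_adj[OF assms(1)] that by (simp add: stage_def)
    next
      case 2
      then show ?thesis using is_path_adj[OF assms(1)] that sh assms
        by (simp add: stage_def clip_def shape_def)
    next
      case 3
      then have "even (level (S m) + j)" using sh by (auto simp: shape_def)
      then show ?thesis using 3 that adj_clip[of "S m" "S (Suc m)" j] \<open>adj (S m) (S (Suc m))\<close>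
        by (simp add: stage_def)
    next
      case 4
      then have "even (level (S (Suc m)) + j)" using sh by (auto simp: shape_def)
      then show ?thesis using 4 that adj_clip[of "S (Suc m)" "S m" j] \<open>adj (S m) (S (Suc m))\<close>
        by (simp add: stage_def adj_sym)
    qed
  qed
  moreover have "clip v 1 = Node 1" if "odd (level v)" for v
    using that by (intro clip_below) (auto elim: oddE)
  then have "stage m S 1 = Node 1"
    using sh assms by (auto simp: stage_def shape_def)
  ultimately show ?thesis by (simp add: is_path_def)
qed

lemma stage_1: "is_path n S \<Longrightarrow> stage 1 S = S"
proof
  fix j assume "is_path n S"
  then show "stage 1 S j = S j"
    by (cases "j = 1") (auto simp: stage_def is_path_def clip_def)
qed

text \<open>Consecutive stages share one alternating vertex. The values are stated through either of
  the two vertices of a stage, so that neighbouring stages can be compared through the common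
  one.\<close>

lemma stage_values:
  assumes "is_path n S" "1 \<le> m" "m < n"
  shows "even (m + j) \<Longrightarrow> j \<le> m \<Longrightarrow> 1 \<le> j \<Longrightarrow> stage m S j = clip (S m) j"
    and "odd (m + j) \<Longrightarrow> j < level (S m) \<Longrightarrow> 1 \<le> j \<Longrightarrow> stage m S j = Node j"
    and "odd (m + j) \<Longrightarrow> j \<le> Suc m \<Longrightarrow> 1 \<le> j \<Longrightarrow> stage m S j = clip (S (Suc m)) j"
    and "even (m + j) \<Longrightarrow> j < level (S (Suc m)) \<Longrightarrow> 1 \<le> j \<Longrightarrow> stage m S j = Node j"
    and "m < j \<or> j = 0 \<Longrightarrow> stage m S j = S j"
proof -
  have sh: "shape m (S m)" "shape (Suc m) (S (Suc m))" and a: "adj (S m) (S (Suc m))"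
    using is_path_shape is_path_adj assms by auto
  show "even (m + j) \<Longrightarrow> j \<le> m \<Longrightarrow> 1 \<le> j \<Longrightarrow> stage m S j = clip (S m) j"
    by (simp add: stage_def)
  show "odd (m + j) \<Longrightarrow> j \<le> Suc m \<Longrightarrow> 1 \<le> j \<Longrightarrow> stage m S j = clip (S (Suc m)) j"
    using sh by (cases "j = Suc m") (auto simp: stage_def clip_above shape_def)
  show "m < j \<or> j = 0 \<Longrightarrow> stage m S j = S j"
    by (auto simp: stage_def)
  show "stage m S j = Node j" if "odd (m + j)" "j < level (S m)" "1 \<le> j"
  proof -
    have "j \<le> level (S (Suc m))" "j \<le> m" using that a sh by (auto simp: adj_def shape_def)
    then show ?thesis using that by (simp add: stage_def clip_below)
  qed
  show "stage m S j = Node j" if "even (m + j)" "j < level (S (Suc m))" "1 \<le> j"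
  proof -
    have "j \<noteq> Suc m" using that(1) by auto
    then have "j \<le> level (S m)" "j \<le> m" using that a sh by (auto simp: adj_def shape_def)
    then show ?thesis using that by (simp add: stage_def clip_below)
  qed
qed

lemma paths_is_path: "S \<in> paths n \<Longrightarrow> is_path n S"
  by (simp add: paths_def)

section \<open>Matrix entries of the cell elements\<close>

context path_rep begin

text \<open>The factors to the left of that for step \<open>m\<close> change only steps before
  \<open>m - 1\<close>. So the factor for step \<open>m\<close> still sees the original
  \<open>P m\<close>, and \<open>cups_support\<close> bounds it by \<open>S m\<close>.\<close>

lemma path_word_support:
  assumes "2 \<le> m" "m \<le> n" "is_path n S" "is_path n P" "op (path_word m S) \<phi> P \<noteq> 0"
  shows "(\<forall>j. 2 \<le> j \<longrightarrow> j < m \<longrightarrow> below (P j) (S j)) \<and>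
    (\<exists>Q. is_path n Q \<and> \<phi> Q \<noteq> 0 \<and> (\<forall>j. m \<le> Suc j \<longrightarrow> Q j = P j))"
  using assms(1,2,5)
proof (induction m arbitrary: \<phi> rule: nat_induct_at_least)
  case base
  then show ?case using assms by auto
next
  case (Suc m)
  then have "op (path_word m S) (op (cups m (S m)) \<phi>) P \<noteq> 0"
    by (simp add: path_word_Suc op_append)
  from Suc.IH[OF _ this] Suc.prems obtain Q where Q: "\<forall>j. 2 \<le> j \<longrightarrow> j < m \<longrightarrow> below (P j) (S j)"
    "is_path n Q" "op (cups m (S m)) \<phi> Q \<noteq> 0" "\<forall>j. m \<le> Suc j \<longrightarrow> Q j = P j" by auto
  have sh: "shape m (S m)" using assms(3) Suc is_path_shape by auto
  from cups_support[OF sh _ _ Q(2) _ Q(3)] Suc obtain Q' where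
    "below (Q m) (S m)" "is_path n Q'" "\<phi> Q' \<noteq> 0" "\<forall>j\<ge>m. Q' j = Q j" by auto
  then show ?case using Q by (auto simp: less_Suc_eq intro!: exI[of _ Q'])
qed

text \<open>In the reversed word the bounds fall on the final path \<open>Q\<close>: the factors to
  the right of that for step \<open>m\<close> no longer touch step \<open>m\<close>.\<close>

lemma rev_path_word_support:
  assumes "2 \<le> m" "m \<le> n" "is_path n T" "is_path n P" "op (rev (path_word m T)) \<phi> P \<noteq> 0"
  shows "\<exists>Q. is_path n Q \<and> \<phi> Q \<noteq> 0 \<and> (\<forall>j. m \<le> Suc j \<longrightarrow> Q j = P j) \<and>
    (\<forall>j. 2 \<le> j \<longrightarrow> j < m \<longrightarrow> below (Q j) (T j))"
  using assms(1,2,4,5)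
proof (induction m arbitrary: P rule: nat_induct_at_least)
  case base
  then show ?case by auto
next
  case (Suc m)
  then have nz: "op (rev (cups m (T m))) (op (rev (path_word m T)) \<phi>) P \<noteq> 0"
    by (simp add: path_word_Suc op_append)
  have sh: "shape m (T m)" using assms(3) Suc is_path_shape by auto
  from cups_support[OF sh _ _ _ _ nz] Suc obtain Q where Q: "below (P m) (T m)" "is_path n Q"
    "op (rev (path_word m T)) \<phi> Q \<noteq> 0" "\<forall>j\<ge>m. Q j = P j" by auto
  from Suc.IH[OF _ Q(2,3)] Suc obtain Q' where
    "is_path n Q'" "\<phi> Q' \<noteq> 0" "\<forall>j. m \<le> Suc j \<longrightarrow> Q' j = Q j" "\<forall>j. 2 \<le> j \<longrightarrow> j < m \<longrightarrow> below (Q' j) (T j)"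
    by auto
  then show ?case using Q by (auto simp: less_Suc_eq intro!: exI[of _ Q'])
qed

definition kernel :: "D_vertex list \<Rightarrow> (nat \<Rightarrow> D_vertex) \<Rightarrow> (nat \<Rightarrow> D_vertex) \<Rightarrow> real" where
  "kernel w P Q = op w (\<lambda>Z. if Z = Q then 1 else 0) P"

text \<open>The first word bounds \<open>P\<close>, the reversed one bounds \<open>Q\<close>, and
  the cup word in the middle bounds step \<open>n\<close>, which stays the same throughout.\<close>

lemma kernel_support:
  assumes "2 \<le> n" "S \<in> paths n" "T \<in> paths n" "S n = T n" "P \<in> paths n"
    "kernel (cell_word n S T) P Q \<noteq> 0" "1 \<le> j" "j \<le> n"
  shows "below (P j) (S j) \<and> below (Q j) (T j)"
proof -
  let ?\<phi> = "\<lambda>Z. if Z = Q then 1 else 0 :: real"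
  note path = assms(2,3,5)[THEN paths_is_path]
  have nz: "op (path_word n S) (op (cups n (S n)) (op (rev (path_word n T)) ?\<phi>)) P \<noteq> 0"
    using assms(6) by (simp add: kernel_def cell_word_def op_append)
  from path_word_support[OF assms(1) _ path(1,3) nz] obtain Z where
    Z: "\<forall>j. 2 \<le> j \<longrightarrow> j < n \<longrightarrow> below (P j) (S j)" "is_path n Z" "Z n = P n"
      "op (cups n (S n)) (op (rev (path_word n T)) ?\<phi>) Z \<noteq> 0" by auto
  have "shape n (S n)" using path(1) assms(1) is_path_shape by auto
  from cups_support[OF this _ _ Z(2) _ Z(4)] assms(1) obtain Y where
    Y: "below (Z n) (S n)" "is_path n Y" "Y n = Z n" "op (rev (path_word n T)) ?\<phi> Y \<noteq> 0" by auto
  from rev_path_word_support[OF assms(1) _ path(2) Y(2,4)] have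
    Q: "is_path n Q" "Q n = Y n" "\<forall>j. 2 \<le> j \<longrightarrow> j < n \<longrightarrow> below (Q j) (T j)"
    by (auto split: if_splits)
  have "j = 1 \<or> j = n \<or> (2 \<le> j \<and> j < n)" using assms(7,8) by auto
  then show ?thesis
    using Z(1,3) Y(1,3) Q assms(4) path by (auto simp: below_def is_path_def)
qed

text \<open>Both stages rise alike and then meet \<open>S m\<close> at every second step. They can
  differ only at the steps that the letters of \<open>cups m (S m)\<close> move, so
  \<open>cups_pos\<close> applies in both directions.\<close>

lemma cups_stage_pos:
  assumes "is_path n S" "2 \<le> m" "m < n" "\<forall>P. 0 \<le> \<phi> P"
  shows "0 < \<phi> (stage m S) \<Longrightarrow> 0 < op (cups m (S m)) \<phi> (stage (m - 1) S)"
    and "0 < \<phi> (stage (m - 1) S) \<Longrightarrow> 0 < op (rev (cups m (S m))) \<phi> (stage m S)"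
proof -
  obtain k where k: "m = Suc k" "1 \<le> k" using assms(2) by (cases m) auto
  have sh: "shape m (S m)" using assms is_path_shape by auto
  have path: "is_path n (stage m S)" "is_path n (stage k S)"
    using assms k by (auto intro: is_path_stage)
  have v1: "stage m S j = S m" if "1 \<le> j" "level (S m) \<le> j" "j \<le> m" "even (m + j)" for j
    using stage_values(1)[of n S m j] assms that by (simp add: clip_above)
  have v2: "stage k S j = S m" if "1 \<le> j" "level (S m) \<le> j" "j \<le> m" "even (m + j)" for j
    using stage_values(3)[of n S k j] assms that k by (simp add: clip_above)
  have agree: "stage k S j = stage m S j" if j: "\<not> (level (S m) < j \<and> j < m \<and> odd (m + j))" for j
  proof -
    consider "j = 0 \<or> m < j" | "1 \<le> j" "j \<le> m" "even (m + j)" | "1 \<le> j" "j < level (S m)" "odd (m + j)"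
    proof -
      have "j \<noteq> level (S m)" "j \<noteq> m" if "odd (m + j)" using that sh by (auto simp: shape_def)
      then show ?thesis using that j by (meson less_one linorder_neqE_nat not_le le_eq_less_or_eq)
    qed
    then show ?thesis
    proof cases
      case 1
      then show ?thesis using assms k by (auto simp: stage_def)
    next
      case 2
      then show ?thesis using stage_values(1)[of n S m j] stage_values(3)[of n S k j] assms k by simp
    next
      case 3
      then show ?thesis using stage_values(2)[of n S m j] stage_values(4)[of n S k j] assms k by simp
    qed
  qed
  show "0 < op (cups m (S m)) \<phi> (stage (m - 1) S)" if "0 < \<phi> (stage m S)"
    using assms k that v2 agree path by (intro cups_pos[OF sh _ _ _ path(1)]) auto
  show "0 < op (rev (cups m (S m))) \<phi> (stage m S)" if "0 < \<phi> (stage (m - 1) S)"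
    using assms k that v1 agree path by (intro cups_pos[OF sh _ _ _ path(2)]) auto
qed

text \<open>The stages form a chain starting at \<open>stage 1 S = S\<close>, with one factor of the
  word for each link.\<close>

lemma path_word_pos:
  assumes "2 \<le> m" "m \<le> n" "is_path n S" "\<forall>P. 0 \<le> \<phi> P" "0 < \<phi> (stage (m - 1) S)"
  shows "0 < op (path_word m S) \<phi> S"
  using assms(1,2,4,5)
proof (induction m arbitrary: \<phi> rule: nat_induct_at_least)
  case base
  then show ?case using stage_1[OF assms(3)] by simp
next
  case (Suc m)
  have "0 < op (cups m (S m)) \<phi> (stage (m - 1) S)"
    using Suc assms(3) by (intro cups_stage_pos(1)) auto
  then have "0 < op (path_word m S) (op (cups m (S m)) \<phi>) S"
    using Suc by (intro Suc.IH) (auto intro: op_nonneg)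
  then show ?case using Suc.hyps by (simp add: path_word_Suc op_append)
qed

lemma rev_path_word_pos:
  assumes "2 \<le> m" "m \<le> n" "is_path n T" "\<forall>P. 0 \<le> \<phi> P" "0 < \<phi> T"
  shows "0 < op (rev (path_word m T)) \<phi> (stage (m - 1) T)"
  using assms(1,2)
proof (induction m rule: nat_induct_at_least)
  case base
  then show ?case using stage_1[OF assms(3)] assms by simp
next
  case (Suc m)
  have "0 < op (rev (cups m (T m))) (op (rev (path_word m T)) \<phi>) (stage m T)"
    using Suc assms by (intro cups_stage_pos(2)) (auto intro: op_nonneg)
  then show ?case using Suc.hyps by (simp add: path_word_Suc op_append)
qed

text \<open>The chain runs from \<open>S\<close> through its stages to the last one, by the middle
  cup word to the last stage of \<open>T\<close>, and back through the stages of \<open>T\<close> to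
  \<open>T\<close>. The middle link exists because \<open>S\<close> and \<open>T\<close> end at the
  same vertex, which governs both last stages.\<close>

lemma kernel_pos:
  assumes "2 \<le> n" "S \<in> paths n" "T \<in> paths n" "S n = T n"
  shows "0 < kernel (cell_word n S T) S T"
proof -
  let ?\<phi> = "\<lambda>Z. if Z = T then 1 else 0 :: real"
  obtain k where k: "n = Suc k" "1 \<le> k" using assms(1) by (cases n) auto
  note path = assms(2,3)[THEN paths_is_path]
  have sh: "shape n (S n)" using path(1) assms(1) is_path_shape by auto
  have stages: "is_path n (stage k S)" "is_path n (stage k T)"
    using path k by (auto intro: is_path_stage)
  have 1: "0 < op (rev (path_word n T)) ?\<phi> (stage k T)"
    using rev_path_word_pos[OF assms(1) _ path(2), of ?\<phi>] k by simp
  have val: "stage k Z j = clip (Z n) j" if "Z \<in> paths n" "1 \<le> j" "j \<le> n" "even (n + j)" for Z j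
    using stage_values(3)[of n Z k j] that k paths_is_path by simp
  have low: "stage k Z j = Node j" if "Z \<in> paths n" "1 \<le> j" "j < level (Z n)" "odd (n + j)" for Z j
    using stage_values(4)[of n Z k j] that k paths_is_path by simp
  have agree: "stage k S j = stage k T j" if j: "\<not> (level (S n) < j \<and> j < n \<and> odd (n + j))" for j
  proof -
    consider "j = 0 \<or> n < j" | "1 \<le> j" "j \<le> n" "even (n + j)" | "1 \<le> j" "j < level (S n)" "odd (n + j)"
    proof -
      have "j \<noteq> level (S n)" "j \<noteq> n" if "odd (n + j)" using that sh by (auto simp: shape_def)
      then show ?thesis using that j by (meson less_one linorder_neqE_nat not_le le_eq_less_or_eq)
    qed
    then show ?thesis
    proof cases
      case 1
      then show ?thesis using assms(2,3) k by (auto simp: stage_def paths_def)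
    qed (use val low assms in auto)
  qed
  have "0 < op (cups n (S n)) (op (rev (path_word n T)) ?\<phi>) (stage k S)"
    using val[OF assms(2)] agree 1 stages assms(1)
    by (intro cups_pos[OF sh _ _ _ stages(2), where ws = "cups n (S n)" and \<phi> = "op (rev (path_word n T)) ?\<phi>"])
       (auto simp: clip_above intro: op_nonneg)
  then have "0 < op (path_word n S) (op (cups n (S n)) (op (rev (path_word n T)) ?\<phi>)) S"
  proof (intro path_word_pos)
    show "\<forall>P. 0 \<le> op (cups n (S n)) (op (rev (path_word n T)) ?\<phi>) P"
      by (intro allI op_nonneg) simp
  qed (use path k assms(1) in simp_all)
  then show ?thesis by (simp add: kernel_def cell_word_def op_append)
qed

end


section \<open>The presentation\<close>

lemma quotient_algebra_sel:
  "carrier (quotient_algebra A I) = carrier (A Quot I)"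
  "monoid.mult (quotient_algebra A I) = monoid.mult (A Quot I)"
  "one (quotient_algebra A I) = one (A Quot I)"
  "zero (quotient_algebra A I) = zero (A Quot I)"
  "add (quotient_algebra A I) = add (A Quot I)"
  by (simp_all add: quotient_algebra_def ring.defs module.defs FactRing_def)

locale algebra_quotient = assoc_algebra R A + I: ideal I A
  for R :: "('r, 'p) ring_scheme" and A :: "('r, 'a) module" (structure) and I
begin

abbreviation Q where "Q \<equiv> quotient_algebra A I"

lemma Q_assoc: "assoc_algebra R Q"
  by (rule assoc_algebra_quotient_algebra) (rule assoc_algebra_axioms I.ideal_axioms)+

lemma carrier_Q: "carrier Q = (\<lambda>x. I +> x) ` carrier A"
  by (auto simp: quotient_algebra_sel FactRing_simps)

lemma class_add: "x \<in> carrier A \<Longrightarrow> y \<in> carrier A \<Longrightarrow> I +> (x \<oplus> y) = (I +> x) \<oplus>\<^bsub>Q\<^esub> (I +> y)"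
  and class_mult: "x \<in> carrier A \<Longrightarrow> y \<in> carrier A \<Longrightarrow> I +> (x \<otimes> y) = (I +> x) \<otimes>\<^bsub>Q\<^esub> (I +> y)"
  and class_one: "I +> \<one> = \<one>\<^bsub>Q\<^esub>"
  using ring_hom_memE[OF I.rcos_ring_hom] by (auto simp: quotient_algebra_sel)

lemma class_zero_iff: "x \<in> carrier A \<Longrightarrow> I +> x = \<zero>\<^bsub>Q\<^esub> \<longleftrightarrow> x \<in> I"
  using I.a_rcos_const[of x] I.a_rcos_self[of x] by (auto simp: quotient_algebra_sel FactRing_def)

lemma class_eq_imp:
  assumes "x \<in> carrier A" "y \<in> carrier A" "I +> x = I +> y"
  shows "x \<ominus> y \<in> I"
proof -
  have "x \<in> I +> y" using I.a_rcos_self[OF assms(1)] assms(3) by simp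
  then obtain i where "i \<in> I" "x = i \<oplus> y" unfolding a_r_coset_def' by auto
  then show ?thesis using assms I.a_subset by (auto simp: minus_eq a_assoc r_neg)
qed

lemma class_smult:
  assumes c: "c \<in> carrier R" and x: "x \<in> carrier A"
  shows "I +> (c \<odot> x) = c \<odot>\<^bsub>Q\<^esub> (I +> x)"
proof -
  have "I +> (c \<odot> y) = I +> (c \<odot> x)" if y: "y \<in> I +> x" for y
  proof -
    obtain i where i: "i \<in> I" "y = i \<oplus> x" using y unfolding a_r_coset_def' by auto
    then have iA: "i \<in> carrier A" using I.a_subset by auto
    then have "c \<odot> i = (c \<odot> \<one>) \<otimes> i" using c by (simp add: smult_mult_left)
    then have "c \<odot> i \<in> I" using I.I_l_closed[OF i(1)] c by simp
    then have "c \<odot> y \<in> I +> (c \<odot> x)"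
      using c x i iA unfolding a_r_coset_def' by (auto simp: smult_r_distr)
    then show ?thesis using c x by (metis smult_closed a_repr_independence I.a_subgroup)
  qed
  moreover have "x \<in> I +> x" using x by (rule I.a_rcos_self)
  ultimately have "(\<Union>y\<in>I +> x. I +> (c \<odot> y)) = I +> (c \<odot> x)" by blast
  then show ?thesis by (simp add: quotient_algebra_def ring.defs module.defs)
qed

lemma ideal_image: 
  assumes "ideal J A"
  shows "ideal ((\<lambda>x. I +> x) ` J) Q"
proof -
  interpret Q: assoc_algebra R Q by (rule Q_assoc)
  have "ideal ((\<lambda>x. I +> x) ` J) (A Quot I)"
    using ring_ideal_imp_quot_ideal[OF I.ideal_axioms assms] by simp
  then interpret J: ideal "(\<lambda>x. I +> x) ` J" "A Quot I" .
  show ?thesis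
  proof (rule idealI[OF Q.ring_axioms])
    show "subgroup ((\<lambda>x. I +> x) ` J) (add_monoid Q)"
      using J.a_subgroup
      unfolding subgroup_def m_inv_def by (simp add: quotient_algebra_sel)
  qed (use J.I_l_closed J.I_r_closed in \<open>auto simp: quotient_algebra_sel\<close>)
qed

end

section \<open>The free algebra and reversal of words\<close>

lemma free_algebra_sel:
  "carrier (free_algebra V) = {f. \<forall>w\<in>Poly_Mapping.keys f. set (letters w) \<subseteq> V}"
  "monoid.mult (free_algebra V) = (*)" "one (free_algebra V) = 1"
  "zero (free_algebra V) = 0" "add (free_algebra V) = (+)"
  by (simp_all add: free_algebra_def)

lemma free_algebra_smult: "c \<odot>\<^bsub>free_algebra V\<^esub> f = Poly_Mapping.single 0 c * f"
  by (simp add: free_algebra_def mult_map_scale_conv_mult)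

lemma free_algebra_single: "set (letters w) \<subseteq> V \<Longrightarrow> Poly_Mapping.single w c \<in> carrier (free_algebra V)"
  by (auto simp: free_algebra_sel)

lemma free_algebra_induct [consumes 1, case_names zero add]:
  assumes "f \<in> carrier (free_algebra V)" "P 0"
    "\<And>f w c. f \<in> carrier (free_algebra V) \<Longrightarrow> set (letters w) \<subseteq> V \<Longrightarrow> P f \<Longrightarrow> P (f + Poly_Mapping.single w c)"
  shows "P f"
  using assms(1)
proof (induction f rule: update_induct)
  case (update f a b)
  have eq: "Poly_Mapping.update a b f = f + Poly_Mapping.single a b"
    using update by (intro poly_mapping_eqI) (auto simp: lookup_update lookup_add lookup_single in_keys_iff when_def)
  have k: "Poly_Mapping.keys (Poly_Mapping.update a b f) = insert a (Poly_Mapping.keys f)"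
    using update by (auto simp: keys_update)
  have "f \<in> carrier (free_algebra V)" "set (letters a) \<subseteq> V"
    using update.prems by (auto simp: free_algebra_sel k)
  then show ?case using update assms(3) by (simp add: eq)
qed (rule assms(2))

lemma poly_mapping_induct_add [case_names zero add]:
  fixes f :: "'v free_word \<Rightarrow>\<^sub>0 'r::comm_ring_1"
  assumes "P 0" "\<And>f w c. P f \<Longrightarrow> P (f + Poly_Mapping.single w c)"
  shows "P f"
  by (rule free_algebra_induct[of f UNIV]) (auto simp: free_algebra_sel assms)

lemma free_algebra_uminus:
  assumes "f \<in> carrier (free_algebra V)"
  shows "\<ominus>\<^bsub>free_algebra V\<^esub> f = - (f :: 'v free_word \<Rightarrow>\<^sub>0 'r::comm_ring_1)"
proof -
  interpret F: assoc_algebra "ring_of_type_algebra :: 'r ring" "free_algebra V" by (rule assoc_algebra_free_algebra)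
  show ?thesis
    by (rule F.minus_equality) (use assms in \<open>simp_all add: free_algebra_sel\<close>)
qed

lemma free_algebra_minus:
  assumes "f \<in> carrier (free_algebra V)" "g \<in> carrier (free_algebra V)"
  shows "f \<ominus>\<^bsub>free_algebra V\<^esub> g = f - (g :: 'v free_word \<Rightarrow>\<^sub>0 'r::comm_ring_1)"
proof -
  interpret F: assoc_algebra "ring_of_type_algebra :: 'r ring" "free_algebra V" by (rule assoc_algebra_free_algebra)
  show ?thesis using assms by (simp add: F.minus_eq free_algebra_uminus) (simp add: free_algebra_sel)
qed

lemma free_algebra_idealI:
  fixes Z :: "('v free_word \<Rightarrow>\<^sub>0 'r::comm_ring_1) set"
  assumes "Z \<subseteq> carrier (free_algebra V)" "0 \<in> Z"
    "\<And>f g. f \<in> Z \<Longrightarrow> g \<in> Z \<Longrightarrow> f + g \<in> Z" "\<And>f. f \<in> Z \<Longrightarrow> - f \<in> Z"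
    "\<And>f g. f \<in> Z \<Longrightarrow> g \<in> carrier (free_algebra V) \<Longrightarrow> g * f \<in> Z"
    "\<And>f g. f \<in> Z \<Longrightarrow> g \<in> carrier (free_algebra V) \<Longrightarrow> f * g \<in> Z"
  shows "ideal Z (free_algebra V)"
proof -
  interpret F: assoc_algebra "ring_of_type_algebra :: 'r ring" "free_algebra V :: ('r, _) module"
    by (rule assoc_algebra_free_algebra)
  have "inv\<^bsub>add_monoid (free_algebra V)\<^esub> f \<in> Z" if "f \<in> Z" for f
    using free_algebra_uminus[of f V] assms(1,4) that by (auto simp: a_inv_def)
  then show ?thesis using assms(1-3,5,6)
    by (intro idealI[OF F.ring_axioms] subgroup.intro) (auto simp: free_algebra_sel)
qed

definition rev_word :: "'v free_word \<Rightarrow> 'v free_word" where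
  "rev_word w = Word (rev (letters w))"

text \<open>\<open>map_key\<close> precomposes with \<open>rev_word\<close>. As
  \<open>rev_word\<close> is its own inverse, this sends every word to its reverse.\<close>

definition free_star :: "('v free_word \<Rightarrow>\<^sub>0 'r::comm_ring_1) \<Rightarrow> 'v free_word \<Rightarrow>\<^sub>0 'r" where
  "free_star = Poly_Mapping.map_key rev_word"

lemma rev_word_rev_word [simp]: "rev_word (rev_word w) = w"
  by (simp add: rev_word_def)

lemma inj_rev_word: "inj rev_word"
  by (metis injI rev_word_rev_word)

lemma free_star_single: "free_star (Poly_Mapping.single w c) = Poly_Mapping.single (rev_word w) c"
  using map_key_single[OF inj_rev_word, of "rev_word w" c] by (simp add: free_star_def)

lemma free_star_add: "free_star (f + g) = free_star f + free_star g"
  by (simp add: free_star_def map_key_plus[OF inj_rev_word])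

lemma free_star_zero: "free_star 0 = 0"
  by (simp add: free_star_def inj_rev_word)

lemma free_star_uminus: "free_star (- f) = - free_star f"
  using free_star_add[of f "- f"] by (simp add: free_star_zero eq_neg_iff_add_eq_0 add.commute)

lemma free_star_diff: "free_star (f - g) = free_star f - free_star g"
  using free_star_add[of f "- g"] by (simp add: free_star_uminus)

lemma free_star_mult: "free_star (f * g) = free_star g * free_star f"
proof (induction f rule: poly_mapping_induct_add)
  case (add f w c)
  have "free_star (Poly_Mapping.single w c * g) = free_star g * free_star (Poly_Mapping.single w c)"
  proof (induction g rule: poly_mapping_induct_add)
    case (add g w' c')
    then show ?case
      by (simp add: distrib_left distrib_right free_star_add free_star_single mult_single mult.commute
        rev_word_def plus_free_word_def)
  qed (simp add: free_star_zero)
  then show ?case using add by (simp add: distrib_left distrib_right free_star_add)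
qed (simp add: free_star_zero)

lemma free_star_free_star: "free_star (free_star f) = f"
  by (induction f rule: poly_mapping_induct_add) (simp_all add: free_star_zero free_star_add free_star_single)

lemma free_star_closed: "f \<in> carrier (free_algebra V) \<Longrightarrow> free_star f \<in> carrier (free_algebra V)"
  by (auto simp: free_algebra_sel free_star_def keys_map_key[OF inj_rev_word] rev_word_def)
     (metis (no_types, lifting) free_word.sel set_rev subsetD)

lemma free_star_gen: "free_star (free_gen v) = free_gen v"
  by (simp add: free_gen_def free_star_single rev_word_def)

lemma free_star_scale: "free_star (Poly_Mapping.single 0 c * f) = Poly_Mapping.single 0 c * free_star f"
proof -
  have "rev_word (0 :: 'a free_word) = 0" by (simp add: rev_word_def zero_free_word_def)
  then show ?thesis by (simp add: free_star_mult free_star_single single_zero_mult_commute[of "free_star f"])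
qed

section \<open>The algebra as a two-step quotient of the free algebra\<close>

locale pair_free_presentation =
  fixes n :: nat
  assumes n: "2 \<le> n"
begin

abbreviation F :: "(int poly, D_vertex free_word \<Rightarrow>\<^sub>0 int poly) module" where
  "F \<equiv> free_algebra (D_vertices n)"

abbreviation I1 where "I1 \<equiv> TL_ideal (D_vertices n) (D_edges n)"

abbreviation pair where "pair \<equiv> TL_D_gen n (Node 1) \<otimes>\<^bsub>TL_D n\<^esub> TL_D_gen n Node_bar"

abbreviation I2 where "I2 \<equiv> Idl\<^bsub>TL_D n\<^esub> {pair}"

definition cls :: "(D_vertex free_word \<Rightarrow>\<^sub>0 int poly) \<Rightarrow> (D_vertex free_word \<Rightarrow>\<^sub>0 int poly) set set" where
  "cls f = I2 +>\<^bsub>TL_D n\<^esub> (I1 +>\<^bsub>F\<^esub> f)"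

sublocale F: assoc_algebra Z_delta F by (rule assoc_algebra_free_algebra)
sublocale T: assoc_algebra Z_delta "TL_D n" by (rule assoc_algebra_TL)
sublocale P: assoc_algebra Z_delta "pair_free_TL_D n" using n by (rule assoc_algebra_pair_free_TL_D)
sublocale q1: algebra_quotient Z_delta F I1
  by (intro algebra_quotient.intro F.assoc_algebra_axioms ideal_TL_ideal)
sublocale q2: algebra_quotient Z_delta "TL_D n" I2
  using n by (intro algebra_quotient.intro T.assoc_algebra_axioms ideal_pair_free)

lemma TL_D_eq: "TL_D n = quotient_algebra F I1"
  by (simp add: TL_def)

lemma cls1_closed: "f \<in> carrier F \<Longrightarrow> I1 +>\<^bsub>F\<^esub> f \<in> carrier (TL_D n)"
  unfolding TL_D_eq q1.carrier_Q by auto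

lemma carrier_pair_free: "carrier (pair_free_TL_D n) = cls ` carrier F"
  unfolding pair_free_TL_D_def q2.carrier_Q cls_def
  unfolding TL_D_eq q1.carrier_Q image_image ..

lemma cls_add: "f \<in> carrier F \<Longrightarrow> g \<in> carrier F \<Longrightarrow> cls (f + g) = cls f \<oplus>\<^bsub>pair_free_TL_D n\<^esub> cls g"
  using q1.class_add[of f g] q2.class_add[OF cls1_closed cls1_closed, of f g]
  unfolding cls_def pair_free_TL_D_def TL_D_eq by (simp add: free_algebra_sel)

lemma cls_mult: "f \<in> carrier F \<Longrightarrow> g \<in> carrier F \<Longrightarrow> cls (f * g) = cls f \<otimes>\<^bsub>pair_free_TL_D n\<^esub> cls g"
  using q1.class_mult[of f g] q2.class_mult[OF cls1_closed cls1_closed, of f g]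
  unfolding cls_def pair_free_TL_D_def TL_D_eq by (simp add: free_algebra_sel)

lemma cls_smult:
  "f \<in> carrier F \<Longrightarrow> cls (Poly_Mapping.single 0 c * f) = c \<odot>\<^bsub>pair_free_TL_D n\<^esub> cls f"
  using q1.class_smult[of c f] q2.class_smult[OF _ cls1_closed, of c f]
  unfolding cls_def pair_free_TL_D_def TL_D_eq by (simp add: free_algebra_smult ring_of_type_algebra_def)

lemma cls_one: "cls 1 = \<one>\<^bsub>pair_free_TL_D n\<^esub>"
  using q1.class_one q2.class_one
  unfolding cls_def pair_free_TL_D_def TL_D_eq by (simp add: free_algebra_sel)

lemma cls_zero: "cls 0 = \<zero>\<^bsub>pair_free_TL_D n\<^esub>"
proof -
  have "(0 :: D_vertex free_word \<Rightarrow>\<^sub>0 int poly) \<in> carrier F" by (simp add: free_algebra_sel)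
  then have "cls 0 \<in> carrier (pair_free_TL_D n)" "cls 0 = 0 \<odot>\<^bsub>pair_free_TL_D n\<^esub> cls 0"
    using cls_smult[of 0 0] by (auto simp: carrier_pair_free)
  then show ?thesis using P.smult_l_null[of "cls 0"] by (simp add: ring_of_type_algebra_def)
qed

lemma F_minus_closed: "f \<in> carrier F \<Longrightarrow> g \<in> carrier F \<Longrightarrow> f - g \<in> carrier F"
  using F.minus_closed[of f g] free_algebra_minus[of f _ g] by simp

lemma F_add_closed: "f \<in> carrier F \<Longrightarrow> g \<in> carrier F \<Longrightarrow> f + g \<in> carrier F"
  and F_mult_closed: "f \<in> carrier F \<Longrightarrow> g \<in> carrier F \<Longrightarrow> f * g \<in> carrier F"
  and F_uminus_closed: "f \<in> carrier F \<Longrightarrow> - f \<in> carrier F"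
  and F_zero_closed: "0 \<in> carrier F"
  using F.a_closed[of f g] F.m_closed[of f g] F.a_inv_closed[of f] F.zero_closed free_algebra_uminus[of f]
  by (simp_all only: free_algebra_sel(2-5))

lemma cls_closed: "f \<in> carrier F \<Longrightarrow> cls f \<in> carrier (pair_free_TL_D n)"
  by (simp add: carrier_pair_free)

lemma cls_eq_iff:
  assumes "f \<in> carrier F" "g \<in> carrier F"
  shows "cls f = cls g \<longleftrightarrow> cls (f - g) = \<zero>\<^bsub>pair_free_TL_D n\<^esub>"
proof -
  have fg: "f - g \<in> carrier F" using assms by (rule F_minus_closed)
  have "cls f = cls (f - g) \<oplus>\<^bsub>pair_free_TL_D n\<^esub> cls g"
    using cls_add[OF fg assms(2)] by simp
  then show ?thesis
    using cls_closed[OF fg] cls_closed[OF assms(2)] P.add.r_cancel_one' P.l_zero by metis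
qed

lemma gen_closed: "v \<in> D_vertices n \<Longrightarrow> free_gen v \<in> carrier F"
  by (rule free_gen_in_free_algebra)

lemma node_closed: "Node_bar \<in> D_vertices n" "Node 1 \<in> D_vertices n"
  using n by (auto simp: D_vertices_def)

lemma pair_eq: "pair = I1 +>\<^bsub>F\<^esub> (free_gen (Node 1) * free_gen Node_bar)"
  using q1.class_mult[OF gen_closed[OF node_closed(2)] gen_closed[OF node_closed(1)]]
  by (simp add: TL_gen_def TL_D_eq free_algebra_sel)

lemma cls_relation:
  assumes "f \<in> TL_relations (D_vertices n) (D_edges n)"
  shows "cls f = \<zero>\<^bsub>pair_free_TL_D n\<^esub>"
proof -
  have f: "f \<in> carrier F" using TL_relations_in_free_algebra assms by blast
  have "f \<in> I1" unfolding TL_ideal_def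
    using F.genideal_self[OF TL_relations_in_free_algebra] assms by blast
  then have "I1 +>\<^bsub>F\<^esub> f = \<zero>\<^bsub>TL_D n\<^esub>" using q1.class_zero_iff[OF f] by (simp add: TL_D_eq)
  then show ?thesis
    using q2.class_zero_iff[OF T.zero_closed] q2.I.zero_closed
    by (simp add: cls_def pair_free_TL_D_def)
qed

lemma cls_pair: "cls (free_gen (Node 1)) \<otimes>\<^bsub>pair_free_TL_D n\<^esub> cls (free_gen Node_bar) = \<zero>\<^bsub>pair_free_TL_D n\<^esub>"
proof -
  let ?f = "free_gen (Node 1) * free_gen Node_bar :: D_vertex free_word \<Rightarrow>\<^sub>0 int poly"
  have f: "?f \<in> carrier F"
    using F.m_closed[OF gen_closed[OF node_closed(2)] gen_closed[OF node_closed(1)]]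
    by (simp add: free_algebra_sel)
  have "pair \<in> I2"
    using T.genideal_self[of "{pair}"] cls1_closed[OF f] pair_eq by auto
  then have "cls ?f = \<zero>\<^bsub>pair_free_TL_D n\<^esub>"
    using q2.class_zero_iff[OF cls1_closed[OF f]]
    unfolding cls_def pair_free_TL_D_def pair_eq[symmetric] by blast
  then show ?thesis using cls_mult gen_closed node_closed by simp
qed

text \<open>\<open>I2\<close> lies in the image of \<open>Z\<close> modulo \<open>I1\<close>, and
  \<open>I1 \<subseteq> Z\<close> lifts membership back to the free algebra. This is the universal
  property of the two-step quotient, by which reversal and the path action descend.\<close>

lemma cls_kernel:
  assumes Z: "ideal Z F" "TL_relations (D_vertices n) (D_edges n) \<subseteq> Z"
      "free_gen (Node 1) * free_gen Node_bar \<in> Z"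
    and f: "f \<in> carrier F" "cls f = \<zero>\<^bsub>pair_free_TL_D n\<^esub>"
  shows "f \<in> Z"
proof -
  interpret Z: ideal Z F by (rule Z(1))
  have I1: "I1 \<subseteq> Z" unfolding TL_ideal_def by (rule F.genideal_minimal[OF Z(1,2)])
  have "ideal ((\<lambda>x. I1 +>\<^bsub>F\<^esub> x) ` Z) (TL_D n)"
    using q1.ideal_image[OF Z(1)] by (simp add: TL_D_eq)
  moreover have "{pair} \<subseteq> (\<lambda>x. I1 +>\<^bsub>F\<^esub> x) ` Z" using Z(3) unfolding pair_eq by blast
  ultimately have I2: "I2 \<subseteq> (\<lambda>x. I1 +>\<^bsub>F\<^esub> x) ` Z" by (rule T.genideal_minimal)
  have "I1 +>\<^bsub>F\<^esub> f \<in> I2"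
    using q2.class_zero_iff[OF cls1_closed[OF f(1)]] f(2) by (simp add: cls_def pair_free_TL_D_def)
  with I2 obtain z where z: "z \<in> Z" "I1 +>\<^bsub>F\<^esub> f = I1 +>\<^bsub>F\<^esub> z" by blast
  have zF: "z \<in> carrier F" using z(1) Z.a_subset by blast
  have "f - z \<in> Z" using q1.class_eq_imp[OF f(1) zF z(2)] I1 free_algebra_minus[OF f(1) zF] by auto
  from Z.a_closed[OF this z(1)] show ?thesis by (simp add: free_algebra_sel(5))
qed

text \<open>Reversal of a chosen representative; \<open>star_cls\<close> shows that the choice does
  not matter.\<close>

definition star :: "(D_vertex free_word \<Rightarrow>\<^sub>0 int poly) set set \<Rightarrow> (D_vertex free_word \<Rightarrow>\<^sub>0 int poly) set set" where
  "star x = cls (free_star (SOME f. f \<in> carrier F \<and> cls f = x))"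

lemma cls_uminus_zero:
  assumes "f \<in> carrier F" "cls f = \<zero>\<^bsub>pair_free_TL_D n\<^esub>"
  shows "cls (- f) = \<zero>\<^bsub>pair_free_TL_D n\<^esub>"
  using cls_eq_iff[OF F.zero_closed assms(1)] assms(2) cls_zero by (simp add: free_algebra_sel)

text \<open>Reversal sends every Temperley-Lieb relation to itself or its negative. It sends the
  pair to the product in the other order, which has the same class because the two generators
  commute.\<close>

lemma cls_free_star_zero:
  assumes "f \<in> carrier F" "cls f = \<zero>\<^bsub>pair_free_TL_D n\<^esub>"
  shows "cls (free_star f) = \<zero>\<^bsub>pair_free_TL_D n\<^esub>"
proof -
  let ?O = "\<zero>\<^bsub>pair_free_TL_D n\<^esub>"
  define Z where "Z = {f \<in> carrier F. cls (free_star f) = ?O}"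
  have id: "ideal Z F"
  proof (rule free_algebra_idealI)
    show "0 \<in> Z" by (simp add: Z_def free_star_zero cls_zero F_zero_closed)
    show "f + g \<in> Z" if "f \<in> Z" "g \<in> Z" for f g
      using that by (simp add: Z_def free_star_add cls_add free_star_closed F_add_closed)
    show "- f \<in> Z" if "f \<in> Z" for f
      using that by (simp add: Z_def free_star_uminus cls_uminus_zero free_star_closed F_uminus_closed)
    show "g * f \<in> Z" if "f \<in> Z" "g \<in> carrier F" for f g
      using that by (simp add: Z_def free_star_mult cls_mult cls_closed free_star_closed F_mult_closed)
    show "f * g \<in> Z" if "f \<in> Z" "g \<in> carrier F" for f g
      using that by (simp add: Z_def free_star_mult cls_mult cls_closed free_star_closed F_mult_closed)
  qed (auto simp: Z_def)
  have rel: "free_star f \<in> TL_relations (D_vertices n) (D_edges n) \<or> - free_star f \<in> TL_relations (D_vertices n) (D_edges n)"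
    if "f \<in> TL_relations (D_vertices n) (D_edges n)" for f
  proof -
    from that consider
        i where "i \<in> D_vertices n" "f = free_gen i * free_gen i - Poly_Mapping.single 0 delta * free_gen i"
      | i j where "i \<in> D_vertices n" "j \<in> D_vertices n" "i \<noteq> j" "{i, j} \<notin> D_edges n"
          "f = free_gen i * free_gen j - free_gen j * free_gen i"
      | i j where "i \<in> D_vertices n" "j \<in> D_vertices n" "{i, j} \<in> D_edges n"
          "f = free_gen i * free_gen j * free_gen i - free_gen i"
      unfolding TL_relations_def mult_map_scale_conv_mult by blast
    then show ?thesis
    proof cases
      case 1
      then have "free_star f = f"
        by (simp add: free_star_diff free_star_mult[of "free_gen i"] free_star_gen free_star_scale)
      then show ?thesis using that by simp
    next
      case 2
      then have "- free_star f = f"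
        by (simp add: free_star_diff free_star_mult free_star_gen)
      then show ?thesis using that by simp
    next
      case 3
      then have "free_star f = f"
        by (simp add: free_star_diff free_star_mult free_star_gen mult.assoc)
      then show ?thesis using that by simp
    qed
  qed
  have "TL_relations (D_vertices n) (D_edges n) \<subseteq> Z"
  proof
    fix f :: "D_vertex free_word \<Rightarrow>\<^sub>0 int poly"
    assume f: "f \<in> TL_relations (D_vertices n) (D_edges n)"
    then have fF: "f \<in> carrier F" using TL_relations_in_free_algebra by blast
    from rel[OF f] have "cls (free_star f) = ?O"
    proof
      assume "- free_star f \<in> TL_relations (D_vertices n) (D_edges n)"
      then have "cls (- free_star f) = ?O" "- free_star f \<in> carrier F"
        using TL_relations_in_free_algebra cls_relation by blast+
      from cls_uminus_zero[OF this(2,1)] show ?thesis by simp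
    qed (rule cls_relation)
    then show "f \<in> Z" using fF by (simp add: Z_def)
  qed
  moreover have "free_gen (Node 1) * free_gen Node_bar \<in> Z"
  proof -
    let ?a = "free_gen (Node 1) :: D_vertex free_word \<Rightarrow>\<^sub>0 int poly" and ?b = "free_gen Node_bar"
    have ne: "{Node 1, Node_bar} \<notin> D_edges n" by (auto simp: D_edges_def doubleton_eq_iff)
    have F: "?a \<in> carrier F" "?b \<in> carrier F" "?a * ?b \<in> carrier F" "?b * ?a \<in> carrier F"
      using gen_closed node_closed F.m_closed[of ?a ?b] F.m_closed[of ?b ?a]
      by (simp_all add: free_algebra_sel)
    have "?a * ?b - ?b * ?a \<in> TL_relations (D_vertices n) (D_edges n)"
      unfolding TL_relations_def using node_closed ne by blast
    then have "cls (?b * ?a) = cls (?a * ?b)"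
      using cls_eq_iff[OF F(3,4)] cls_relation by metis
    also have "\<dots> = ?O" using cls_pair F cls_mult by metis
    finally show ?thesis using F by (simp add: Z_def free_star_mult free_star_gen)
  qed
  ultimately have "f \<in> Z" using cls_kernel[OF id] assms by blast
  then show ?thesis by (simp add: Z_def)
qed

lemma star_cls:
  assumes "f \<in> carrier F"
  shows "star (cls f) = cls (free_star f)"
proof -
  let ?g = "SOME g. g \<in> carrier F \<and> cls g = cls f"
  have g: "?g \<in> carrier F \<and> cls ?g = cls f" by (rule someI[of _ f]) (use assms in simp)
  then have "cls (?g - f) = \<zero>\<^bsub>pair_free_TL_D n\<^esub>" using cls_eq_iff assms by blast
  then have "cls (free_star ?g - free_star f) = \<zero>\<^bsub>pair_free_TL_D n\<^esub>"
    using cls_free_star_zero F_minus_closed g assms by (simp flip: free_star_diff)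
  then show ?thesis
    using cls_eq_iff[of "free_star ?g" "free_star f"] free_star_closed g assms by (auto simp: star_def)
qed

text \<open>The unit as default value keeps \<open>b\<close> in the carrier and fixed by
  \<open>star\<close> at every vertex, as the abstract locales demand.\<close>

definition b :: "D_vertex \<Rightarrow> (D_vertex free_word \<Rightarrow>\<^sub>0 int poly) set set" where
  "b v = (if v \<in> D_vertices n then cls (free_gen v) else \<one>\<^bsub>pair_free_TL_D n\<^esub>)"

lemma b_relations:
  assumes v: "v \<in> D_vertices n" "w \<in> D_vertices n"
  shows "b v \<otimes>\<^bsub>pair_free_TL_D n\<^esub> b v = delta \<odot>\<^bsub>pair_free_TL_D n\<^esub> b v"
    and "{v, w} \<notin> D_edges n \<Longrightarrow> b v \<otimes>\<^bsub>pair_free_TL_D n\<^esub> b w = b w \<otimes>\<^bsub>pair_free_TL_D n\<^esub> b v"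
    and "{v, w} \<in> D_edges n \<Longrightarrow>
      b v \<otimes>\<^bsub>pair_free_TL_D n\<^esub> b w \<otimes>\<^bsub>pair_free_TL_D n\<^esub> b v = b v"
proof -
  let ?v = "free_gen v :: D_vertex free_word \<Rightarrow>\<^sub>0 int poly" and ?w = "free_gen w"
  have F: "?v \<in> carrier F" "?w \<in> carrier F" using v gen_closed by auto
  have m: "f * g \<in> carrier F" if "f \<in> carrier F" "g \<in> carrier F" for f g
    using F.m_closed[OF that] by (simp add: free_algebra_sel)
  have s: "Poly_Mapping.single 0 delta * ?v \<in> carrier F"
    by (intro m F free_algebra_single) (simp add: zero_free_word_def)
  have eq: "cls f = cls g" if "f \<in> carrier F" "g \<in> carrier F"
    "f - g \<in> TL_relations (D_vertices n) (D_edges n)" for f g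
    using cls_eq_iff[OF that(1,2)] cls_relation[OF that(3)] by simp
  have "cls (?v * ?v) = cls (Poly_Mapping.single 0 delta * ?v)"
    using v F by (intro eq m s) (auto simp: TL_relations_def mult_map_scale_conv_mult)
  then show "b v \<otimes>\<^bsub>pair_free_TL_D n\<^esub> b v = delta \<odot>\<^bsub>pair_free_TL_D n\<^esub> b v"
    using v F by (simp add: b_def cls_mult cls_smult)
  show "b v \<otimes>\<^bsub>pair_free_TL_D n\<^esub> b w = b w \<otimes>\<^bsub>pair_free_TL_D n\<^esub> b v" if "{v, w} \<notin> D_edges n"
  proof (cases "v = w")
    case False
    then have "cls (?v * ?w) = cls (?w * ?v)"
      using v F that by (intro eq m) (auto simp: TL_relations_def)
    then show ?thesis using v F by (simp add: b_def cls_mult)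
  qed simp
  show "b v \<otimes>\<^bsub>pair_free_TL_D n\<^esub> b w \<otimes>\<^bsub>pair_free_TL_D n\<^esub> b v = b v" if "{v, w} \<in> D_edges n"
  proof -
    have "cls (?v * ?w * ?v) = cls ?v"
      using v F that by (intro eq m) (auto simp: TL_relations_def)
    then show ?thesis using v F by (simp add: b_def cls_mult m)
  qed
qed

end


section \<open>Cellularity\<close>

lemma generated_submodule_mem:
  "x \<in> generated_submodule R A B \<longleftrightarrow> (\<forall>N. submodule N R A \<longrightarrow> B \<subseteq> N \<longrightarrow> x \<in> N)"
  by (auto simp: generated_submodule_def hull_def)

context Module.module begin

lemma generated_submodule_closed:
  assumes "B \<subseteq> carrier M"
  shows "generated_submodule R M B \<subseteq> carrier M"
  using carrier_is_submodule assms unfolding generated_submodule_mem subset_iff by blast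

lemma generated_submodule_inc: "x \<in> B \<Longrightarrow> x \<in> generated_submodule R M B"
  by (auto simp: generated_submodule_mem)

lemma generated_submodule_add:
  "x \<in> generated_submodule R M B \<Longrightarrow> y \<in> generated_submodule R M B \<Longrightarrow>
    x \<oplus>\<^bsub>M\<^esub> y \<in> generated_submodule R M B"
  using submoduleE(5) unfolding generated_submodule_mem by blast

lemma generated_submodule_smult:
  "x \<in> generated_submodule R M B \<Longrightarrow> c \<in> carrier R \<Longrightarrow>
    c \<odot>\<^bsub>M\<^esub> x \<in> generated_submodule R M B"
  using submoduleE(4) unfolding generated_submodule_mem by blast

lemma generated_submodule_zero: "\<zero>\<^bsub>M\<^esub> \<in> generated_submodule R M B"
  unfolding generated_submodule_mem
proof (intro allI impI)
  fix N assume N: "submodule N R M"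
  then obtain x where x: "x \<in> N" using submoduleE(2) by blast
  then have "\<zero>\<^bsub>R\<^esub> \<odot>\<^bsub>M\<^esub> x \<in> N" using submoduleE(4)[OF N] by simp
  then show "\<zero>\<^bsub>M\<^esub> \<in> N" using x submoduleE(1)[OF N] by auto
qed

end

text \<open>\<open>ev z\<close> stands for the matrix entries of the path representation at
  \<open>\<delta> = z\<close>; its linearity and its values on words are all that is assumed.
  \<open>carrier_induct\<close> expresses that words span, without writing finite sums.\<close>

locale pair_free_cellular = pair_free_star Z_delta A n delta b star
  for A :: "(int poly, 'a, 'q) module_scheme" (structure) and n b star +
  fixes ev :: "int \<Rightarrow> 'a \<Rightarrow> (nat \<Rightarrow> D_vertex) \<Rightarrow> (nat \<Rightarrow> D_vertex) \<Rightarrow> real"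
  assumes star_add: "\<lbrakk>x \<in> carrier A; y \<in> carrier A\<rbrakk> \<Longrightarrow> star (x \<oplus> y) = star x \<oplus> star y"
    and carrier_induct: "\<lbrakk>x \<in> carrier A; p \<zero>;
      \<And>y c w. \<lbrakk>y \<in> carrier A; p y; set w \<subseteq> gens n\<rbrakk> \<Longrightarrow> p (y \<oplus> c \<odot> val w)\<rbrakk> \<Longrightarrow> p x"
    and ev_add: "\<lbrakk>x \<in> carrier A; y \<in> carrier A\<rbrakk> \<Longrightarrow> 2 \<le> z \<Longrightarrow> ev z (x \<oplus> y) P Q = ev z x P Q + ev z y P Q"
    and ev_smult: "x \<in> carrier A \<Longrightarrow> 2 \<le> z \<Longrightarrow> ev z (c \<odot> x) P Q = real_of_int (poly c z) * ev z x P Q"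
    and ev_val: "set w \<subseteq> gens n \<Longrightarrow> 2 \<le> z \<Longrightarrow> ev z (val w) P Q = path_rep.kernel (real_of_int z) n w P Q"
begin

lemma carrier_R [simp]: "c \<in> carrier Z_delta"
  by (simp add: ring_of_type_algebra_def)

lemma R_zero [simp]: "\<zero>\<^bsub>Z_delta\<^esub> = (0 :: int poly)"
  by (simp add: ring_of_type_algebra_def)

section \<open>The cell datum and its basis\<close>

definition cells :: "D_vertex set" where
  "cells = {v. shape n v}"

definition cell_le :: "D_vertex rel" where
  "cell_le = {(k, l). k \<in> cells \<and> l \<in> cells \<and> below k l}"

definition tableaux :: "D_vertex \<Rightarrow> (nat \<Rightarrow> D_vertex) set" where
  "tableaux l = {S \<in> paths n. S n = l}"

definition basis_elt :: "D_vertex \<Rightarrow> (nat \<Rightarrow> D_vertex) \<Rightarrow> (nat \<Rightarrow> D_vertex) \<Rightarrow> 'a" where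
  "basis_elt l S T = cel n S T"

lemma cell_word_gens: "set (cell_word n S T) \<subseteq> gens n"
  using path_word_gens[of n S] path_word_gens[of n T] cups_gens[of n "S n"] gens_mono[of "n - 1" n]
  by (auto simp: cell_word_def)

lemma path_end_cells: "S \<in> paths n \<Longrightarrow> S n \<in> cells"
  using is_path_shape[of n S n] n2 by (simp add: cells_def paths_def)

lemma straight_g:
  assumes "shape n v" "x \<in> Mon n"
  shows "straight n v (x \<otimes> g n v)"
proof (cases "n = level v")
  case True
  then show ?thesis using straight_full[of n] assms n2 by simp
next
  case False
  then obtain k where k: "n = Suc (Suc k)" "level v \<le> k" "shape k v" using assms by (metis shape_Suc_Suc)
  show ?thesis
  proof (cases "k = 0")
    case True
    then show ?thesis using straight_2 k assms by (simp add: numeral_2_eq_2)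
  next
    case False
    then show ?thesis using straight_all[OF spanned_all] k assms by simp
  qed
qed

text \<open>At the vertex \<open>Node n\<close> the cup word is empty, so spanning applies to a bare
  word.\<close>

lemma val_cel:
  assumes "set w \<subseteq> gens n"
  shows "\<exists>r. \<exists>S\<in>paths n. \<exists>T\<in>paths n. S n = T n \<and> val w = r \<odot> cel n S T"
proof -
  have "shape n (Node n)" by (simp add: shape_def)
  then obtain r S T where "S \<in> paths n" "T \<in> paths n" "S n = T n"
    "val w \<otimes> g n (Node n) \<otimes> \<one> = r \<odot> cel n S T"
    using spanned_all[OF n2 order_refl] Mon_val[OF assms] Mon_one unfolding spanned_def by blast
  then show ?thesis by auto
qed

lemma cell_kernel:
  assumes "2 \<le> z" "S \<in> paths n" "T \<in> paths n" "S n = T n" "P \<in> paths n"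
  shows "0 < ev z (cel n S T) S T"
    and "\<lbrakk>ev z (cel n S T) P Q \<noteq> 0; 1 \<le> j; j \<le> n\<rbrakk> \<Longrightarrow> below (P j) (S j) \<and> below (Q j) (T j)"
proof -
  interpret path_rep "real_of_int z" n by unfold_locales (use assms in simp)
  show "0 < ev z (cel n S T) S T"
    using kernel_pos[OF n2 assms(2-4)] ev_val[OF cell_word_gens assms(1)] by simp
  show "\<lbrakk>ev z (cel n S T) P Q \<noteq> 0; 1 \<le> j; j \<le> n\<rbrakk> \<Longrightarrow> below (P j) (S j) \<and> below (Q j) (T j)"
    using kernel_support[OF n2 assms(2-5)] ev_val[OF cell_word_gens assms(1)] by simp
qed

lemma paths_eqI:
  assumes "S \<in> paths n" "T \<in> paths n" "\<And>j. 1 \<le> j \<Longrightarrow> j \<le> n \<Longrightarrow> S j = T j"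
  shows "S = T"
proof
  fix j show "S j = T j"
    using assms by (cases "j = 0 \<or> n < j") (auto simp: paths_def)
qed

text \<open>A numerical height compatible with the stepwise order of paths; it turns the partial
  order into one in which a maximal index can be chosen.\<close>

definition weight :: "(nat \<Rightarrow> D_vertex) \<Rightarrow> nat" where
  "weight S = (\<Sum>j\<in>{1..n}. level (S j))"

lemma weight_mono:
  assumes "\<And>j. 1 \<le> j \<Longrightarrow> j \<le> n \<Longrightarrow> below (P j) (S j)"
  shows "weight P \<le> weight S"
  unfolding weight_def using assms by (intro sum_mono) (fastforce simp: below_def)

lemma weight_eq:
  assumes "P \<in> paths n" "S \<in> paths n" "\<And>j. 1 \<le> j \<Longrightarrow> j \<le> n \<Longrightarrow> below (P j) (S j)" "weight S \<le> weight P"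
  shows "P = S"
proof (rule paths_eqI[OF assms(1,2)])
  fix j assume j: "1 \<le> j" "j \<le> n"
  show "P j = S j"
  proof (rule ccontr)
    assume "P j \<noteq> S j"
    then have "level (P j) < level (S j)" using assms(3)[OF j] by (simp add: below_def)
    then have "weight P < weight S"
      unfolding weight_def using assms(3) j
      by (intro sum_strict_mono_ex1) (fastforce simp: below_def)+
    then show False using assms(4) by simp
  qed
qed

text \<open>The support bound admits only smaller weights, with equality at the index itself alone.
  This is the triangularity behind injectivity and independence.\<close>

lemma cell_maximal:
  assumes "2 \<le> z" "S \<in> paths n" "T \<in> paths n" "S n = T n" "P \<in> paths n" "Q \<in> paths n"
    "ev z (cel n S T) P Q \<noteq> 0" "weight S + weight T \<le> weight P + weight Q"
  shows "P = S" "Q = T"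
proof -
  have below: "below (P j) (S j)" "below (Q j) (T j)" if "1 \<le> j" "j \<le> n" for j
    using cell_kernel(2)[OF assms(1-5,7) that] by auto
  have "weight P \<le> weight S" "weight Q \<le> weight T" using below by (auto intro: weight_mono)
  then show "P = S" "Q = T" using weight_eq below assms by auto
qed

text \<open>Of two equal cell elements, take the one whose index has the larger weight. Its entry at
  that index is positive, so the other element has it as well, and \<open>cell_maximal\<close>
  identifies the indices.\<close>

lemma cel_inj:
  assumes "S \<in> paths n" "T \<in> paths n" "S n = T n" "S' \<in> paths n" "T' \<in> paths n" "S' n = T' n"
    "cel n S T = cel n S' T'"
  shows "S = S' \<and> T = T'"
proof -
  have w: "S = S' \<and> T = T'" if "S \<in> paths n" "T \<in> paths n" "S n = T n" "S' \<in> paths n" "T' \<in> paths n" "S' n = T' n"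
    "cel n S T = cel n S' T'" "weight S + weight T \<le> weight S' + weight T'" for S T S' T'
  proof -
    have "ev 2 (cel n S T) S' T' \<noteq> 0" using cell_kernel(1)[of 2 S' T' S'] that by simp
    from cell_maximal[OF _ that(1,2,3,4,5) this that(8)] show ?thesis by simp
  qed
  show ?thesis
    using w[of S T S' T'] w[of S' T' S T] assms by (cases "weight S + weight T \<le> weight S' + weight T'") auto
qed

abbreviation basis :: "'a set" where
  "basis \<equiv> (\<lambda>(l, S, T). basis_elt l S T) ` (SIGMA l:cells. tableaux l \<times> tableaux l)"

lemma basis_iff: "x \<in> basis \<longleftrightarrow> (\<exists>S\<in>paths n. \<exists>T\<in>paths n. S n = T n \<and> x = cel n S T)"
proof
  assume "\<exists>S\<in>paths n. \<exists>T\<in>paths n. S n = T n \<and> x = cel n S T"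
  then obtain S T where "S \<in> paths n" "T \<in> paths n" "S n = T n" "x = cel n S T" by blast
  then show "x \<in> basis" using path_end_cells
    by (intro image_eqI[of _ _ "(S n, S, T)"]) (auto simp: basis_elt_def tableaux_def)
next
  assume "x \<in> basis"
  then obtain S T where "S \<in> paths n" "T \<in> paths n" "S n = T n" "x = cel n S T"
    by (auto simp: basis_elt_def tableaux_def)
  then show "\<exists>S\<in>paths n. \<exists>T\<in>paths n. S n = T n \<and> x = cel n S T" by blast
qed

lemma basis_closed: "basis \<subseteq> carrier A"
  unfolding subset_iff basis_iff by auto

lemma ev_zero: "2 \<le> z \<Longrightarrow> ev z \<zero> P Q = 0"
  using ev_smult[of \<zero> z 0 P Q] smult_r_null[of 0] by simp

lemma ev_finsum:
  assumes "2 \<le> z" "finite F" "F \<subseteq> carrier A"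
  shows "ev z (\<Oplus>b\<in>F. c b \<odot> b) P Q = (\<Sum>b\<in>F. real_of_int (poly (c b) z) * ev z b P Q)"
  using assms(2,3)
proof (induction F rule: finite_induct)
  case empty
  then show ?case using ev_zero[OF assms(1)] by simp
next
  case (insert x F)
  then have "(\<Oplus>b\<in>insert x F. c b \<odot> b) = c x \<odot> x \<oplus> (\<Oplus>b\<in>F. c b \<odot> b)"
    by (intro finsum_insert) auto
  then show ?case using insert assms(1)
    by (simp add: ev_add ev_smult finsum_closed subset_iff Pi_def)
qed

text \<open>Among the terms with non-zero coefficient take one of maximal weight. By triangularity
  the matrix entry at its index isolates its coefficient, a polynomial which then vanishes at every
  integer \<open>z \<ge> 2\<close>.\<close>

lemma basis_independent: "linearly_independent Z_delta A basis"
  unfolding linearly_independent_def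
proof (intro allI impI)
  fix F and c :: "'a \<Rightarrow> int poly"
  assume F: "finite F" "F \<subseteq> basis" and zero: "(\<Oplus>b\<in>F. c b \<odot> b) = \<zero>"
  define D where "D = {b \<in> F. c b \<noteq> 0}"
  show "\<forall>b\<in>F. c b = \<zero>\<^bsub>Z_delta\<^esub>"
  proof (rule ccontr)
    assume "\<not> ?thesis"
    then have D: "finite D" "D \<noteq> {}" using F by (auto simp: D_def)
    have "\<forall>b\<in>F. \<exists>S T. S \<in> paths n \<and> T \<in> paths n \<and> S n = T n \<and> b = cel n S T"
      using F(2) unfolding subset_iff basis_iff by blast
    then obtain s t where st: "\<And>b. b \<in> F \<Longrightarrow> s b \<in> paths n \<and> t b \<in> paths n \<and> s b n = t b n \<and> b = cel n (s b) (t b)"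
      by metis
    define wt where "wt b = weight (s b) + weight (t b)" for b
    have "Max (wt ` D) \<in> wt ` D" using D by (intro Max_in) auto
    then obtain x where x: "x \<in> D" "wt x = Max (wt ` D)" by auto
    then have wx: "wt b \<le> wt x" if "b \<in> D" for b using D that by simp
    have xF: "x \<in> F" "c x \<noteq> 0" using x by (auto simp: D_def)
    have "poly (c x) z = 0" if z: "2 \<le> z" for z
    proof -
      let ?e = "\<lambda>b. real_of_int (poly (c b) z) * ev z b (s x) (t x)"
      have other: "?e b = 0" if b: "b \<in> F - {x}" for b
      proof (rule ccontr)
        assume nz: "?e b \<noteq> 0"
        then have "b \<in> D" using b by (auto simp: D_def)
        then have "wt b \<le> wt x" by (rule wx)
        moreover have "ev z (cel n (s b) (t b)) (s x) (t x) \<noteq> 0" using nz st[of b] b by auto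
        ultimately have "s x = s b" "t x = t b"
          using cell_maximal[OF z, of "s b" "t b" "s x" "t x"] st[of b] st[OF xF(1)] b by (auto simp: wt_def)
        then have "b = x" using st[of b] st[OF xF(1)] b by simp
        then show False using b by simp
      qed
      have "0 = ev z (\<Oplus>b\<in>F. c b \<odot> b) (s x) (t x)" using zero ev_zero[OF z] by simp
      also have "\<dots> = (\<Sum>b\<in>F. ?e b)" using F basis_closed by (intro ev_finsum z) auto
      also have "\<dots> = ?e x + sum ?e (F - {x})" using F(1) xF(1) by (rule sum.remove)
      also have "sum ?e (F - {x}) = 0" using other by (intro sum.neutral) blast
      finally have "?e x = 0" by simp
      moreover have "0 < ev z x (s x) (t x)"
        using cell_kernel(1)[OF z, of "s x" "t x" "s x"] st[OF xF(1)] by simp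
      ultimately show ?thesis by simp
    qed
    then have "{2..} \<subseteq> {z. poly (c x) z = 0}" by auto
    then have "infinite {z. poly (c x) z = 0}" using infinite_Ici infinite_super by blast
    then show False using poly_roots_finite[OF xF(2)] by simp
  qed
qed

lemma basis_generates: "generated_submodule Z_delta A basis = carrier A"
proof
  show "generated_submodule Z_delta A basis \<subseteq> carrier A"
    using basis_closed by (rule generated_submodule_closed)
  show "carrier A \<subseteq> generated_submodule Z_delta A basis"
  proof
    fix x assume "x \<in> carrier A"
    then show "x \<in> generated_submodule Z_delta A basis"
    proof (rule carrier_induct)
      show "\<zero> \<in> generated_submodule Z_delta A basis" by (rule generated_submodule_zero)
      fix y c w assume y: "y \<in> generated_submodule Z_delta A basis" and w: "set w \<subseteq> gens n"
      obtain r S T where "S \<in> paths n" "T \<in> paths n" "S n = T n" "val w = r \<odot> cel n S T"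
        using val_cel[OF w] by blast
      then have "cel n S T \<in> basis" unfolding basis_iff by blast
      then have "val w \<in> generated_submodule Z_delta A basis"
        unfolding \<open>val w = r \<odot> cel n S T\<close>
        by (intro generated_submodule_smult generated_submodule_inc) auto
      then show "y \<oplus> c \<odot> val w \<in> generated_submodule Z_delta A basis"
        using y by (intro generated_submodule_add generated_submodule_smult) auto
    qed
  qed
qed

section \<open>Multiplication modulo lower cells\<close>

abbreviation low :: "D_vertex \<Rightarrow> 'a set" where
  "low l \<equiv> cell_lower Z_delta A cells cell_le tableaux basis_elt l"

lemma low_add: "x \<in> low l \<Longrightarrow> y \<in> low l \<Longrightarrow> x \<oplus> y \<in> low l"
  and low_smult: "x \<in> low l \<Longrightarrow> c \<odot> x \<in> low l"
  and low_zero: "\<zero> \<in> low l"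
  unfolding cell_lower_def
  by (intro generated_submodule_add generated_submodule_smult generated_submodule_zero; simp)+

text \<open>Spanning rewrites the product as a multiple of one cell element whose end has smaller
  level than \<open>l\<close>, and which is thus a generator of the lower submodule.\<close>

lemma lower_low:
  assumes "x \<in> lower n (level l)" "shape n l"
  shows "x \<in> low l"
proof -
  obtain p q v where x: "x = p \<otimes> g n v \<otimes> q" "p \<in> Mon n" "q \<in> Mon n" "shape n v" "level v < level l"
    using assms(1) by (auto simp: lower_def)
  obtain r S T where S: "S \<in> paths n" "T \<in> paths n" "S n = T n" "below (S n) v" "x = r \<odot> cel n S T"
    using spanned_all[OF n2 order_refl] x(2-4) unfolding spanned_def x(1) by blast
  have "level (S n) < level l" using S(4) x(5) by (auto simp: below_def)
  then have "cel n S T \<in> low l"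
    unfolding cell_lower_def using S assms(2) path_end_cells[of S]
    by (intro generated_submodule_inc CollectI exI[of _ "S n"] exI[of _ S] exI[of _ T])
       (auto simp: basis_elt_def tableaux_def cell_le_def cells_def below_def)
  then show ?thesis using S(5) low_smult by simp
qed

abbreviation comb :: "D_vertex \<Rightarrow> ((nat \<Rightarrow> D_vertex) \<Rightarrow> int poly) \<Rightarrow> (nat \<Rightarrow> D_vertex) \<Rightarrow> 'a" where
  "comb l \<rho> T \<equiv> (\<Oplus>S'\<in>tableaux l. \<rho> S' \<odot> basis_elt l S' T)"

lemma finite_tableaux: "finite (tableaux l)"
  by (simp add: tableaux_def finite_paths)

lemma basis_elt_closed [simp]: "basis_elt l S T \<in> carrier A"
  by (simp add: basis_elt_def)

lemma comb_closed [simp]: "comb l \<rho> T \<in> carrier A"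
  by (intro finsum_closed) auto

lemma comb_single:
  assumes "S \<in> tableaux l"
  shows "comb l (\<lambda>S'. if S' = S then r else 0) T = r \<odot> basis_elt l S T"
proof -
  have "comb l (\<lambda>S'. if S' = S then r else 0) T
    = (\<Oplus>S'\<in>tableaux l. if S = S' then r \<odot> basis_elt l S' T else \<zero>)"
    using smult_l_null by (intro finsum_cong') auto
  also have "\<dots> = r \<odot> basis_elt l S T"
    using add.finprod_singleton[OF assms finite_tableaux, of "\<lambda>S'. r \<odot> basis_elt l S' T"] by (simp add: finsum_def)
  finally show ?thesis .
qed

lemma comb_zero: "comb l (\<lambda>_. 0) T = \<zero>"
proof -
  have "comb l (\<lambda>_. 0) T = (\<Oplus>S'\<in>tableaux l. \<zero>)"
    using smult_l_null by (intro finsum_cong') auto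
  then show ?thesis by simp
qed

lemma comb_add:
  "comb l (\<lambda>S. \<rho> S + c * \<tau> S) T = comb l \<rho> T \<oplus> c \<odot> comb l \<tau> T"
proof -
  have R: "x + y = x \<oplus>\<^bsub>Z_delta\<^esub> y" "x * y = x \<otimes>\<^bsub>Z_delta\<^esub> y" for x y :: "int poly"
    by (simp_all add: ring_of_type_algebra_def)
  have "c \<odot> comb l \<tau> T = (\<Oplus>S\<in>tableaux l. c \<odot> (\<tau> S \<odot> basis_elt l S T))"
    by (rule finsum_smult_ldistr) (auto simp: finite_tableaux)
  moreover have "comb l (\<lambda>S. \<rho> S + c * \<tau> S) T
    = (\<Oplus>S\<in>tableaux l. \<rho> S \<odot> basis_elt l S T \<oplus> c \<odot> (\<tau> S \<odot> basis_elt l S T))"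
    unfolding R by (intro finsum_cong') (auto simp: smult_l_distr smult_assoc1)
  ultimately show ?thesis by (simp add: finsum_addf)
qed

text \<open>\<open>T\<close> enters only through the factor \<open>star (u n T)\<close> on the
  right, whereas straightening concerns what stands to its left; so one \<open>\<rho>\<close> serves
  all \<open>T\<close>. The induction over \<open>a\<close> reduces to words, for which at most one
  coefficient is non-zero.\<close>

lemma mult_basis:
  assumes l: "l \<in> cells" and S: "S \<in> tableaux l" and a: "a \<in> carrier A"
  shows "\<exists>\<rho>. \<forall>T\<in>tableaux l. a \<otimes> basis_elt l S T \<ominus> comb l \<rho> T \<in> low l"
  using a
proof (rule carrier_induct)
  show "\<exists>\<rho>. \<forall>T\<in>tableaux l. \<zero> \<otimes> basis_elt l S T \<ominus> comb l \<rho> T \<in> low l"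
    by (rule exI[of _ "\<lambda>_. 0"]) (simp add: comb_zero low_zero minus_eq)
next
  fix y c w
  assume y: "y \<in> carrier A" and w: "set w \<subseteq> gens n"
    and "\<exists>\<rho>. \<forall>T\<in>tableaux l. y \<otimes> basis_elt l S T \<ominus> comb l \<rho> T \<in> low l"
  then obtain \<rho> where \<rho>: "\<And>T. T \<in> tableaux l \<Longrightarrow> y \<otimes> basis_elt l S T \<ominus> comb l \<rho> T \<in> low l" by blast
  have l': "shape n l" and S': "S \<in> paths n" "S n = l" using l S by (auto simp: cells_def tableaux_def)
  have "straight n l ((val w \<otimes> u n S) \<otimes> g n l)"
    by (intro straight_g l' Mon_mult Mon_val[OF w] u_Mon)
  then have "\<exists>\<tau>. \<forall>T\<in>tableaux l. val w \<otimes> basis_elt l S T \<ominus> comb l \<tau> T \<in> low l"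
    unfolding straight_def
  proof
    assume "\<exists>r\<in>carrier Z_delta. \<exists>S'\<in>paths n. S' n = l \<and> val w \<otimes> u n S \<otimes> g n l = r \<odot> (u n S' \<otimes> g n l)"
    then obtain r R where R: "R \<in> tableaux l" "val w \<otimes> u n S \<otimes> g n l = r \<odot> (u n R \<otimes> g n l)"
      by (auto simp: tableaux_def)
    have "val w \<otimes> basis_elt l S T = r \<odot> basis_elt l R T" for T
    proof -
      have "val w \<otimes> basis_elt l S T = (val w \<otimes> u n S \<otimes> g n l) \<otimes> star (u n T)"
        by (simp add: basis_elt_def cel_eq S' m_assoc)
      also have "\<dots> = r \<odot> basis_elt l R T"
        using R(1) unfolding R(2) by (simp add: basis_elt_def cel_eq tableaux_def smult_mult_left)
      finally show ?thesis .
    qed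
    then show ?thesis
      using R(1) by (intro exI[of _ "\<lambda>S'. if S' = R then r else 0"]) (simp add: comb_single minus_eq r_neg low_zero)
  next
    assume low: "val w \<otimes> u n S \<otimes> g n l \<in> lower n (level l)"
    have "val w \<otimes> basis_elt l S T \<in> low l" for T
    proof -
      have "val w \<otimes> basis_elt l S T = (val w \<otimes> u n S \<otimes> g n l) \<otimes> star (u n T)"
        by (simp add: basis_elt_def cel_eq S' m_assoc)
      then show ?thesis
        using lower_mult_right[OF low star_Mon[OF u_Mon]] lower_low l' by simp
    qed
    then show ?thesis
      by (intro exI[of _ "\<lambda>_. 0"]) (simp add: comb_zero minus_eq)
  qed
  then obtain \<tau> where \<tau>: "\<And>T. T \<in> tableaux l \<Longrightarrow> val w \<otimes> basis_elt l S T \<ominus> comb l \<tau> T \<in> low l" by blast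
  show "\<exists>\<rho>. \<forall>T\<in>tableaux l. (y \<oplus> c \<odot> val w) \<otimes> basis_elt l S T \<ominus> comb l \<rho> T \<in> low l"
  proof (intro exI[of _ "\<lambda>S. \<rho> S + c * \<tau> S"] ballI)
    fix T assume T: "T \<in> tableaux l"
    let ?B = "basis_elt l S T"
    have "(y \<oplus> c \<odot> val w) \<otimes> ?B \<ominus> comb l (\<lambda>S. \<rho> S + c * \<tau> S) T
      = (y \<otimes> ?B \<oplus> c \<odot> (val w \<otimes> ?B)) \<ominus> (comb l \<rho> T \<oplus> c \<odot> comb l \<tau> T)"
      using y by (simp add: comb_add l_distr smult_mult_left)
    also have "\<dots> = (y \<otimes> ?B \<ominus> comb l \<rho> T) \<oplus> c \<odot> (val w \<otimes> ?B \<ominus> comb l \<tau> T)"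
      using y by (simp add: minus_eq smult_r_distr smult_r_minus minus_add a_ac)
    also have "\<dots> \<in> low l" using \<rho>[OF T] \<tau>[OF T] by (intro low_add low_smult)
    finally show "(y \<oplus> c \<odot> val w) \<otimes> ?B \<ominus> comb l (\<lambda>S. \<rho> S + c * \<tau> S) T \<in> low l" .
  qed
qed

lemma partial_order_cell_le: "partial_order_on cells cell_le"
  unfolding partial_order_on_def preorder_on_def
  by (auto simp: cell_le_def refl_on_def trans_def antisym_def below_def)

lemma is_cell_datum: "cell_datum Z_delta A cells cell_le tableaux basis_elt star"
proof unfold_locales
  show "partial_order_on cells cell_le" by (rule partial_order_cell_le)
  show "finite (tableaux l)" for l by (rule finite_tableaux)
  show "inj_on (\<lambda>(l, S, T). basis_elt l S T) (SIGMA l:cells. tableaux l \<times> tableaux l)"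
  proof (rule inj_onI)
    fix x y
    assume x: "x \<in> (SIGMA l:cells. tableaux l \<times> tableaux l)" and y: "y \<in> (SIGMA l:cells. tableaux l \<times> tableaux l)"
      and eq: "(case x of (l, S, T) \<Rightarrow> basis_elt l S T) = (case y of (l, S, T) \<Rightarrow> basis_elt l S T)"
    obtain l S T where x': "x = (l, S, T)" by (cases x) auto
    obtain l' S' T' where y': "y = (l', S', T')" by (cases y) auto
    have "S = S' \<and> T = T'"
      using x y eq unfolding x' y' by (intro cel_inj) (simp_all add: basis_elt_def tableaux_def)
    then show "x = y" using x y unfolding x' y' by (auto simp: tableaux_def)
  qed
  show "module_basis Z_delta A basis"
    unfolding module_basis_def using basis_closed basis_independent basis_generates by simp
  show "star (basis_elt l S T) = basis_elt l T S" if "S \<in> tableaux l" "T \<in> tableaux l" for l S T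
    using that star_cel[of n S T] by (simp add: basis_elt_def tableaux_def)
  show "\<exists>r. (\<forall>S'\<in>tableaux l. \<forall>S\<in>tableaux l. r S' S \<in> carrier Z_delta) \<and>
      (\<forall>S\<in>tableaux l. \<forall>T\<in>tableaux l. a \<otimes> basis_elt l S T \<ominus> comb l (\<lambda>S'. r S' S) T \<in> low l)"
    if l: "l \<in> cells" and a: "a \<in> carrier A" for l a
  proof -
    have "\<forall>S\<in>tableaux l. \<exists>\<rho>. \<forall>T\<in>tableaux l. a \<otimes> basis_elt l S T \<ominus> comb l \<rho> T \<in> low l"
      by (intro ballI mult_basis l a)
    from bchoice[OF this] obtain \<rho> where
      "\<forall>S\<in>tableaux l. \<forall>T\<in>tableaux l. a \<otimes> basis_elt l S T \<ominus> comb l (\<rho> S) T \<in> low l" ..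
    then show ?thesis by (intro exI[of _ "\<lambda>S' S. \<rho> S S'"]) simp
  qed
qed (auto simp: star_add star_smult star_mult star_star)

end

section \<open>The path representation of the free algebra\<close>

context path_rep begin

lemma op_linear: "op w (\<lambda>P. a * \<phi> P + b * \<psi> P) P = a * op w \<phi> P + b * op w \<psi> P"
proof (induction w arbitrary: P)
  case (Cons v w)
  have "op w (\<lambda>P. a * \<phi> P + b * \<psi> P) = (\<lambda>P. a * op w \<phi> P + b * op w \<psi> P)"
    using Cons by auto
  then show ?case by (simp add: op_Cons act_linear)
qed simp

lemma op_zero: "op w (\<lambda>_. 0) P = 0"
  using op_linear[of w 0 "\<lambda>_. 0" 0 "\<lambda>_. 0" P] by simp

end

locale free_path_rep = path_rep "real_of_int z" n for z n
begin

text \<open>The linear extension of \<open>op\<close>, with \<open>\<delta>\<close> specialised to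
  the integer \<open>z\<close> by evaluating every coefficient there.\<close>

definition rho :: "(D_vertex free_word \<Rightarrow>\<^sub>0 int poly) \<Rightarrow> ((nat \<Rightarrow> D_vertex) \<Rightarrow> real) \<Rightarrow> (nat \<Rightarrow> D_vertex) \<Rightarrow> real" where
  "rho f \<phi> P = (\<Sum>w\<in>Poly_Mapping.keys f.
     real_of_int (poly (Poly_Mapping.lookup f w) z) * op (letters w) \<phi> P)"

lemma rho_superset:
  assumes "finite K" "Poly_Mapping.keys f \<subseteq> K"
  shows "rho f \<phi> P = (\<Sum>w\<in>K. real_of_int (poly (Poly_Mapping.lookup f w) z) * op (letters w) \<phi> P)"
  unfolding rho_def using assms by (intro sum.mono_neutral_left) (auto simp: in_keys_iff)

lemma rho_add: "rho (f + g) \<phi> P = rho f \<phi> P + rho g \<phi> P"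
proof -
  let ?K = "Poly_Mapping.keys f \<union> Poly_Mapping.keys g"
  have K: "finite ?K" "Poly_Mapping.keys f \<subseteq> ?K" "Poly_Mapping.keys g \<subseteq> ?K" "Poly_Mapping.keys (f + g) \<subseteq> ?K"
    using keys_add[of f g] by auto
  show ?thesis
    unfolding rho_superset[OF K(1,2)] rho_superset[OF K(1,3)] rho_superset[OF K(1,4)]
    by (simp add: lookup_add distrib_right sum.distrib)
qed

lemma rho_zero: "rho 0 \<phi> P = 0"
  by (simp add: rho_def)

lemma rho_single: "rho (Poly_Mapping.single w c) \<phi> P = real_of_int (poly c z) * op (letters w) \<phi> P"
  by (simp add: rho_def)

lemma rho_diff: "rho (f - g) \<phi> P = rho f \<phi> P - rho g \<phi> P"
  using rho_add[of "f - g" g \<phi> P] by simp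

lemma rho_uminus: "rho (- f) \<phi> P = - rho f \<phi> P"
  using rho_diff[of 0 f \<phi> P] by (simp add: rho_zero)

text \<open>Bilinearity reduces the claim to two words, whose concatenation acts as the composition
  by \<open>op_append\<close>.\<close>

lemma rho_mult: "rho (f * g) \<phi> P = rho f (rho g \<phi>) P"
proof (induction f rule: poly_mapping_induct_add)
  case (add f w c)
  have "rho (Poly_Mapping.single w c * g) \<phi> P = real_of_int (poly c z) * op (letters w) (rho g \<phi>) P"
  proof (induction g rule: poly_mapping_induct_add)
    case zero
    have "rho 0 \<phi> = (\<lambda>_. 0)" by (simp add: rho_zero fun_eq_iff)
    then show ?case by (simp add: rho_zero op_zero)
  next
    case (add g w' c')
    have "rho (g + Poly_Mapping.single w' c') \<phi>
      = (\<lambda>P. 1 * rho g \<phi> P + real_of_int (poly c' z) * op (letters w') \<phi> P)"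
      by (simp add: rho_add rho_single fun_eq_iff)
    then have eq: "op (letters w) (rho (g + Poly_Mapping.single w' c') \<phi>) P
      = op (letters w) (rho g \<phi>) P + real_of_int (poly c' z) * op (letters w) (op (letters w') \<phi>) P"
      using op_linear[of "letters w" 1 "rho g \<phi>" "real_of_int (poly c' z)" "op (letters w') \<phi>" P] by simp
    have "rho (Poly_Mapping.single w c * (g + Poly_Mapping.single w' c')) \<phi> P
      = real_of_int (poly c z) * (op (letters w) (rho g \<phi>) P +
          real_of_int (poly c' z) * op (letters w) (op (letters w') \<phi>) P)"
      using add by (simp add: distrib_left rho_add rho_single mult_single plus_free_word_def op_append)
    then show ?case unfolding eq .
  qed
  then show ?case using add by (simp add: distrib_right rho_add rho_single)
qed (simp add: rho_zero)

lemma rho_gen: "rho (free_gen v) \<phi> = act v \<phi>"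
  by (simp add: fun_eq_iff free_gen_def rho_single op_Cons)

lemma rho_scale: "rho (Poly_Mapping.single 0 c * f) \<phi> P = real_of_int (poly c z) * rho f \<phi> P"
  by (simp add: rho_mult rho_single zero_free_word_def)

lemma rho_null: "(\<And>P. \<phi> P = 0) \<Longrightarrow> rho f \<phi> P = 0"
proof -
  assume "\<And>P. \<phi> P = 0"
  then have "\<phi> = (\<lambda>_. 0)" by auto
  then show ?thesis by (simp add: rho_def op_zero)
qed

text \<open>The elements that act as zero form an ideal. It contains all relations by
  \<open>act_sq\<close>, \<open>act_commute\<close>, \<open>act_braid\<close> and
  \<open>act_pair\<close>, so \<open>cls_kernel\<close> applies.\<close>

lemma rho_kernel:
  assumes n: "2 \<le> n" and f: "f \<in> carrier (free_algebra (D_vertices n))"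
    "pair_free_presentation.cls n f = \<zero>\<^bsub>pair_free_TL_D n\<^esub>"
  shows "rho f \<phi> P = 0"
proof -
  interpret pair_free_presentation n by unfold_locales (rule n)
  define Z where "Z = {f \<in> carrier F. \<forall>\<phi> P. rho f \<phi> P = 0}"
  have "ideal Z F"
  proof (rule free_algebra_idealI)
    show "0 \<in> Z" by (simp add: Z_def rho_zero F_zero_closed)
    show "f + g \<in> Z" if "f \<in> Z" "g \<in> Z" for f g
      using that by (simp add: Z_def rho_add F_add_closed)
    show "- f \<in> Z" if "f \<in> Z" for f
      using that by (simp add: Z_def rho_uminus F_uminus_closed)
    show "g * f \<in> Z" if "f \<in> Z" "g \<in> carrier F" for f g
      using that by (simp add: Z_def rho_mult rho_null F_mult_closed)
    show "f * g \<in> Z" if "f \<in> Z" "g \<in> carrier F" for f g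
      using that by (simp add: Z_def rho_mult F_mult_closed)
  qed (auto simp: Z_def)
  moreover have "TL_relations (D_vertices n) (D_edges n) \<subseteq> Z"
  proof
    fix f :: "D_vertex free_word \<Rightarrow>\<^sub>0 int poly"
    assume f: "f \<in> TL_relations (D_vertices n) (D_edges n)"
    then have "f \<in> carrier F" using TL_relations_in_free_algebra by blast
    moreover from f consider
        i where "i \<in> gens n" "f = free_gen i * free_gen i - Poly_Mapping.single 0 delta * free_gen i"
      | i j where "i \<in> gens n" "j \<in> gens n" "{i, j} \<notin> D_edges n"
          "f = free_gen i * free_gen j - free_gen j * free_gen i"
      | i j where "i \<in> gens n" "j \<in> gens n" "{i, j} \<in> D_edges n"
          "f = free_gen i * free_gen j * free_gen i - free_gen i"
      unfolding TL_relations_def mult_map_scale_conv_mult gens_eq_D_vertices[OF n] by blast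
    then have "rho f \<phi> P = 0" for \<phi> P
    proof cases
      case 1
      then show ?thesis by (simp add: rho_diff rho_mult[of "free_gen _"] rho_scale rho_gen act_sq delta_def)
    next
      case 2
      then show ?thesis by (simp add: rho_diff rho_mult rho_gen act_commute[OF 2(1-3)])
    next
      case 3
      then show ?thesis by (simp add: rho_diff rho_mult rho_gen act_braid)
    qed
    ultimately show "f \<in> Z" by (simp add: Z_def)
  qed
  moreover have "free_gen (Node 1) * free_gen Node_bar \<in> Z"
    using gen_closed[OF node_closed(1)] gen_closed[OF node_closed(2)]
    by (simp add: Z_def F_mult_closed rho_mult rho_gen act_pair del: One_nat_def)
  ultimately have "f \<in> Z" using cls_kernel f by blast
  then show ?thesis by (simp add: Z_def)
qed

end

section \<open>Matrix entries on the quotient and the concrete instance\<close>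

context pair_free_presentation begin

text \<open>Again a chosen representative is used. By \<open>ev_cls\<close> the choice does not
  matter for \<open>2 \<le> z\<close>, the range in which the path representation is
  available.\<close>

definition ev :: "int \<Rightarrow> (D_vertex free_word \<Rightarrow>\<^sub>0 int poly) set set \<Rightarrow> (nat \<Rightarrow> D_vertex) \<Rightarrow> (nat \<Rightarrow> D_vertex) \<Rightarrow> real" where
  "ev z x P Q = free_path_rep.rho z n (SOME f. f \<in> carrier F \<and> cls f = x) (\<lambda>Z. if Z = Q then 1 else 0) P"

lemma ev_cls:
  assumes "2 \<le> z" "f \<in> carrier F"
  shows "ev z (cls f) P Q = free_path_rep.rho z n f (\<lambda>Z. if Z = Q then 1 else 0) P"
proof -
  interpret free_path_rep z n by unfold_locales (use assms in simp)
  let ?g = "SOME g. g \<in> carrier F \<and> cls g = cls f"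
  have g: "?g \<in> carrier F \<and> cls ?g = cls f" by (rule someI[of _ f]) (use assms in simp)
  then have "rho (?g - f) (\<lambda>Z. if Z = Q then 1 else 0) P = 0"
    using cls_eq_iff assms n by (intro rho_kernel F_minus_closed) blast+
  then show ?thesis by (simp add: ev_def rho_diff)
qed

lemma F_single: "set (letters w) \<subseteq> D_vertices n \<Longrightarrow> Poly_Mapping.single w c \<in> carrier F"
  by (rule free_algebra_single)

lemma F_scalar: "Poly_Mapping.single 0 c \<in> carrier F"
  by (rule F_single) (simp add: zero_free_word_def)

lemma carrier_induct:
  assumes "x \<in> carrier (pair_free_TL_D n)" "p \<zero>\<^bsub>pair_free_TL_D n\<^esub>"
    "\<And>y c w. \<lbrakk>y \<in> carrier (pair_free_TL_D n); p y; set w \<subseteq> D_vertices n\<rbrakk> \<Longrightarrow>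
      p (y \<oplus>\<^bsub>pair_free_TL_D n\<^esub> c \<odot>\<^bsub>pair_free_TL_D n\<^esub> cls (Poly_Mapping.single (Word w) 1))"
  shows "p x"
proof -
  obtain f where f: "f \<in> carrier F" "x = cls f" using assms(1) by (auto simp: carrier_pair_free)
  from f(1) have "p (cls f)"
  proof (induction f rule: free_algebra_induct)
    case zero
    then show ?case using assms(2) by (simp add: cls_zero)
  next
    case (add f w c)
    have "cls (Poly_Mapping.single w c) = c \<odot>\<^bsub>pair_free_TL_D n\<^esub> cls (Poly_Mapping.single w 1)"
      using cls_smult[OF F_single[OF add(2)], of c 1] by (simp add: mult_single)
    then have "cls (f + Poly_Mapping.single w c) = cls f \<oplus>\<^bsub>pair_free_TL_D n\<^esub>
        c \<odot>\<^bsub>pair_free_TL_D n\<^esub> cls (Poly_Mapping.single (Word (letters w)) 1)"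
      using add F_single by (simp add: cls_add)
    then show ?case using add assms(3)[of "cls f" "letters w" c] cls_closed by simp
  qed
  then show ?thesis using f by simp
qed

lemma b_closed: "b v \<in> carrier (pair_free_TL_D n)"
  by (simp add: b_def cls_closed gen_closed)

lemma b_word:
  assumes "set w \<subseteq> D_vertices n"
  shows "foldr (\<lambda>v x. b v \<otimes>\<^bsub>pair_free_TL_D n\<^esub> x) w \<one>\<^bsub>pair_free_TL_D n\<^esub> = cls (Poly_Mapping.single (Word w) 1)"
  using assms
proof (induction w)
  case Nil
  then show ?case using cls_one by (simp flip: zero_free_word_def)
next
  case (Cons v w)
  have "Poly_Mapping.single (Word (v # w)) (1 :: int poly) = free_gen v * Poly_Mapping.single (Word w) 1"
    by (simp add: free_gen_def mult_single plus_free_word_def)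
  then show ?case
    using Cons F_single[of "Word w"] by (simp add: b_def cls_mult gen_closed)
qed

sublocale A: pair_free Z_delta "pair_free_TL_D n" n delta b
proof unfold_locales
  show "b (Node 1) \<otimes>\<^bsub>pair_free_TL_D n\<^esub> b Node_bar = \<zero>\<^bsub>pair_free_TL_D n\<^esub>"
    using cls_pair node_closed by (simp add: b_def)
  show "b v \<otimes>\<^bsub>pair_free_TL_D n\<^esub> b w = b w \<otimes>\<^bsub>pair_free_TL_D n\<^esub> b v"
    if "v \<in> gens n" "w \<in> gens n" "{v, w} \<notin> D_edges n" for v w
    using that unfolding gens_eq_D_vertices[OF n] by (rule b_relations(2))
qed (use n in \<open>simp_all only: gens_eq_D_vertices b_closed delta_closed b_relations\<close>)

lemma star_cellular: "pair_free_cellular (pair_free_TL_D n) n b star ev"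
proof unfold_locales
  fix x y c
  assume x: "x \<in> carrier (pair_free_TL_D n)"
  then obtain f where f: "f \<in> carrier F" "x = cls f" by (auto simp: carrier_pair_free)
  note sf = free_star_closed[OF f(1)]
  show "star x \<in> carrier (pair_free_TL_D n)" using f sf by (simp add: star_cls cls_closed)
  show "star (star x) = x" using f sf by (simp add: star_cls free_star_free_star)
  show "star (c \<odot>\<^bsub>pair_free_TL_D n\<^esub> x) = c \<odot>\<^bsub>pair_free_TL_D n\<^esub> star x"
    using f sf by (simp add: star_cls free_star_scale F_mult_closed F_scalar flip: cls_smult)
  show "ev z (c \<odot>\<^bsub>pair_free_TL_D n\<^esub> x) P Q = real_of_int (poly c z) * ev z x P Q" if "2 \<le> z" for z P Q
  proof -
    interpret free_path_rep z n by unfold_locales (use that in simp)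
    show ?thesis using f that by (simp add: ev_cls rho_scale F_mult_closed F_scalar flip: cls_smult)
  qed
  assume y: "y \<in> carrier (pair_free_TL_D n)"
  then obtain g where g: "g \<in> carrier F" "y = cls g" by (auto simp: carrier_pair_free)
  note sg = free_star_closed[OF g(1)]
  show "star (x \<otimes>\<^bsub>pair_free_TL_D n\<^esub> y) = star y \<otimes>\<^bsub>pair_free_TL_D n\<^esub> star x"
    using f g sf sg by (simp add: star_cls free_star_mult F_mult_closed flip: cls_mult)
  show "star (x \<oplus>\<^bsub>pair_free_TL_D n\<^esub> y) = star x \<oplus>\<^bsub>pair_free_TL_D n\<^esub> star y"
    using f g sf sg by (simp add: star_cls free_star_add F_add_closed flip: cls_add)
  show "ev z (x \<oplus>\<^bsub>pair_free_TL_D n\<^esub> y) P Q = ev z x P Q + ev z y P Q" if "2 \<le> z" for z P Q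
  proof -
    interpret free_path_rep z n by unfold_locales (use that in simp)
    show ?thesis using f g that by (simp add: ev_cls rho_add F_add_closed flip: cls_add)
  qed
next
  fix v
  have "(1 :: D_vertex free_word \<Rightarrow>\<^sub>0 int poly) \<in> carrier F"
    using F.one_closed by (simp only: free_algebra_sel(3))
  moreover have "free_star (1 :: D_vertex free_word \<Rightarrow>\<^sub>0 int poly) = 1"
    using free_star_single[of "0 :: D_vertex free_word" "1 :: int poly"]
    by (simp add: rev_word_def zero_free_word_def flip: single_one)
  ultimately have "star \<one>\<^bsub>pair_free_TL_D n\<^esub> = \<one>\<^bsub>pair_free_TL_D n\<^esub>"
    using star_cls[of 1] by (simp add: cls_one)
  then show "star (b v) = b v" by (simp add: b_def star_cls gen_closed free_star_gen)
next
  fix w :: "D_vertex list" and z :: int and P Q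
  assume w: "set w \<subseteq> gens n" and z: "2 \<le> z"
  interpret free_path_rep z n by unfold_locales (use z in simp)
  have "A.val w = cls (Poly_Mapping.single (Word w) 1)"
    using b_word w gens_eq_D_vertices[OF n] by (simp add: A.val_def)
  then show "ev z (A.val w) P Q = kernel w P Q"
    using w z F_single[of "Word w"] gens_eq_D_vertices[OF n]
    by (simp add: ev_cls rho_single kernel_def)
next
  fix x p
  show "p x"
    if "x \<in> carrier (pair_free_TL_D n)" "p \<zero>\<^bsub>pair_free_TL_D n\<^esub>"
      "\<And>y c w. \<lbrakk>y \<in> carrier (pair_free_TL_D n); p y; set w \<subseteq> gens n\<rbrakk> \<Longrightarrow>
        p (y \<oplus>\<^bsub>pair_free_TL_D n\<^esub> c \<odot>\<^bsub>pair_free_TL_D n\<^esub> A.val w)"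
  proof (rule carrier_induct[where p = p, OF that(1,2)])
    fix y c and w :: "D_vertex list"
    assume "y \<in> carrier (pair_free_TL_D n)" "p y" "set w \<subseteq> D_vertices n"
    then show "p (y \<oplus>\<^bsub>pair_free_TL_D n\<^esub> c \<odot>\<^bsub>pair_free_TL_D n\<^esub> cls (Poly_Mapping.single (Word w) 1))"
      using that(3)[of y w c] b_word[of w] gens_eq_D_vertices[OF n] by (simp add: A.val_def)
  qed
qed

end

theorem corollary3p3p8:
  fixes n :: nat
  assumes "4 \<le> n"
  shows "cellular_algebra Z_delta (pair_free_TL_D n)"
proof -
  interpret pair_free_presentation n by unfold_locales (use assms in simp)
  show ?thesis
    using cellular_algebraI[OF pair_free_cellular.is_cell_datum[OF star_cellular]] .
qed

end
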